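(* Consider the Newtonian $N$-body problem in a Euclidean space $E$ with $\dim E\ge2$ and masses $m_1,\dots,m_N>0$. For all $h\ge0$, the space $(E^N,\phi_h)$ is the completion of $(\Omega,d_h)$, via the inclusion $\Omega\subset E^N$.
   Context: $E$ is a finite-dimensional Euclidean space, $N\ge 2$, $m_1,\dots,m_N>0$. For $x=(r_1,\dots,r_N),\,y=(s_1,\dots,s_N)\in E^N$ the mass inner product is $\langle x,y\rangle=\sum_i m_i\langle r_i,s_i\rangle_E$, with norm $\|\cdot\|$. $U(x)=\sum_{i<j}m_im_j\|r_i-r_j\|_E^{-1}\in(0,+\infty]$ and $\Omega=\{x\in E^N:U(x)<+\infty\}$ (open and dense in $E^N$). The Jacobi-Maupertuis metric of level $h$ is the Riemannian metric $j_h=2(h+U)\,g_m$ on $\Omega$, $g_m$ being the metric of the mass inner product; $d_h$ is its Riemannian distance on $\Omega$ (infimum of lengths of piecewise $C^1$ curves in $\Omega$). For $x,y\in E^N$, $$\phi_h(x,y)=\inf_\gamma \int_a^b\Big(\tfrac12\|\dot\gamma\|^2+U(\gamma)+h\Big)\,dt,$$ the infimum being over all absolutely continuous curves $\gamma:[a,b]\to E^N$ (with $a<b$ arbitrary), $\gamma(a)=x$, $\gamma(b)=y$. *)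

theory Defs
  imports "HOL-Analysis.Analysis"
begin

text \<open>
  A configuration of bodies indexed by \<open>'n\<close> in the Euclidean space \<open>'e\<close> is a vector
  \<open>x :: 'e ^ 'n\<close>; the linear order on \<open>'n\<close> only serves to write sums over \<open>i < j\<close>.
\<close>

definition mass_inner :: "('n::finite \<Rightarrow> real) \<Rightarrow> ('e::euclidean_space, 'n) vec \<Rightarrow> ('e, 'n) vec \<Rightarrow> real"
  where "mass_inner m x y = (\<Sum>i\<in>UNIV. m i * (x $ i \<bullet> y $ i))"

definition mass_norm :: "('n::finite \<Rightarrow> real) \<Rightarrow> ('e::euclidean_space, 'n) vec \<Rightarrow> real"
  where "mass_norm m x = sqrt (mass_inner m x x)"

text \<open>
  Division in \<^typ>\<open>ennreal\<close> satisfies \<open>a / 0 = \<infinity>\<close> for \<open>a > 0\<close>, so the potential is infinite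
  exactly at the collisions.
\<close>

definition newton_potential ::
  "('n::{finite,linorder} \<Rightarrow> real) \<Rightarrow> ('e::euclidean_space, 'n) vec \<Rightarrow> ennreal"
  where "newton_potential m x =
    (\<Sum>(i, j)\<in>{(i, j). i < j}. ennreal (m i * m j) / ennreal (norm (x $ i - x $ j)))"

definition collision_free :: "('n::{finite,linorder} \<Rightarrow> real) \<Rightarrow> (('e::euclidean_space, 'n) vec) set"
  where "collision_free m = {x. newton_potential m x < \<infinity>}"


text \<open>
  The Jacobi-Maupertuis metric tensor at \<open>x\<close>, meaningful for \<open>x \<in> collision_free m\<close>.
\<close>

definition jm_metric ::
  "('n::{finite,linorder} \<Rightarrow> real) \<Rightarrow> real \<Rightarrow> ('e::euclidean_space, 'n) vec \<Rightarrow> ('e, 'n) vec \<Rightarrow> ('e, 'n) vec \<Rightarrow> real"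
  where "jm_metric m h x v w = 2 * (h + enn2real (newton_potential m x)) * mass_inner m v w"

text \<open>
  Velocities enter only through integrals, so their unspecified values on a null set of times
  are irrelevant.
\<close>

definition jm_length ::
  "('n::{finite,linorder} \<Rightarrow> real) \<Rightarrow> real \<Rightarrow> real \<Rightarrow> real \<Rightarrow> (real \<Rightarrow> ('e::euclidean_space, 'n) vec) \<Rightarrow> ennreal"
  where "jm_length m h a b \<gamma> =
    (\<integral>\<^sup>+ t\<in>{a..b}.
       ennreal (sqrt (jm_metric m h (\<gamma> t)
         (vector_derivative \<gamma> (at t within {a..b})) (vector_derivative \<gamma> (at t within {a..b}))))
     \<partial>lebesgue)"

definition jm_dist ::
  "('n::{finite,linorder} \<Rightarrow> real) \<Rightarrow> real \<Rightarrow> ('e::euclidean_space, 'n) vec \<Rightarrow> ('e, 'n) vec \<Rightarrow> ennreal"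
  where "jm_dist m h x y =
    Inf {jm_length m h a b \<gamma> | a b \<gamma>.
      a < b \<and> \<gamma> piecewise_C1_differentiable_on {a..b} \<and> \<gamma> ` {a..b} \<subseteq> collision_free m \<and>
      \<gamma> a = x \<and> \<gamma> b = y}"


definition absolutely_continuous_curve ::
  "real \<Rightarrow> real \<Rightarrow> (real \<Rightarrow> 'a::real_normed_vector) \<Rightarrow> bool"
  where "absolutely_continuous_curve a b \<gamma> \<longleftrightarrow>
    (\<forall>\<epsilon>>0. \<exists>\<delta>>0. \<forall>I :: (real \<times> real) set.
       finite I \<and> (\<forall>(s, t)\<in>I. a \<le> s \<and> s \<le> t \<and> t \<le> b) \<and>
       disjoint_family_on (\<lambda>(s, t). {s<..<t}) I \<and> (\<Sum>(s, t)\<in>I. t - s) < \<delta> \<longrightarrow>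
       (\<Sum>(s, t)\<in>I. norm (\<gamma> t - \<gamma> s)) < \<epsilon>)"

text \<open>The integral of the Lagrangian plus \<open>h\<close>; it is used for \<open>h \<ge> 0\<close> only.\<close>

definition lagrangian_action ::
  "('n::{finite,linorder} \<Rightarrow> real) \<Rightarrow> real \<Rightarrow> real \<Rightarrow> real \<Rightarrow> (real \<Rightarrow> ('e::euclidean_space, 'n) vec) \<Rightarrow> ennreal"
  where "lagrangian_action m h a b \<gamma> =
    (\<integral>\<^sup>+ t\<in>{a..b}.
       (ennreal (1/2 * (mass_norm m (vector_derivative \<gamma> (at t within {a..b})))\<^sup>2) +
        newton_potential m (\<gamma> t) + ennreal h)
     \<partial>lebesgue)"

definition action_potential ::
  "('n::{finite,linorder} \<Rightarrow> real) \<Rightarrow> real \<Rightarrow> ('e::euclidean_space, 'n) vec \<Rightarrow> ('e, 'n) vec \<Rightarrow> ennreal"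
  where "action_potential m h x y =
    Inf {lagrangian_action m h a b \<gamma> | a b \<gamma>.
      a < b \<and> absolutely_continuous_curve a b \<gamma> \<and> \<gamma> a = x \<and> \<gamma> b = y}"


definition is_metric_completion ::
  "'a set \<Rightarrow> ('a \<Rightarrow> 'a \<Rightarrow> real) \<Rightarrow> 'b set \<Rightarrow> ('b \<Rightarrow> 'b \<Rightarrow> real) \<Rightarrow> ('a \<Rightarrow> 'b) \<Rightarrow> bool"
  where "is_metric_completion S d M d' f \<longleftrightarrow>
    Metric_space S d \<and> Metric_space M d' \<and> Metric_space.mcomplete M d' \<and>
    f \<in> S \<rightarrow> M \<and> (\<forall>x\<in>S. \<forall>y\<in>S. d' (f x) (f y) = d x y) \<and>
    Metric_space.mtopology M d' closure_of (f ` S) = M"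

end

theory Submission
  imports Defs
begin

text \<open>
  Off the collisions both functions are one and the same geodesic distance. Let
  \<open>\<rho> = sqrt (2 * (h + U))\<close>. The inequality \<open>\<rho> * s \<le> s\<^sup>2 / 2 + U + h\<close> bounds the
  Jacobi-Maupertuis speed of a curve by the integrand of its action, and equality holds when the
  curve runs at speed \<open>s = \<rho>\<close>. Only the curves that compete differ: those of \<open>action_potential\<close>
  are absolutely continuous instead of piecewise \<open>C\<^sup>1\<close>, and they may run through collisions.

  The regularity of the curves is dealt with by \<open>cost_le_jm_length\<close>: a function that satisfies the
  triangle inequality and is at most \<open>R\<close> times the mass length on every collision-free segment where
  \<open>\<rho> \<le> R\<close> is bounded by the Jacobi-Maupertuis length of every collision-free curve that is the
  integral of its velocity. Applied to \<open>action_potential\<close> and to piecewise \<open>C\<^sup>1\<close> curves, this gives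
  \<open>action_potential \<le> jm_dist\<close>. Applied to \<open>jm_dist\<close>, it bounds \<open>jm_dist\<close> by the action of every
  absolutely continuous collision-free curve.

  Collisions are removed by a shift (\<open>jm_dist_le_action_potential\<close>). Give the bodies distinct weights
  \<open>c i\<close> and move the whole curve of body \<open>i\<close> by \<open>(\<kappa> * c i) *\<^sub>R v\<close>, with \<open>v\<close> in the unit ball of the
  ambient space. In dimension at least two, the average over \<open>v\<close> of the inverse distance of two bodies is
  at most a constant times the unshifted inverse distance, so by dominated convergence the average
  of the integral of the potential tends to the original integral as \<open>\<kappa>\<close> tends to zero. In
  the same dimensions the image of an absolutely continuous curve is a null set, so almost every \<open>v\<close>
  produces a curve without collisions.

  The same averages produce curves that leave a collision along \<open>t powr (3/4)\<close> with little action;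
  hence \<open>action_potential\<close> is finite, and small between nearby points
  (\<open>action_potential_upper_bound\<close>). Conversely \<open>U\<close> is at least a constant divided by the size of the
  configuration, which yields \<open>action_potential_lower_bound\<close>. The two estimates show that a Cauchy
  sequence for \<open>action_potential\<close> is a Cauchy sequence for the norm and that norm convergence implies
  convergence for \<open>action_potential\<close>. Completeness follows, and the density of the collision-free
  configurations carries over from the norm.

  What is used of real analysis is that an absolutely continuous curve is differentiable almost
  everywhere and is the integral of its derivative. The first part rests on the Vitali covering
  theorem, by way of monotone functions; the second is a direct estimate of Riemann sums.
\<close>

section \<open>Differentiability almost everywhere of monotone functions\<close>

text \<open>
  Induction on the number of intervals: the interval with the largest left end lies to the right
  of all the others.
\<close>

lemma sum_increments_le_nondegenerate:
  fixes G :: "real \<Rightarrow> real"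
  assumes "card I = n" "finite I" "a \<le> b" "mono_on {a..b} G"
    and "\<And>s t. (s, t) \<in> I \<Longrightarrow> a \<le> s \<and> s < t \<and> t \<le> b"
    and "disjoint_family_on (\<lambda>(s, t). {s<..<t}) I"
  shows "(\<Sum>(s, t)\<in>I. G t - G s) \<le> G b - G a"
  using assms
proof (induction n arbitrary: I b)
  case 0
  then have "I = {}" by simp
  with 0 show ?case by (auto simp: mono_on_def)
next
  case (Suc n)
  let ?M = "Max (fst ` I)"
  have "I \<noteq> {}" using Suc.prems by auto
  then have "?M \<in> fst ` I" using Suc.prems by (intro Max_in) auto
  then obtain s t where st: "(s, t) \<in> I" "s = ?M" by force
  have le: "s' \<le> s" if "(s', t') \<in> I" for s' t'
  proof -
    have "s' \<in> fst ` I" using that by force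
    then show ?thesis unfolding st(2) using Suc.prems(2) by (intro Max_ge) auto
  qed
  have b1: "a \<le> s" "s < t" "t \<le> b" using Suc.prems(5)[OF st(1)] by auto
  have sub: "a \<le> s' \<and> s' < t' \<and> t' \<le> s" if "(s', t') \<in> I - {(s, t)}" for s' t'
  proof -
    have 1: "a \<le> s'" "s' < t'" "t' \<le> b" "s' \<le> s" using Suc.prems(5)[of s' t'] le that by auto
    have "{s'<..<t'} \<inter> {s<..<t} = {}"
      using Suc.prems(6) that st(1) unfolding disjoint_family_on_def by fastforce
    moreover have "(s + min t t') / 2 \<in> {s'<..<t'} \<inter> {s<..<t}" if "t' > s"
      using 1 b1 that by (auto simp: min_def)
    ultimately show ?thesis using 1 by fastforce
  qed
  have IH: "(\<Sum>(s, t)\<in>I - {(s, t)}. G t - G s) \<le> G s - G a"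
  proof (rule Suc.IH)
    show "card (I - {(s, t)}) = n" using Suc.prems st by simp
    show "mono_on {a..s} G" using Suc.prems(4) b1 by (auto simp: mono_on_def)
    show "disjoint_family_on (\<lambda>(s, t). {s<..<t}) (I - {(s, t)})"
      using Suc.prems(6) by (auto simp: disjoint_family_on_def)
  qed (use Suc.prems b1 sub in auto)
  have "(\<Sum>(s, t)\<in>I. G t - G s) = (G t - G s) + (\<Sum>(s, t)\<in>I - {(s, t)}. G t - G s)"
    using Suc.prems(2) st(1) by (subst sum.remove[OF _ st(1)]) auto
  moreover have "G t \<le> G b" using Suc.prems(4) b1 by (auto simp: mono_on_def)
  ultimately show ?case using IH by linarith
qed

lemma sum_increments_le:
  fixes G :: "real \<Rightarrow> real"
  assumes "finite I" "a \<le> b" "mono_on {a..b} G"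
    and I: "\<And>s t. (s, t) \<in> I \<Longrightarrow> a \<le> s \<and> s \<le> t \<and> t \<le> b"
    and dj: "disjoint_family_on (\<lambda>(s, t). {s<..<t}) I"
  shows "(\<Sum>(s, t)\<in>I. G t - G s) \<le> G b - G a"
proof -
  let ?J = "{(s, t) \<in> I. s < t}"
  have "(\<Sum>(s, t)\<in>I. G t - G s) = (\<Sum>(s, t)\<in>?J. G t - G s)"
    using assms(1) I by (intro sum.mono_neutral_right) (auto, metis order.order_iff_strict)
  also have "\<dots> \<le> G b - G a"
  proof (rule sum_increments_le_nondegenerate[OF refl _ assms(2,3)])
    show "finite ?J" using assms(1) by (rule rev_finite_subset) auto
    show "disjoint_family_on (\<lambda>(s, t). {s<..<t}) ?J"
      using dj by (rule disjoint_family_on_mono[rotated]) auto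
  qed (use I in auto)
  finally show ?thesis .
qed

text \<open>
  The Vitali covering theorem for intervals. The points need not be centres of their intervals;
  slopes of a function will be measured over intervals that contain the point, possibly as an end.
\<close>

lemma Vitali_intervals:
  fixes S :: "real set"
  assumes "\<And>x d. \<lbrakk>x \<in> S; 0 < d\<rbrakk> \<Longrightarrow> \<exists>u v. u < v \<and> u \<le> x \<and> x \<le> v \<and> v - u < d \<and> P u v"
  obtains C :: "(real \<times> real) set" where "countable C" "\<And>u v. (u, v) \<in> C \<Longrightarrow> u < v \<and> P u v"
    "disjoint_family_on (\<lambda>(u, v). {u..v}) C"
    "negligible (S - (\<Union>(u, v)\<in>C. {u..v}))"
proof -
  define K where "K = {(u, v). u < v \<and> P u v}"
  \<comment> \<open>Centre and radius of an interval with given ends.\<close>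
  define a where "a = (\<lambda>(u, v). (u + v) / 2 :: real)"
  define r where "r = (\<lambda>(u, v). (v - u) / 2 :: real)"
  have cb: "cball (a i) (r i) = (case i of (u, v) \<Rightarrow> {u..v})" for i
    by (cases i) (auto simp: a_def r_def cball_eq_atLeastAtMost field_simps)
  have "0 < r i" if "i \<in> K" for i using that by (auto simp: K_def r_def)
  moreover have "\<exists>i. i \<in> K \<and> x \<in> cball (a i) (r i) \<and> r i < d" if x: "x \<in> S" and d: "0 < d" for x d
  proof -
    obtain u v where "u < v" "u \<le> x" "x \<le> v" "v - u < d" "P u v" using assms[OF x d] by blast
    then show ?thesis
      by (intro exI[of _ "(u, v)"] conjI, unfold cb) (auto simp: K_def r_def)
  qed
  ultimately obtain C where C: "countable C" "C \<subseteq> K"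
     "pairwise (\<lambda>i j. disjnt (cball (a i) (r i)) (cball (a j) (r j))) C"
     "negligible(S - (\<Union>i \<in> C. cball (a i) (r i)))"
    by (rule Vitali_covering_theorem_cballs)
  show ?thesis
  proof
    show "countable C" by fact
    show "u < v \<and> P u v" if "(u, v) \<in> C" for u v using that C(2) by (auto simp: K_def)
    show "disjoint_family_on (\<lambda>(u, v). {u..v}) C"
      using C(3) by (simp add: disjoint_family_on_def pairwise_def disjnt_def cb)
    show "negligible (S - (\<Union>(u, v)\<in>C. {u..v}))" using C(4) by (simp add: cb)
  qed
qed

text \<open>
  If a monotone function has slope at least \<open>q\<close> over arbitrarily short intervals around every point
  of \<open>S\<close>, then disjoint such intervals cover almost all of \<open>S\<close>, and \<open>q\<close> times their total length is at
  most their total increment. The family \<open>C\<close> of host intervals records where this increment is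
  available.
\<close>

lemma steep_set_outer_measure_le:
  fixes G :: "real \<Rightarrow> real"
  assumes G: "mono G" and q: "0 < q"
    and steep: "\<And>x d. \<lbrakk>x \<in> S; 0 < d\<rbrakk> \<Longrightarrow> \<exists>u v. u < v \<and> u \<le> x \<and> x \<le> v \<and> v - u < d \<and>
        q * (v - u) \<le> G v - G u \<and> (\<exists>(c, d)\<in>C. c \<le> u \<and> v \<le> d)"
    and host: "\<And>F. \<lbrakk>finite F; F \<subseteq> C\<rbrakk> \<Longrightarrow> (\<Sum>(c, d)\<in>F. G d - G c) \<le> B"
  obtains T where "S \<subseteq> T" "T \<in> lmeasurable" "measure lebesgue T \<le> B / q"
proof -
  obtain D where D: "countable D"
    "\<And>u v. (u, v) \<in> D \<Longrightarrow> u < v \<and> q * (v - u) \<le> G v - G u \<and> (\<exists>(c, d)\<in>C. c \<le> u \<and> v \<le> d)"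
    "disjoint_family_on (\<lambda>(u, v). {u..v}) D" "negligible (S - (\<Union>(u, v)\<in>D. {u..v}))"
    by (rule Vitali_intervals[where S = S and P = "\<lambda>u v. q * (v - u) \<le> G v - G u \<and> (\<exists>(c, d)\<in>C. c \<le> u \<and> v \<le> d)"])
      (use steep in blast)+
  define hst where "hst i = (SOME c. c \<in> C \<and> fst c \<le> fst i \<and> snd i \<le> snd c)" for i :: "real \<times> real"
  have hst: "hst i \<in> C \<and> fst (hst i) \<le> fst i \<and> snd i \<le> snd (hst i)" if "i \<in> D" for i
    unfolding hst_def by (rule someI_ex) (use D(2)[of "fst i" "snd i"] that in force)
  have fin: "measure lebesgue (\<Union>i\<in>F. case i of (u, v) \<Rightarrow> {u..v}) \<le> B / q"
    if F: "F \<subseteq> D" "finite F" for F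
  proof -
    have "measure lebesgue (\<Union>i\<in>F. case i of (u, v) \<Rightarrow> {u..v})
        \<le> (\<Sum>i\<in>F. measure lebesgue (case i of (u, v) \<Rightarrow> {u..v}))"
      by (rule measure_UNION_le) (use F in auto)
    also have "\<dots> = (\<Sum>i\<in>F. snd i - fst i)"
      using F D(2) by (intro sum.cong) (force simp: split_beta)+
    also have "\<dots> \<le> (\<Sum>i\<in>F. (G (snd i) - G (fst i)) / q)"
      using F D(2) q by (intro sum_mono) (force simp: field_simps)
    also have "\<dots> = (\<Sum>i\<in>F. G (snd i) - G (fst i)) / q"
      by (simp add: sum_divide_distrib)
    also have "(\<Sum>i\<in>F. G (snd i) - G (fst i))
        = (\<Sum>c\<in>hst ` F. \<Sum>i\<in>{i\<in>F. hst i = c}. G (snd i) - G (fst i))"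
      by (rule sum.image_gen) fact
    also have "\<dots> \<le> (\<Sum>c\<in>hst ` F. G (snd c) - G (fst c))"
    proof (rule sum_mono)
      fix c assume c: "c \<in> hst ` F"
      let ?I = "{i\<in>F. hst i = c}"
      have "(\<Sum>(s, t)\<in>?I. G t - G s) \<le> G (snd c) - G (fst c)"
      proof (rule sum_increments_le)
        show "finite ?I" using F by auto
        show "fst c \<le> snd c" using c hst D(2) F by (force dest!: subsetD)
        show "mono_on {fst c..snd c} G" using G by (auto simp: mono_on_def mono_def)
        show "fst c \<le> s \<and> s \<le> t \<and> t \<le> snd c" if "(s, t) \<in> ?I" for s t
          using that hst[of "(s, t)"] D(2)[of s t] F by auto
        show "disjoint_family_on (\<lambda>(s, t). {s<..<t}) ?I"
        proof -
          have "{s<..<t} \<inter> {s'<..<t'} = {}" if "(s, t) \<in> F" "(s', t') \<in> F" "(s, t) \<noteq> (s', t')" for s t s' t'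
          proof -
            have "{s..t} \<inter> {s'..t'} = {}"
              using disjoint_family_onD[OF D(3), of "(s, t)" "(s', t')"] that F by auto
            moreover have "{s<..<t} \<subseteq> {s..t}" "{s'<..<t'} \<subseteq> {s'..t'}" by auto
            ultimately show ?thesis by blast
          qed
          then show ?thesis unfolding disjoint_family_on_def by (simp add: split_paired_all)
        qed
      qed
      then show "(\<Sum>i\<in>?I. G (snd i) - G (fst i)) \<le> G (snd c) - G (fst c)"
        by (simp add: split_beta)
    qed
    also have "\<dots> \<le> B"
      using host[of "hst ` F"] F hst unfolding split_beta by blast
    finally show ?thesis using q by (simp add: divide_right_mono)
  qed
  let ?U = "\<Union>i\<in>D. case i of (u, v) \<Rightarrow> {u..v}"
  have meas: "?U \<in> lmeasurable" "measure lebesgue ?U \<le> B / q"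
  proof -
    have 1: "(case i of (u, v) \<Rightarrow> {u..v}) \<in> lmeasurable" for i :: "real \<times> real" by (cases i) auto
    show "?U \<in> lmeasurable" using 1 fin by (intro fmeasurable_UN_bound[OF D(1)])
    show "measure lebesgue ?U \<le> B / q" using 1 fin by (intro measure_UN_bound[OF D(1)])
  qed
  let ?N = "S - ?U"
  have N: "?N \<in> null_sets lebesgue" using D(4) negligible_iff_null_sets by blast
  show ?thesis
  proof
    show "S \<subseteq> ?U \<union> ?N" by auto
    show "?U \<union> ?N \<in> lmeasurable"
      by (intro fmeasurable.Un meas(1) negligible_imp_measurable D(4))
    show "measure lebesgue (?U \<union> ?N) \<le> B / q"
      using meas(2) measure_Un_null_set[OF fmeasurableD[OF meas(1)] N] by simp
  qed
qed

lemma lmeasurable_outer_open: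
  assumes S: "S \<in> lmeasurable" and e: "e > 0"
  obtains T where "open T" "S \<subseteq> T" "T \<in> lmeasurable" "measure lebesgue T < measure lebesgue S + e"
proof -
  obtain T where T: "open T" "S \<subseteq> T" "T - S \<in> lmeasurable" "emeasure lebesgue (T - S) < ennreal e"
    using sets_lebesgue_outer_open[OF fmeasurableD[OF S] e] by blast
  have eq: "T = S \<union> (T - S)" using T(2) by auto
  have "measure lebesgue T \<le> measure lebesgue S + measure lebesgue (T - S)"
    by (subst eq, rule measure_Un_le) (use S T(3) in auto)
  moreover have "measure lebesgue (T - S) < e"
    using T(3,4) e by (simp add: emeasure_eq_measure2 ennreal_less_iff)
  moreover have "T \<in> lmeasurable" by (subst eq, intro fmeasurable.Un S T(3))
  ultimately show ?thesis using T that by auto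
qed

text \<open>
  Let \<open>\<nu>\<close> be the outer measure of \<open>S\<close>. Disjoint intervals of slope at most \<open>p\<close> cover almost all of
  \<open>S\<close> and have total increment at most \<open>p * (\<nu> + e)\<close>. Used as hosts for intervals of slope at
  least \<open>q\<close>, they give \<open>q * \<nu> \<le> p * (\<nu> + e)\<close>, which forces \<open>\<nu> = 0\<close>.
\<close>

lemma negligible_slope_gap:
  fixes G :: "real \<Rightarrow> real"
  assumes G: "mono G" and pq: "p < q" and S: "S \<subseteq> {a<..<b}"
    and lo: "\<And>x d. \<lbrakk>x \<in> S; 0 < d\<rbrakk> \<Longrightarrow> \<exists>u v. u < v \<and> u \<le> x \<and> x \<le> v \<and> v - u < d \<and> G v - G u \<le> p * (v - u)"
    and hi: "\<And>x d. \<lbrakk>x \<in> S; 0 < d\<rbrakk> \<Longrightarrow> \<exists>u v. u < v \<and> u \<le> x \<and> x \<le> v \<and> v - u < d \<and> q * (v - u) \<le> G v - G u"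
  shows "negligible S"
proof (cases "S = {}")
  case False
  then obtain x0 where "x0 \<in> S" by auto
  then obtain u0 v0 where "u0 < v0" "G v0 - G u0 \<le> p * (v0 - u0)" using lo[of x0 1] by auto
  moreover have "G u0 \<le> G v0" using G \<open>u0 < v0\<close> by (auto simp: mono_def)
  ultimately have "0 \<le> p * (v0 - u0)" "0 < v0 - u0" by auto
  then have p: "0 \<le> p" by (simp add: zero_le_mult_iff)
  with pq have q: "0 < q" by simp
  let ?mm = "{measure lebesgue T | T. S \<subseteq> T \<and> T \<in> lmeasurable}"
  define \<nu> where "\<nu> = Inf ?mm"
  have bdd: "bdd_below ?mm" by (intro bdd_belowI[of _ 0]) auto
  have ne: "?mm \<noteq> {}" using S by (auto intro!: exI[of _ "{a<..<b}"])
  have le: "\<nu> \<le> measure lebesgue T" if "S \<subseteq> T" "T \<in> lmeasurable" for T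
    unfolding \<nu>_def using that by (intro cInf_lower[OF _ bdd]) auto
  have \<nu>0: "0 \<le> \<nu>" unfolding \<nu>_def by (rule cInf_greatest[OF ne]) auto
  have step: "\<nu> \<le> p * (\<nu> + e) / q" if e: "e > 0" for e
  proof -
    obtain T0 where T0: "S \<subseteq> T0" "T0 \<in> lmeasurable" "measure lebesgue T0 < \<nu> + e/2"
      using cInf_lessD[OF ne, of "\<nu> + e/2"] e unfolding \<nu>_def by auto
    obtain U where U: "open U" "T0 \<subseteq> U" "U \<in> lmeasurable" "measure lebesgue U < measure lebesgue T0 + e/2"
      using lmeasurable_outer_open[OF T0(2), of "e/2"] e by auto
    have mU: "measure lebesgue U \<le> \<nu> + e" using U(4) T0(3) by simp
    have lo': "\<exists>u v. u < v \<and> u \<le> x \<and> x \<le> v \<and> v - u < d \<and> (G v - G u \<le> p * (v - u) \<and> {u..v} \<subseteq> U)"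
      if x: "x \<in> S" and d: "0 < d" for x d
    proof -
      obtain r where r: "r > 0" "ball x r \<subseteq> U" using U(1,2) T0(1) x openE by blast
      obtain u v where uv: "u < v" "u \<le> x" "x \<le> v" "v - u < min d r" "G v - G u \<le> p * (v - u)"
        using lo[OF x, of "min d r"] d r by auto
      have "{u..v} \<subseteq> ball x r" using uv by (auto simp: dist_real_def)
      then show ?thesis using uv r by (intro exI[of _ u] exI[of _ v]) auto
    qed
    obtain C where C: "countable C" "\<And>u v. (u, v) \<in> C \<Longrightarrow> u < v \<and> (G v - G u \<le> p * (v - u) \<and> {u..v} \<subseteq> U)"
      "disjoint_family_on (\<lambda>(u, v). {u..v}) C" "negligible (S - (\<Union>(u, v)\<in>C. {u..v}))"
      by (rule Vitali_intervals[where S = S and P = "\<lambda>u v. G v - G u \<le> p * (v - u) \<and> {u..v} \<subseteq> U"])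
        (use lo' in blast)+
    \<comment> \<open>Away from the ends of its host, a point has short intervals around it inside the host.\<close>
    define S1 where "S1 = S \<inter> (\<Union>(u, v)\<in>C. {u<..<v})"
    have hi': "\<exists>u v. u < v \<and> u \<le> x \<and> x \<le> v \<and> v - u < d \<and> q * (v - u) \<le> G v - G u \<and> (\<exists>(c, d)\<in>C. c \<le> u \<and> v \<le> d)"
      if x: "x \<in> S1" and d: "0 < d" for x d
    proof -
      obtain c c' where cc: "(c, c') \<in> C" "c < x" "x < c'" using x by (auto simp: S1_def)
      have x': "x \<in> S" using x by (auto simp: S1_def)
      obtain u v where uv: "u < v" "u \<le> x" "x \<le> v" "v - u < min d (min (x - c) (c' - x))" "q * (v - u) \<le> G v - G u"
        using hi[OF x', of "min d (min (x - c) (c' - x))"] d cc by auto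
      have "c \<le> u" "v \<le> c'" using uv by auto
      then have "\<exists>(c, d)\<in>C. c \<le> u \<and> v \<le> d" using cc(1) by auto
      then show ?thesis using uv by (intro exI[of _ u] exI[of _ v]) auto
    qed
    have host: "(\<Sum>(c, d)\<in>F. G d - G c) \<le> p * measure lebesgue U" if F: "finite F" "F \<subseteq> C" for F
    proof -
      have "(\<Sum>(c, d)\<in>F. G d - G c) \<le> (\<Sum>(c, d)\<in>F. p * (d - c))"
        using F C(2) by (intro sum_mono) auto
      also have "\<dots> = p * (\<Sum>i\<in>F. measure lebesgue (case i of (c, d) \<Rightarrow> {c..d}))"
        using F C(2) unfolding sum_distrib_left by (intro sum.cong) (force simp: split_beta)+
      also have "(\<Sum>i\<in>F. measure lebesgue (case i of (c, d) \<Rightarrow> {c..d}))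
          = measure lebesgue (\<Union>i\<in>F. case i of (c, d) \<Rightarrow> {c..d})"
        using F by (intro measure_finite_Union[symmetric] disjoint_family_on_mono[OF _ C(3)])
          (auto simp: emeasure_lborel_Icc_eq)
      also have "\<dots> \<le> measure lebesgue U"
      proof (rule measure_mono_fmeasurable[OF _ _ U(3)])
        show "(\<Union>i\<in>F. case i of (c, d) \<Rightarrow> {c..d}) \<subseteq> U" using F C(2) by fastforce
        show "(\<Union>i\<in>F. case i of (c, d) \<Rightarrow> {c..d}) \<in> sets lebesgue"
          using F(1) by (intro sets.finite_UN) (auto split: prod.splits)
      qed
      finally show ?thesis using p by (simp add: mult_left_mono)
    qed
    obtain T where T: "S1 \<subseteq> T" "T \<in> lmeasurable" "measure lebesgue T \<le> p * measure lebesgue U / q"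
      by (rule steep_set_outer_measure_le[OF G q hi' host])
    have "countable (fst ` C \<union> snd ` C)" using C(1) by auto
    then have "negligible (fst ` C \<union> snd ` C)" by (simp add: negligible_iff_null_sets countable_imp_null_set_lborel null_sets_completionI)
    then have N: "negligible (S - S1)"
    proof (rule negligible_subset[OF negligible_Un[OF C(4)]])
      show "S - S1 \<subseteq> S - (\<Union>(u, v)\<in>C. {u..v}) \<union> (fst ` C \<union> snd ` C)"
      proof
        fix x assume x: "x \<in> S - S1"
        show "x \<in> S - (\<Union>(u, v)\<in>C. {u..v}) \<union> (fst ` C \<union> snd ` C)"
        proof (cases "\<exists>(u, v)\<in>C. x \<in> {u..v}")
          case True
          then obtain u v where "(u, v) \<in> C" "u \<le> x" "x \<le> v" by auto
          moreover then have "x = u \<or> x = v" using x by (force simp: S1_def)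
          ultimately show ?thesis by force
        qed (use x in auto)
      qed
    qed
    have "\<nu> \<le> measure lebesgue (T \<union> (S - S1))"
      using T N by (intro le) (auto intro: fmeasurable.Un negligible_imp_measurable)
    also have "\<dots> = measure lebesgue T"
      using T N by (intro measure_Un_null_set) (auto simp: negligible_iff_null_sets)
    also have "\<dots> \<le> p * (\<nu> + e) / q"
      using order_trans[OF T(3) divide_right_mono[OF mult_left_mono[OF mU p]]] q by simp
    finally show ?thesis .
  qed
  have "\<nu> = 0"
  proof (rule ccontr)
    assume "\<nu> \<noteq> 0"
    with \<nu>0 have pos: "\<nu> > 0" by simp
    define e where "e = \<nu> * (q - p) / (2 * q)"
    have "e > 0" using pos pq q by (auto simp: e_def)
    from step[OF this] have "q * \<nu> \<le> p * \<nu> + p * e" using q by (simp add: field_simps)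
    moreover have "p * e \<le> q * e" using pq \<open>e > 0\<close> by simp
    moreover have "q * e = \<nu> * (q - p) / 2" using q by (simp add: e_def)
    ultimately have "\<nu> * (q - p) \<le> \<nu> * (q - p) / 2" by (simp add: algebra_simps)
    then show False using pos pq by simp
  qed
  show ?thesis
    unfolding negligible_outer
  proof (intro allI impI)
    fix e :: real assume "e > 0"
    then have "Inf ?mm < e" using \<open>\<nu> = 0\<close> by (simp add: \<nu>_def)
    from cInf_lessD[OF ne this] show "\<exists>T. S \<subseteq> T \<and> T \<in> lmeasurable \<and> measure lebesgue T < e" by blast
  qed
qed (simp add: negligible_empty)

text \<open>
  At a point that avoids the countably many sets \<open>E (p, q)\<close> with rational \<open>p < q\<close>, and the set where
  the slopes are unbounded, the difference quotients converge: their limit is the infimum of the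
  rational numbers that bound them above near the point.
\<close>

lemma monotone_differentiable_ae:
  fixes G :: "real \<Rightarrow> real"
  assumes G: "mono G"
  shows "negligible {x \<in> {a<..<b}. \<not> G differentiable (at x)}"
proof -
  define lo where "lo p x \<longleftrightarrow> (\<forall>d>0. \<exists>u v. u < v \<and> u \<le> x \<and> x \<le> v \<and> v - u < d \<and> G v - G u \<le> p * (v - u))" for p x
  define hi where "hi q x \<longleftrightarrow> (\<forall>d>0. \<exists>u v. u < v \<and> u \<le> x \<and> x \<le> v \<and> v - u < d \<and> q * (v - u) \<le> G v - G u)" for q x
  define E where "E = (\<lambda>(p, q). {x \<in> {a<..<b}. lo p x \<and> hi q x})"
  define Einf where "Einf = {x \<in> {a<..<b}. \<forall>n::nat. hi (real n) x}"
  have "negligible (E pq)" if "pq \<in> {(p, q) \<in> \<rat> \<times> \<rat>. p < q}" for pq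
  proof -
    obtain p q where pq: "pq = (p, q)" "p < q" using \<open>pq \<in> _\<close> by auto
    show ?thesis unfolding pq E_def prod.case
      by (rule negligible_slope_gap[OF G pq(2), of _ a b]) (auto simp: lo_def hi_def)
  qed
  moreover have "countable {(p, q) \<in> \<rat> \<times> \<rat>. p < (q::real)}"
    by (rule countable_subset[OF _ countable_SIGMA[OF countable_rat countable_rat]]) auto
  ultimately have N1: "negligible (\<Union>pq \<in> {(p, q) \<in> \<rat> \<times> \<rat>. p < q}. E pq)"
    by (intro negligible_countable_Union countable_image) blast+
  have N2: "negligible Einf"
    unfolding negligible_outer_le
  proof safe
    fix e :: real assume e: "e > 0"
    define B where "B = \<bar>G b - G a\<bar>"
    obtain n :: nat where n: "B / e < real n" using reals_Archimedean2 by blast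
    moreover have "0 \<le> B / e" using e by (auto simp: B_def)
    ultimately have n0: "0 < real n" by linarith
    have 1: "\<exists>u v. u < v \<and> u \<le> x \<and> x \<le> v \<and> v - u < d \<and> real n * (v - u) \<le> G v - G u \<and> (\<exists>(c, d)\<in>{(a, b)}. c \<le> u \<and> v \<le> d)"
      if x: "x \<in> Einf" and d: "0 < d" for x d
    proof -
      have x': "a < x" "x < b" using x by (auto simp: Einf_def)
      have hx: "hi (real n) x" and pos: "0 < min d (min (x - a) (b - x))"
        using x x' d by (auto simp: Einf_def)
      obtain u v where uv: "u < v" "u \<le> x" "x \<le> v" "v - u < min d (min (x - a) (b - x))" "real n * (v - u) \<le> G v - G u"
        using hx[unfolded hi_def, rule_format, OF pos] by auto
      then show ?thesis by (intro exI[of _ u] exI[of _ v]) auto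
    qed
    have 2: "(\<Sum>(c, d)\<in>F. G d - G c) \<le> B" if "finite F" "F \<subseteq> {(a, b)}" for F
    proof -
      have "F = {} \<or> F = {(a, b)}" using that by auto
      then show ?thesis by (auto simp: B_def)
    qed
    obtain T where "Einf \<subseteq> T" "T \<in> lmeasurable" "measure lebesgue T \<le> B / n"
      by (rule steep_set_outer_measure_le[OF G n0 1 2])
    moreover have "B / n \<le> e" using n n0 e by (simp add: field_simps)
    ultimately show "\<exists>T. Einf \<subseteq> T \<and> T \<in> lmeasurable \<and> measure lebesgue T \<le> e"
      by (intro exI[of _ T]) auto
  qed
  show ?thesis
  proof (rule negligible_subset[OF negligible_Un[OF N1 N2]], rule subsetI, rule ccontr)
    fix x assume x: "x \<in> {x \<in> {a<..<b}. \<not> G differentiable (at x)}"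
      and "x \<notin> (\<Union>pq \<in> {(p, q) \<in> \<rat> \<times> \<rat>. p < q}. E pq) \<union> Einf"
    then have nE': "\<forall>pq \<in> {(p, q) \<in> \<rat> \<times> \<rat>. p < q}. x \<notin> E pq" and nEinf: "x \<notin> Einf" by blast+
    have nE: "\<not> (lo p x \<and> hi q x)" if "p \<in> \<rat>" "q \<in> \<rat>" "p < q" for p q
      using bspec[OF nE', of "(p, q)"] that x by (simp add: E_def)
    obtain n where n: "\<not> hi (real n) x" using x nEinf by (auto simp: Einf_def)
    \<comment> \<open>A difference quotient in either direction is the slope over an interval with \<open>x\<close> as an end.\<close>
    define sl where "sl h = (G (x + h) - G x) / h" for h
    have sl_hi: "eventually (\<lambda>h. sl h < q) (at 0)" if "\<not> hi q x" for q
    proof -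
      obtain d where d: "d > 0" "\<And>u v. u < v \<Longrightarrow> u \<le> x \<Longrightarrow> x \<le> v \<Longrightarrow> v - u < d \<Longrightarrow> G v - G u < q * (v - u)"
        using \<open>\<not> hi q x\<close> unfolding hi_def by (metis not_le)
      have "sl h < q" if "h \<noteq> 0" "\<bar>h\<bar> < d" for h
        using d(2)[of "min x (x + h)" "max x (x + h)"] that
        by (cases "h > 0") (auto simp: sl_def field_simps)
      then show ?thesis unfolding eventually_at using d(1) by (auto simp: dist_real_def)
    qed
    have sl_lo: "eventually (\<lambda>h. p < sl h) (at 0)" if "\<not> lo p x" for p
    proof -
      obtain d where d: "d > 0" "\<And>u v. u < v \<Longrightarrow> u \<le> x \<Longrightarrow> x \<le> v \<Longrightarrow> v - u < d \<Longrightarrow> p * (v - u) < G v - G u"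
        using \<open>\<not> lo p x\<close> unfolding lo_def by (metis not_le)
      have "p < sl h" if "h \<noteq> 0" "\<bar>h\<bar> < d" for h
        using d(2)[of "min x (x + h)" "max x (x + h)"] that
        by (cases "h > 0") (auto simp: sl_def field_simps)
      then show ?thesis unfolding eventually_at using d(1) by (auto simp: dist_real_def)
    qed
    have sl0: "0 \<le> sl h" for h
      using monoD[OF G, of x "x + h"] monoD[OF G, of "x + h" x]
      by (cases "h \<ge> 0") (auto simp: sl_def divide_nonneg_nonneg divide_nonpos_nonpos)
    define Q where "Q = {q \<in> \<rat>. \<not> hi q x}"
    have Qne: "real n \<in> Q" using n by (auto simp: Q_def)
    have Q0: "0 \<le> q" if "q \<in> Q" for q
    proof -
      have "eventually (\<lambda>h. sl h < q) (at 0)" using that sl_hi by (auto simp: Q_def)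
      then obtain h where "sl h < q" using eventually_happens'[of "at (0::real)"] by auto
      then show ?thesis using sl0[of h] by simp
    qed
    have bQ: "bdd_below Q" using Q0 by (intro bdd_belowI) auto
    define L where "L = Inf Q"
    have "(sl \<longlongrightarrow> L) (at 0)"
    proof (rule order_tendstoI)
      fix y assume "y < L"
      obtain q where q: "q \<in> \<rat>" "y < q" "q < L" using Rats_dense_in_real[OF \<open>y < L\<close>] by auto
      obtain p where p: "p \<in> \<rat>" "y < p" "p < q" using Rats_dense_in_real[OF q(2)] by auto
      have "q \<notin> Q" using q cInf_lower[OF _ bQ, of q] by (auto simp: L_def)
      then have "\<not> lo p x" using nE[OF p(1) q(1) p(3)] q(1) by (auto simp: Q_def)
      from sl_lo[OF this] show "eventually (\<lambda>h. y < sl h) (at 0)"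
        by eventually_elim (use p in auto)
    next
      fix y assume "L < y"
      then obtain q where q: "q \<in> Q" "q < y" using cInf_lessD[of Q y] Qne by (auto simp: L_def)
      then have "eventually (\<lambda>h. sl h < q) (at 0)" using sl_hi by (auto simp: Q_def)
      then show "eventually (\<lambda>h. sl h < y) (at 0)" by eventually_elim (use q in auto)
    qed
    then have "(G has_field_derivative L) (at x)" unfolding DERIV_def sl_def .
    then show False using x by (auto simp: real_differentiable_def)
  qed
qed

section \<open>Absolutely continuous curves\<close>

abbreviation interval_family :: "real \<Rightarrow> real \<Rightarrow> (real \<times> real) set \<Rightarrow> bool"
  where "interval_family a b I \<equiv> finite I \<and> (\<forall>(s, t)\<in>I. a \<le> s \<and> s \<le> t \<and> t \<le> b) \<and>
    disjoint_family_on (\<lambda>(s, t). {s<..<t}) I"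

abbreviation total_length :: "(real \<times> real) set \<Rightarrow> real"
  where "total_length I \<equiv> (\<Sum>(s, t)\<in>I. t - s)"

abbreviation total_increment :: "(real \<Rightarrow> 'a::real_normed_vector) \<Rightarrow> (real \<times> real) set \<Rightarrow> real"
  where "total_increment f I \<equiv> (\<Sum>(s, t)\<in>I. norm (f t - f s))"

lemma absolutely_continuous_curveE:
  fixes f :: "real \<Rightarrow> 'a::real_normed_vector"
  assumes "absolutely_continuous_curve a b f" "\<epsilon> > 0"
  obtains \<delta> where "\<delta> > 0"
    "\<And>I. interval_family a b I \<and> total_length I < \<delta> \<Longrightarrow> total_increment f I < \<epsilon>"
  using assms unfolding absolutely_continuous_curve_def conj_assoc by meson

lemma absolutely_continuous_curveI:
  fixes f :: "real \<Rightarrow> 'a::real_normed_vector"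
  assumes "\<And>\<epsilon>. \<epsilon> > 0 \<Longrightarrow>
    \<exists>\<delta>>0. \<forall>I. interval_family a b I \<and> total_length I < \<delta> \<longrightarrow> total_increment f I < \<epsilon>"
  shows "absolutely_continuous_curve a b f"
  using assms unfolding absolutely_continuous_curve_def conj_assoc by blast

lemma absolutely_continuous_curve_imp_continuous_on:
  fixes f :: "real \<Rightarrow> 'a::real_normed_vector"
  assumes ac: "absolutely_continuous_curve a b f"
  shows "continuous_on {a..b} f"
  unfolding continuous_on_iff
proof (intro ballI allI impI)
  fix x e :: real assume x: "x \<in> {a..b}" and e: "0 < e"
  obtain \<delta> where \<delta>: "\<delta> > 0" "\<And>I. interval_family a b I \<and> total_length I < \<delta> \<Longrightarrow> total_increment f I < e"
    using absolutely_continuous_curveE[OF ac e] by blast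
  have "dist (f y) (f x) < e" if y: "y \<in> {a..b}" "dist y x < \<delta>" for y
    using \<delta>(2)[of "{(min x y, max x y)}"] x y
    by (cases "x \<le> y") (auto simp: disjoint_family_on_def dist_norm norm_minus_commute)
  then show "\<exists>d>0. \<forall>y\<in>{a..b}. dist y x < d \<longrightarrow> dist (f y) (f x) < e" using \<delta>(1) by blast
qed

text \<open>
  This covers translation and reversal of time and also clamping to a smaller interval, which turns a curve
  into one that is constant outside that interval.
\<close>

lemma absolutely_continuous_curve_compose_monotone:
  fixes f :: "real \<Rightarrow> 'a::real_normed_vector" and \<pi> :: "real \<Rightarrow> real"
  assumes ac: "absolutely_continuous_curve a b f"
    and range: "\<And>t. c \<le> t \<Longrightarrow> t \<le> d \<Longrightarrow> a \<le> \<pi> t \<and> \<pi> t \<le> b"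
    and mono: "(\<forall>s t. c \<le> s \<longrightarrow> s \<le> t \<longrightarrow> t \<le> d \<longrightarrow> \<pi> s \<le> \<pi> t) \<or>
      (\<forall>s t. c \<le> s \<longrightarrow> s \<le> t \<longrightarrow> t \<le> d \<longrightarrow> \<pi> t \<le> \<pi> s)"
    and lip: "\<And>s t. c \<le> s \<Longrightarrow> s \<le> t \<Longrightarrow> t \<le> d \<Longrightarrow> \<bar>\<pi> t - \<pi> s\<bar> \<le> t - s"
  shows "absolutely_continuous_curve c d (\<lambda>t. f (\<pi> t))"
proof (rule absolutely_continuous_curveI)
  fix e :: real assume "e > 0"
  then obtain \<delta> where \<delta>: "\<delta> > 0" "\<And>I. interval_family a b I \<and> total_length I < \<delta> \<Longrightarrow> total_increment f I < e"
    using absolutely_continuous_curveE[OF ac] by blast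
  have "(\<Sum>(s, t)\<in>I. norm (f (\<pi> t) - f (\<pi> s))) < e"
    if I: "finite I" "\<forall>(s, t)\<in>I. c \<le> s \<and> s \<le> t \<and> t \<le> d"
       "disjoint_family_on (\<lambda>(s, t). {s<..<t}) I" "(\<Sum>(s, t)\<in>I. t - s) < \<delta>" for I
  proof -
    define J where "J = {i\<in>I. \<pi> (fst i) \<noteq> \<pi> (snd i)}"
    define lo hi where "lo i = min (\<pi> (fst i)) (\<pi> (snd i))" and "hi i = max (\<pi> (fst i)) (\<pi> (snd i))" for i
    have finJ: "finite J" using I(1) by (simp add: J_def)
    have lohi: "lo i < hi i" if "i \<in> J" for i using that by (auto simp: J_def lo_def hi_def)
    have in_cd: "c \<le> fst i \<and> fst i \<le> snd i \<and> snd i \<le> d" if "i \<in> I" for i using I(2) that by (cases i) auto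
    have dj: "{lo i<..<hi i} \<inter> {lo j<..<hi j} = {}" if ij: "i \<in> J" "j \<in> J" "i \<noteq> j" for i j
    proof -
      have nd: "fst i < snd i" "fst j < snd j" "i \<in> I" "j \<in> I"
        using ij in_cd[of i] in_cd[of j] by (auto simp: J_def less_le)
      have "{fst i<..<snd i} \<inter> {fst j<..<snd j} = {}"
        using disjoint_family_onD[OF I(3) nd(3,4) ij(3)] by (simp add: split_beta)
      moreover have "(max (fst i) (fst j) + min (snd i) (snd j)) / 2 \<in> {fst i<..<snd i} \<inter> {fst j<..<snd j}"
        if "fst j < snd i" "fst i < snd j" using that nd by auto
      ultimately have "snd i \<le> fst j \<or> snd j \<le> fst i" by fastforce
      have "hi i \<le> lo j \<or> hi j \<le> lo i"
        using mono
      proof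
        assume m: "\<forall>s t. c \<le> s \<longrightarrow> s \<le> t \<longrightarrow> t \<le> d \<longrightarrow> \<pi> s \<le> \<pi> t"
        then have "\<pi> (fst i) \<le> \<pi> (snd i)" "\<pi> (fst j) \<le> \<pi> (snd j)"
          "snd i \<le> fst j \<longrightarrow> \<pi> (snd i) \<le> \<pi> (fst j)" "snd j \<le> fst i \<longrightarrow> \<pi> (snd j) \<le> \<pi> (fst i)"
          using in_cd[OF nd(3)] in_cd[OF nd(4)] by auto
        then show ?thesis using \<open>snd i \<le> fst j \<or> snd j \<le> fst i\<close> by (auto simp: lo_def hi_def)
      next
        assume m: "\<forall>s t. c \<le> s \<longrightarrow> s \<le> t \<longrightarrow> t \<le> d \<longrightarrow> \<pi> t \<le> \<pi> s"
        then have "\<pi> (snd i) \<le> \<pi> (fst i)" "\<pi> (snd j) \<le> \<pi> (fst j)"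
          "snd i \<le> fst j \<longrightarrow> \<pi> (fst j) \<le> \<pi> (snd i)" "snd j \<le> fst i \<longrightarrow> \<pi> (fst i) \<le> \<pi> (snd j)"
          using in_cd[OF nd(3)] in_cd[OF nd(4)] by auto
        then show ?thesis using \<open>snd i \<le> fst j \<or> snd j \<le> fst i\<close> by (auto simp: lo_def hi_def)
      qed
      then show ?thesis by auto
    qed
    let ?h = "\<lambda>i. (lo i, hi i)"
    have inj: "inj_on ?h J"
    proof (rule inj_onI, rule ccontr)
      fix i j assume *: "i \<in> J" "j \<in> J" "?h i = ?h j" "i \<noteq> j"
      then have "(lo i + hi i) / 2 \<in> {lo i<..<hi i} \<inter> {lo j<..<hi j}" using lohi[of i] lohi[of j] by auto
      then show False using dj[of i j] * by auto
    qed
    have "(\<Sum>(s, t)\<in>?h ` J. t - s) = (\<Sum>i\<in>J. \<bar>\<pi> (snd i) - \<pi> (fst i)\<bar>)"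
      by (subst sum.reindex[OF inj]) (auto simp: lo_def hi_def intro!: sum.cong)
    also have "\<dots> \<le> (\<Sum>i\<in>J. snd i - fst i)"
      using in_cd by (intro sum_mono lip) (auto simp: J_def)
    also have "\<dots> \<le> (\<Sum>i\<in>I. snd i - fst i)"
      using in_cd by (intro sum_mono2 I(1)) (auto simp: J_def)
    also have "\<dots> < \<delta>" using I(4) by (simp add: split_beta)
    finally have small: "(\<Sum>(s, t)\<in>?h ` J. t - s) < \<delta>" .
    have "disjoint_family_on (\<lambda>(s, t). {s<..<t}) (?h ` J)"
      using dj unfolding disjoint_family_on_def by force
    moreover have "\<forall>(s, t)\<in>?h ` J. a \<le> s \<and> s \<le> t \<and> t \<le> b"
    proof clarsimp
      fix s t assume "(s, t) \<in> J"
      then have "c \<le> s" "s \<le> t" "t \<le> d" using in_cd[of "(s, t)"] by (auto simp: J_def)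
      then show "a \<le> lo (s, t) \<and> lo (s, t) \<le> hi (s, t) \<and> hi (s, t) \<le> b"
        using range[of s] range[of t] by (auto simp: lo_def hi_def)
    qed
    ultimately have "(\<Sum>(s, t)\<in>?h ` J. norm (f t - f s)) < e"
      using finJ small by (intro \<delta>(2)) auto
    also have "(\<Sum>(s, t)\<in>?h ` J. norm (f t - f s)) = (\<Sum>i\<in>J. norm (f (\<pi> (snd i)) - f (\<pi> (fst i))))"
      by (subst sum.reindex[OF inj]) (auto simp: lo_def hi_def min_def max_def norm_minus_commute intro!: sum.cong)
    also have "\<dots> = (\<Sum>i\<in>I. norm (f (\<pi> (snd i)) - f (\<pi> (fst i))))"
      using I(1) by (intro sum.mono_neutral_left) (auto simp: J_def)
    finally show ?thesis by (simp add: split_beta)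
  qed
  then show "\<exists>\<delta>>0. \<forall>I. interval_family c d I \<and> total_length I < \<delta> \<longrightarrow> total_increment (\<lambda>t. f (\<pi> t)) I < e"
    using \<delta>(1) by (intro exI[of _ \<delta>]) auto
qed

text \<open>
  The typical \<open>k\<close> is a sum of two curves; a concatenation is, up to a constant, the sum of two clamped
  curves.
\<close>

lemma absolutely_continuous_curve_dominated:
  fixes f :: "real \<Rightarrow> 'a::real_normed_vector" and g :: "real \<Rightarrow> 'b::real_normed_vector"
    and k :: "real \<Rightarrow> 'c::real_normed_vector"
  assumes "absolutely_continuous_curve a b f" "absolutely_continuous_curve a b g"
    and le: "\<And>s t. a \<le> s \<Longrightarrow> s \<le> t \<Longrightarrow> t \<le> b \<Longrightarrow> norm (k t - k s) \<le> norm (f t - f s) + norm (g t - g s)"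
  shows "absolutely_continuous_curve a b k"
proof (rule absolutely_continuous_curveI)
  fix e :: real assume "e > 0"
  then have "e/2 > 0" by simp
  obtain \<delta>1 where \<delta>1: "\<delta>1 > 0" "\<And>I. interval_family a b I \<and> total_length I < \<delta>1 \<Longrightarrow> total_increment f I < e/2"
    using absolutely_continuous_curveE[OF assms(1) \<open>e/2 > 0\<close>] by blast
  obtain \<delta>2 where \<delta>2: "\<delta>2 > 0" "\<And>I. interval_family a b I \<and> total_length I < \<delta>2 \<Longrightarrow> total_increment g I < e/2"
    using absolutely_continuous_curveE[OF assms(2) \<open>e/2 > 0\<close>] by blast
  have "(\<Sum>(s, t)\<in>I. norm (k t - k s)) < e"
    if I: "finite I" "\<forall>(s, t)\<in>I. a \<le> s \<and> s \<le> t \<and> t \<le> b"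
       "disjoint_family_on (\<lambda>(s, t). {s<..<t}) I" "(\<Sum>(s, t)\<in>I. t - s) < min \<delta>1 \<delta>2" for I
  proof -
    have "(\<Sum>(s, t)\<in>I. norm (k t - k s)) \<le> (\<Sum>(s, t)\<in>I. norm (f t - f s) + norm (g t - g s))"
      using I(2) by (intro sum_mono) (auto intro!: le)
    also have "\<dots> = (\<Sum>(s, t)\<in>I. norm (f t - f s)) + (\<Sum>(s, t)\<in>I. norm (g t - g s))"
      by (simp add: split_beta sum.distrib)
    also have "\<dots> < e" using \<delta>1(2)[of I] \<delta>2(2)[of I] I by linarith
    finally show ?thesis .
  qed
  then show "\<exists>\<delta>>0. \<forall>I. interval_family a b I \<and> total_length I < \<delta> \<longrightarrow> total_increment k I < e"
    using \<delta>1(1) \<delta>2(1) by (intro exI[of _ "min \<delta>1 \<delta>2"]) auto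
qed

lemma absolutely_continuous_curve_join:
  fixes f g :: "real \<Rightarrow> 'a::real_normed_vector"
  assumes f: "absolutely_continuous_curve a c f" and g: "absolutely_continuous_curve c b g"
    and c: "a \<le> c" "c \<le> b" "f c = g c"
  shows "absolutely_continuous_curve a b (\<lambda>t. if t \<le> c then f t else g t)"
proof (rule absolutely_continuous_curve_dominated)
  show "absolutely_continuous_curve a b (\<lambda>t. f (min t c))"
    by (rule absolutely_continuous_curve_compose_monotone[OF f]) (use c in auto)
  show "absolutely_continuous_curve a b (\<lambda>t. g (max t c))"
    by (rule absolutely_continuous_curve_compose_monotone[OF g]) (use c in auto)
  fix s t :: real assume st: "a \<le> s" "s \<le> t" "t \<le> b"
  have "(if t \<le> c then f t else g t) - (if s \<le> c then f s else g s)
      = (f (min t c) - f (min s c)) + (g (max t c) - g (max s c))"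
    using st c(3) by auto
  then show "norm ((if t \<le> c then f t else g t) - (if s \<le> c then f s else g s))
      \<le> norm (f (min t c) - f (min s c)) + norm (g (max t c) - g (max s c))"
    using norm_triangle_ineq by metis
qed

lemma absolutely_continuous_curve_bounded_linear:
  fixes f :: "real \<Rightarrow> 'a::real_normed_vector" and L :: "'a \<Rightarrow> 'b::real_normed_vector"
  assumes ac: "absolutely_continuous_curve a b f" and L: "bounded_linear L"
  shows "absolutely_continuous_curve a b (\<lambda>t. L (f t))"
proof (rule absolutely_continuous_curveI)
  fix e :: real assume e: "e > 0"
  obtain K where K: "K > 0" "\<And>v. norm (L v) \<le> norm v * K" using bounded_linear.pos_bounded[OF L] by blast
  have "e / K > 0" using e K by simp
  then obtain \<delta> where \<delta>: "\<delta> > 0" "\<And>I. interval_family a b I \<and> total_length I < \<delta> \<Longrightarrow> total_increment f I < e / K"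
    using absolutely_continuous_curveE[OF ac] by blast
  have "(\<Sum>(s, t)\<in>I. norm (L (f t) - L (f s))) < e"
    if I: "interval_family a b I \<and> total_length I < \<delta>" for I
  proof -
    have "(\<Sum>(s, t)\<in>I. norm (L (f t) - L (f s))) \<le> (\<Sum>(s, t)\<in>I. norm (f t - f s) * K)"
      using K(2) by (intro sum_mono) (auto simp: linear_diff[OF bounded_linear.linear[OF L], symmetric])
    also have "\<dots> = (\<Sum>(s, t)\<in>I. norm (f t - f s)) * K" by (simp add: sum_distrib_right split_beta)
    also have "\<dots> < e" using \<delta>(2)[OF I] K(1) by (simp add: pos_less_divide_eq)
    finally show ?thesis .
  qed
  then show "\<exists>\<delta>>0. \<forall>I. interval_family a b I \<and> total_length I < \<delta> \<longrightarrow> total_increment (\<lambda>t. L (f t)) I < e"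
    using \<delta>(1) by (intro exI[of _ \<delta>]) auto
qed

lemma absolutely_continuous_curve_add_const:
  assumes "absolutely_continuous_curve a b \<gamma>"
  shows "absolutely_continuous_curve a b (\<lambda>t. \<gamma> t + w)"
  using assms by (simp add: absolutely_continuous_curve_def)

lemma lipschitz_imp_absolutely_continuous_curve:
  fixes f :: "real \<Rightarrow> 'a::real_normed_vector"
  assumes "\<And>s t. a \<le> s \<Longrightarrow> s \<le> t \<Longrightarrow> t \<le> b \<Longrightarrow> norm (f t - f s) \<le> K * (t - s)" and K: "K > 0"
  shows "absolutely_continuous_curve a b f"
proof (rule absolutely_continuous_curveI)
  fix e :: real assume e: "e > 0"
  have "(\<Sum>(s, t)\<in>I. norm (f t - f s)) < e"
    if I: "finite I" "\<forall>(s, t)\<in>I. a \<le> s \<and> s \<le> t \<and> t \<le> b" "(\<Sum>(s, t)\<in>I. t - s) < e / K" for I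
  proof -
    have "(\<Sum>(s, t)\<in>I. norm (f t - f s)) \<le> (\<Sum>(s, t)\<in>I. K * (t - s))"
      using I(2) by (intro sum_mono) (auto intro!: assms)
    also have "\<dots> = K * (\<Sum>(s, t)\<in>I. t - s)" by (simp add: sum_distrib_left split_beta)
    also have "\<dots> < e" using I(3) K by (simp add: pos_less_divide_eq mult.commute)
    finally show ?thesis .
  qed
  then show "\<exists>\<delta>>0. \<forall>I. interval_family a b I \<and> total_length I < \<delta> \<longrightarrow> total_increment f I < e"
    using e K by (intro exI[of _ "e / K"]) auto
qed

lemma absolutely_continuous_curve_affine:
  fixes x u :: "'a::real_normed_vector"
  shows "absolutely_continuous_curve a b (\<lambda>t. x + (t / T) *\<^sub>R u)"
proof (rule lipschitz_imp_absolutely_continuous_curve)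
  fix s t :: real assume st: "s \<le> t"
  have "(x + (t / T) *\<^sub>R u) - (x + (s / T) *\<^sub>R u) = ((t - s) / T) *\<^sub>R u"
    by (simp add: algebra_simps diff_divide_distrib)
  then have "norm ((x + (t / T) *\<^sub>R u) - (x + (s / T) *\<^sub>R u)) = norm u / \<bar>T\<bar> * (t - s)" using st by simp
  also have "\<dots> \<le> (norm u / \<bar>T\<bar> + 1) * (t - s)" using st by (intro mult_right_mono) auto
  finally show "norm ((x + (t / T) *\<^sub>R u) - (x + (s / T) *\<^sub>R u)) \<le> (norm u / \<bar>T\<bar> + 1) * (t - s)" .
qed (simp add: add_nonneg_pos)

text \<open>
  On an interval shorter than the \<open>\<delta>\<close> that belongs to \<open>\<epsilon> = 1\<close> the variation is at most \<open>1\<close>. The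
  statement is kept local because differentiability almost everywhere and negligibility of the image,
  for which it is used, are local properties.
\<close>

lemma absolutely_continuous_curve_local_control:
  fixes f :: "real \<Rightarrow> 'a::real_normed_vector"
  assumes ac: "absolutely_continuous_curve a b f"
  obtains \<delta> where "\<delta> > 0"
    "\<And>c d. a \<le> c \<Longrightarrow> d \<le> b \<Longrightarrow> d - c < \<delta> \<Longrightarrow>
      \<exists>V :: real \<Rightarrow> real. \<forall>x y. c \<le> x \<longrightarrow> x \<le> y \<longrightarrow> y \<le> d \<longrightarrow> norm (f y - f x) \<le> V y - V x"
proof -
  obtain \<delta> where \<delta>: "\<delta> > 0" "\<And>I. interval_family a b I \<and> total_length I < \<delta> \<Longrightarrow> total_increment f I < 1"
    using absolutely_continuous_curveE[OF ac zero_less_one] by blast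
  show ?thesis
  proof (rule that[OF \<delta>(1)])
    fix c d assume cd: "a \<le> c" "d \<le> b" "d - c < \<delta>"
    \<comment> \<open>\<open>V x\<close> is the variation of \<open>f\<close> over \<open>{c..x}\<close>.\<close>
    define Fam where "Fam x = {I. finite I \<and> (\<forall>(s, t)\<in>I. c \<le> s \<and> s \<le> t \<and> t \<le> x) \<and>
       disjoint_family_on (\<lambda>(s, t). {s<..<t}) I}" for x
    define W where "W I = total_increment f I" for I
    define V where "V x = Sup (W ` Fam x)" for x
    have W1: "W I \<le> 1" if I: "I \<in> Fam x" "c \<le> x" "x \<le> d" for I x
    proof -
      have "(\<Sum>(s, t)\<in>I. t - s) \<le> x - c"
        using I by (intro sum_increments_le[where G = "\<lambda>x. x"]) (auto simp: Fam_def mono_on_def)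
      then have "(\<Sum>(s, t)\<in>I. norm (f t - f s)) < 1"
        using I cd by (intro \<delta>(2)) (fastforce simp: Fam_def)
      then show ?thesis by (simp add: W_def)
    qed
    have "norm (f y - f x) \<le> V y - V x" if xy: "c \<le> x" "x \<le> y" "y \<le> d" for x y
    proof (cases "x = y")
      case False
      have "W I \<le> V y - norm (f y - f x)" if I: "I \<in> Fam x" for I
      proof -
        have notin: "(x, y) \<notin> I" using I False xy by (auto simp: Fam_def)
        have "disjoint_family_on (\<lambda>(s, t). {s<..<t}) (insert (x, y) I)"
          using I notin by (subst disjoint_family_on_insert) (fastforce simp: Fam_def)+
        then have "insert (x, y) I \<in> Fam y" using I xy by (force simp: Fam_def)
        then have "W (insert (x, y) I) \<le> V y"
          unfolding V_def using W1 xy by (intro cSup_upper) (auto intro!: bdd_aboveI[of _ 1])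
        moreover have "W (insert (x, y) I) = norm (f y - f x) + W I"
          using I notin by (simp add: W_def Fam_def)
        ultimately show ?thesis by simp
      qed
      moreover have "{} \<in> Fam x" by (auto simp: Fam_def disjoint_family_on_def)
      ultimately have "V x \<le> V y - norm (f y - f x)"
        unfolding V_def[of x] by (intro cSup_least) auto
      then show ?thesis by simp
    qed simp
    then show "\<exists>V :: real \<Rightarrow> real. \<forall>x y. c \<le> x \<longrightarrow> x \<le> y \<longrightarrow> y \<le> d \<longrightarrow> norm (f y - f x) \<le> V y - V x"
      by blast
  qed
qed

text \<open>
  Each coordinate is the difference of the monotone functions \<open>V\<close> and \<open>V - f \<bullet> i\<close>.
\<close>

lemma differentiable_ae_of_variation_control:
  fixes f :: "real \<Rightarrow> 'a::euclidean_space" and V :: "real \<Rightarrow> real"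
  assumes cd: "c < d" and V: "\<And>x y. c \<le> x \<Longrightarrow> x \<le> y \<Longrightarrow> y \<le> d \<Longrightarrow> norm (f y - f x) \<le> V y - V x"
  shows "negligible {x \<in> {c<..<d}. \<not> f differentiable (at x)}"
proof -
  \<comment> \<open>Clamping makes the functions monotone on the whole line without changing them on \<open>{c..d}\<close>.\<close>
  define p where "p x = max c (min x d)" for x
  have p: "c \<le> p x" "p x \<le> d" "x \<le> y \<Longrightarrow> p x \<le> p y" for x y using cd by (auto simp: p_def)
  define H where "H i x = V (p x) - f (p x) \<bullet> i" for i x
  have mG: "mono (\<lambda>x. V (p x))"
  proof (rule monoI)
    fix x y :: real assume "x \<le> y"
    from order_trans[OF norm_ge_zero V[OF p(1) p(3)[OF this] p(2)]] show "V (p x) \<le> V (p y)" by simp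
  qed
  have mH: "mono (H i)" if i: "i \<in> Basis" for i
  proof (rule monoI)
    fix x y :: real assume xy: "x \<le> y"
    have "(f (p y) - f (p x)) \<bullet> i \<le> norm (f (p y) - f (p x))"
      using Basis_le_norm[OF i, of "f (p y) - f (p x)"] by linarith
    also have "\<dots> \<le> V (p y) - V (p x)" using p xy by (intro V) auto
    finally show "H i x \<le> H i y" by (simp add: H_def inner_diff_left)
  qed
  let ?B = "{x \<in> {c<..<d}. \<not> (\<lambda>x. V (p x)) differentiable (at x)} \<union>
    (\<Union>i\<in>Basis. {x \<in> {c<..<d}. \<not> H i differentiable (at x)})"
  have neg: "negligible ?B"
  proof (rule negligible_Un[OF monotone_differentiable_ae[OF mG]], rule negligible_Union)
    fix N assume "N \<in> (\<lambda>i. {x \<in> {c<..<d}. \<not> H i differentiable (at x)}) ` Basis"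
    then show "negligible N" using mH monotone_differentiable_ae by blast
  qed simp
  show ?thesis
  proof (rule negligible_subset[OF neg], intro subsetI, rule ccontr)
    fix x assume x: "x \<in> {x \<in> {c<..<d}. \<not> f differentiable (at x)}" and nB: "x \<notin> ?B"
    have "(\<lambda>y. f y \<bullet> i) differentiable (at x)" if i: "i \<in> Basis" for i
    proof -
      have "(\<lambda>y. V (p y) - H i y) differentiable (at x)"
        using x nB i by (intro differentiable_diff) auto
      then obtain D where D: "((\<lambda>y. V (p y) - H i y) has_derivative D) (at x)"
        by (auto simp: differentiable_def)
      have "((\<lambda>y. f y \<bullet> i) has_derivative D) (at x)"
        by (rule has_derivative_transform_within_open[OF D, of "{c<..<d}"])
          (use x in \<open>auto simp: H_def p_def\<close>)
      then show ?thesis by (auto simp: differentiable_def)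
    qed
    then have "f differentiable (at x)" by (subst differentiable_componentwise_within) auto
    then show False using x by simp
  qed
qed

lemma absolutely_continuous_curve_differentiable_ae:
  fixes f :: "real \<Rightarrow> 'a::euclidean_space"
  assumes ac: "absolutely_continuous_curve a b f"
  shows "negligible {x \<in> {a<..<b}. \<not> f differentiable (at x)}"
proof -
  obtain \<delta> where \<delta>: "\<delta> > 0"
    "\<And>c d. a \<le> c \<Longrightarrow> d \<le> b \<Longrightarrow> d - c < \<delta> \<Longrightarrow>
      \<exists>V :: real \<Rightarrow> real. \<forall>x y. c \<le> x \<longrightarrow> x \<le> y \<longrightarrow> y \<le> d \<longrightarrow> norm (f y - f x) \<le> V y - V x"
    using absolutely_continuous_curve_local_control[OF ac] by blast
  define Q where "Q = {(c, d) \<in> \<rat> \<times> \<rat>. a \<le> c \<and> c < d \<and> d \<le> b \<and> d - c < \<delta>}"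
  define N where "N = (\<lambda>(c, d). {x \<in> {c<..<d}. \<not> f differentiable (at x)})"
  have neg: "negligible (N cd)" if "cd \<in> Q" for cd
  proof -
    obtain c d where cd: "cd = (c, d)" "a \<le> c" "c < d" "d \<le> b" "d - c < \<delta>"
      using \<open>cd \<in> Q\<close> by (auto simp: Q_def)
    obtain V :: "real \<Rightarrow> real" where
      V: "\<And>x y. c \<le> x \<Longrightarrow> x \<le> y \<Longrightarrow> y \<le> d \<Longrightarrow> norm (f y - f x) \<le> V y - V x"
      using \<delta>(2)[OF cd(2,4,5)] by blast
    show ?thesis unfolding cd N_def prod.case
      by (rule differentiable_ae_of_variation_control[OF cd(3) V])
  qed
  have "countable Q" unfolding Q_def
    by (rule countable_subset[OF _ countable_SIGMA[OF countable_rat countable_rat]]) auto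
  then have "negligible (\<Union>(N ` Q))"
    using neg by (intro negligible_countable_Union countable_image) blast+
  then show ?thesis
  proof (rule negligible_subset, intro subsetI)
    fix x assume x: "x \<in> {x \<in> {a<..<b}. \<not> f differentiable (at x)}"
    obtain c where c: "c \<in> \<rat>" "max a (x - \<delta>/2) < c" "c < x"
      using Rats_dense_in_real[of "max a (x - \<delta>/2)" x] x \<delta>(1) by auto
    obtain d where d: "d \<in> \<rat>" "x < d" "d < min b (x + \<delta>/2)"
      using Rats_dense_in_real[of x "min b (x + \<delta>/2)"] x \<delta>(1) by auto
    have "(c, d) \<in> Q" using c d by (auto simp: Q_def)
    moreover have "x \<in> N (c, d)" using c d x by (auto simp: N_def)
    ultimately show "x \<in> \<Union>(N ` Q)" by blast
  qed
qed

text \<open>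
  In a Riemann sum over a fine tagged division, a tag outside \<open>Z\<close> contributes an error controlled by
  differentiability, while the intervals with tags in \<open>Z\<close> lie in an open set of small measure, where
  absolute continuity makes the increments of \<open>f\<close> small.
\<close>

lemma absolutely_continuous_curve_has_integral:
  fixes f :: "real \<Rightarrow> 'a::euclidean_space"
  assumes ac: "absolutely_continuous_curve a b f"
    and cd: "a \<le> c" "c \<le> d" "d \<le> b"
    and Z: "negligible Z"
    and f': "\<And>x. x \<in> {c..d} - Z \<Longrightarrow> (f has_vector_derivative f' x) (at x)"
  shows "(f' has_integral (f d - f c)) {c..d}"
proof (cases "c = d")
  case True
  then show ?thesis by (auto simp: has_integral_refl)
next
  case False
  with cd have cd': "c < d" by simp
  \<comment> \<open>Values on the null set \<open>Z\<close> do not matter for the integral; with \<open>0\<close> there, tags in \<open>Z\<close> drop out.\<close>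
  define g where "g x = (if x \<in> Z then 0 else f' x)" for x
  have "(g has_integral (f d - f c)) (cbox c d)"
    unfolding has_integral
  proof (intro allI impI)
    fix e :: real assume e: "0 < e"
    obtain \<delta> where \<delta>: "\<delta> > 0" "\<And>I. interval_family a b I \<and> total_length I < \<delta> \<Longrightarrow> total_increment f I < e/2"
      using absolutely_continuous_curveE[OF ac half_gt_zero[OF e]] by blast
    obtain T where T: "open T" "Z \<subseteq> T" "T \<in> lmeasurable" "measure lebesgue T < \<delta>"
      using lmeasurable_outer_open[OF negligible_imp_measurable[OF Z] \<delta>(1)] negligible_imp_measure0[OF Z]
      by auto
    define \<eta> where "\<eta> = e / (2 * (d - c))"
    have \<eta>: "\<eta> > 0" using e cd' by (simp add: \<eta>_def)
    have "\<exists>r>0. (x \<in> Z \<longrightarrow> ball x r \<subseteq> T) \<and>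
        (x \<in> {c..d} - Z \<longrightarrow> (\<forall>y. \<bar>y - x\<bar> < r \<longrightarrow> norm (f y - f x - (y - x) *\<^sub>R f' x) \<le> \<eta> * \<bar>y - x\<bar>))" for x
    proof (cases "x \<in> Z")
      case True
      then show ?thesis using T(1,2) openE by blast
    next
      case nZ: False
      show ?thesis
      proof (cases "x \<in> {c..d}")
        case True
        then have "(f has_derivative (\<lambda>h. h *\<^sub>R f' x)) (at x)"
          using f'[of x] nZ by (simp add: has_vector_derivative_def)
        then obtain r where "r > 0" "\<And>y. norm (y - x) < r \<Longrightarrow> norm (f y - f x - (y - x) *\<^sub>R f' x) \<le> \<eta> * norm (y - x)"
          using \<eta> unfolding has_derivative_at_alt by blast
        then show ?thesis using nZ by (intro exI[of _ r]) auto
      qed (use nZ in \<open>auto intro: exI[of _ 1]\<close>)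
    qed
    then obtain r where r: "\<And>x. r x > 0" "\<And>x. x \<in> Z \<Longrightarrow> ball x (r x) \<subseteq> T"
      "\<And>x y. x \<in> {c..d} - Z \<Longrightarrow> \<bar>y - x\<bar> < r x \<Longrightarrow> norm (f y - f x - (y - x) *\<^sub>R f' x) \<le> \<eta> * \<bar>y - x\<bar>"
      by metis
    define \<gamma> where "\<gamma> x = ball x (r x)" for x
    have gauge: "gauge \<gamma>" using r(1) by (auto simp: gauge_def \<gamma>_def)
    have est: "norm ((\<Sum>(x, k)\<in>p. measure lborel k *\<^sub>R g x) - (f d - f c)) < e"
      if p: "p tagged_division_of cbox c d" "\<gamma> fine p" for p
    proof -
      have fin: "finite p" using p(1) by blast
      define lo hi where "lo i = Inf (snd i)" and "hi i = Sup (snd i)" for i :: "real \<times> real set"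
      have pk: "snd i = {lo i..hi i} \<and> lo i \<le> fst i \<and> fst i \<le> hi i \<and> c \<le> lo i \<and> hi i \<le> d \<and>
          {lo i..hi i} \<subseteq> ball (fst i) (r (fst i)) \<and> measure lborel (snd i) = hi i - lo i" if i: "i \<in> p" for i
      proof -
        obtain x k where xk: "i = (x, k)" by (cases i)
        obtain u v where uv: "k = cbox u v" using tagged_division_ofD(4)[OF p(1)] i xk by blast
        have "x \<in> k" "k \<subseteq> cbox c d" using tagged_division_ofD(2,3)[OF p(1)] i xk by blast+
        moreover have "k \<subseteq> ball x (r x)" using p(2) i xk by (auto simp: fine_def \<gamma>_def)
        ultimately show ?thesis using uv xk by (auto simp: lo_def hi_def)
      qed
      have dj: "{lo i<..<hi i} \<inter> {lo j<..<hi j} = {}" if "i \<in> p" "j \<in> p" "i \<noteq> j" for i j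
      proof -
        have "interior (snd i) \<inter> interior (snd j) = {}"
          using that by (intro tagged_division_ofD(5)[OF p(1), of "fst i" _ "fst j"]) auto
        moreover have "snd i = {lo i..hi i}" "snd j = {lo j..hi j}" using pk that by blast+
        ultimately show ?thesis by (simp add: interior_atLeastAtMost_real)
      qed
      let ?P = "{i\<in>p. fst i \<in> Z}"
      let ?I = "(\<lambda>i. (lo i, hi i)) ` ?P"
      have ndeg: "lo i = hi i" if "i \<in> ?P" "j \<in> ?P" "i \<noteq> j" "(lo i, hi i) = (lo j, hi j)" for i j
      proof (rule ccontr)
        assume "lo i \<noteq> hi i"
        then have "(lo i + hi i) / 2 \<in> {lo i<..<hi i} \<inter> {lo j<..<hi j}" using pk[of i] that by auto
        then show False using dj[of i j] that by auto
      qed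
      have dI: "disjoint_family_on (\<lambda>(s, t). {s<..<t}) ?I"
        unfolding disjoint_family_on_def
      proof (intro ballI impI)
        fix u v assume "u \<in> ?I" "v \<in> ?I" "u \<noteq> v"
        then obtain i j where "i \<in> ?P" "j \<in> ?P" "u = (lo i, hi i)" "v = (lo j, hi j)" "i \<noteq> j" by auto
        then show "(case u of (s, t) \<Rightarrow> {s<..<t}) \<inter> (case v of (s, t) \<Rightarrow> {s<..<t}) = {}"
          using dj[of i j] by auto
      qed
      \<comment> \<open>Open intervals, since adjacent intervals of a division share an end.\<close>
      have "(\<Sum>(s, t)\<in>?I. t - s) = (\<Sum>i\<in>?I. measure lebesgue (case i of (s, t) \<Rightarrow> {s<..<t}))"
      proof (rule sum.cong[OF refl])
        fix u assume "u \<in> ?I"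
        then obtain i where i: "i \<in> p" "u = (lo i, hi i)" by auto
        then have "lo i \<le> hi i" using pk[of i] by auto
        then show "(case u of (s, t) \<Rightarrow> t - s) = measure lebesgue (case u of (s, t) \<Rightarrow> {s<..<t})"
          by (simp add: i(2))
      qed
      also have "\<dots> = measure lebesgue (\<Union>i\<in>?I. case i of (s, t) \<Rightarrow> {s<..<t})"
      proof (intro measure_finite_Union[symmetric] dI)
        have "emeasure lebesgue {s<..<t} \<noteq> \<infinity>" for s t :: real
          using emeasure_bounded_finite[of "{s<..<t}"] by simp
        then show "emeasure lebesgue (case i of (s, t) \<Rightarrow> {s<..<t}) \<noteq> \<infinity>" for i :: "real \<times> real"
          by (cases i) simp
      qed (use fin in auto)
      also have "\<dots> \<le> measure lebesgue T"
      proof (rule measure_mono_fmeasurable[OF _ _ T(3)])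
        show "(\<Union>i\<in>?I. case i of (s, t) \<Rightarrow> {s<..<t}) \<subseteq> T"
        proof clarsimp
          fix x k y assume *: "(x, k) \<in> p" "x \<in> Z" "lo (x, k) < y" "y < hi (x, k)"
          have "{lo (x, k)..hi (x, k)} \<subseteq> ball x (r x)" using pk[OF *(1)] unfolding fst_conv by blast
          moreover have "y \<in> {lo (x, k)..hi (x, k)}" using * by auto
          ultimately have "y \<in> ball x (r x)" by blast
          then show "y \<in> T" using r(2)[OF *(2)] by auto
        qed
        show "(\<Union>i\<in>?I. case i of (s, t) \<Rightarrow> {s<..<t}) \<in> sets lebesgue"
          using fin by (intro sets.finite_UN) (auto split: prod.splits)
      qed
      finally have "(\<Sum>(s, t)\<in>?I. t - s) < \<delta>" using T(4) by simp
      then have "(\<Sum>(s, t)\<in>?I. norm (f t - f s)) < e/2"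
        using fin pk cd dI by (intro \<delta>(2)) fastforce
      also have "(\<Sum>(s, t)\<in>?I. norm (f t - f s)) = (\<Sum>i\<in>?P. norm (f (hi i) - f (lo i)))"
      proof (subst sum.reindex_nontrivial)
        show "(case (lo i, hi i) of (s, t) \<Rightarrow> norm (f t - f s)) = 0"
          if "i \<in> ?P" "j \<in> ?P" "i \<noteq> j" "(lo i, hi i) = (lo j, hi j)" for i j
          using ndeg[OF that] by simp
      qed (use fin in \<open>auto simp: o_def\<close>)
      finally have bad: "(\<Sum>i\<in>?P. norm (f (hi i) - f (lo i))) < e/2" .
      let ?R = "{i\<in>p. fst i \<notin> Z}"
      have "norm ((hi i - lo i) *\<^sub>R f' (fst i) - (f (hi i) - f (lo i))) \<le> \<eta> * (hi i - lo i)" if i: "i \<in> ?R" for i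
      proof -
        let ?x = "fst i"
        have x: "?x \<in> {c..d} - Z" using i pk[of i] by auto
        have "{lo i..hi i} \<subseteq> ball ?x (r ?x)" "lo i \<le> hi i" using i pk[of i] by auto
        then have "lo i \<in> ball ?x (r ?x)" "hi i \<in> ball ?x (r ?x)" by (auto simp del: mem_ball)
        then have "\<bar>lo i - ?x\<bar> < r ?x" "\<bar>hi i - ?x\<bar> < r ?x" by (auto simp: dist_real_def)
        note * = r(3)[OF x this(1)] r(3)[OF x this(2)]
        have "norm ((hi i - lo i) *\<^sub>R f' ?x - (f (hi i) - f (lo i)))
           = norm ((f (lo i) - f ?x - (lo i - ?x) *\<^sub>R f' ?x) - (f (hi i) - f ?x - (hi i - ?x) *\<^sub>R f' ?x))"
          by (rule arg_cong[of _ _ norm]) (simp add: algebra_simps)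
        also have "\<dots> \<le> \<eta> * \<bar>lo i - ?x\<bar> + \<eta> * \<bar>hi i - ?x\<bar>"
          using * norm_triangle_ineq4 order_trans add_mono by meson
        also have "\<dots> = \<eta> * (hi i - lo i)" using i pk[of i] by (simp add: algebra_simps)
        finally show ?thesis .
      qed
      then have "(\<Sum>i\<in>?R. norm ((hi i - lo i) *\<^sub>R f' (fst i) - (f (hi i) - f (lo i)))) \<le> (\<Sum>i\<in>?R. \<eta> * (hi i - lo i))"
        by (rule sum_mono)
      also have "\<dots> \<le> (\<Sum>i\<in>p. \<eta> * (hi i - lo i))"
      proof (rule sum_mono2[OF fin])
        fix i assume "i \<in> p - ?R"
        then have "lo i \<le> hi i" using pk[of i] by auto
        then show "0 \<le> \<eta> * (hi i - lo i)" using \<eta> by simp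
      qed auto
      also have "\<dots> = \<eta> * (\<Sum>(x, k)\<in>p. measure lborel k)"
        unfolding sum_distrib_left by (intro sum.cong) (use pk in auto)
      also have "\<dots> = \<eta> * (d - c)"
        using additive_content_tagged_division[OF p(1)] cd by simp
      also have "\<dots> = e/2" using cd' by (simp add: \<eta>_def divide_simps)
      finally have good: "(\<Sum>i\<in>?R. norm ((hi i - lo i) *\<^sub>R f' (fst i) - (f (hi i) - f (lo i)))) \<le> e/2" .
      have "(\<Sum>(x, k)\<in>p. measure lborel k *\<^sub>R g x) - (f d - f c)
         = (\<Sum>(x, k)\<in>p. measure lborel k *\<^sub>R g x) - (\<Sum>(x, k)\<in>p. f (Sup k) - f (Inf k))"
        using additive_tagged_division_1[OF cd(2), of p f] p(1) by simp
      also have "\<dots> = (\<Sum>i\<in>p. (hi i - lo i) *\<^sub>R g (fst i) - (f (hi i) - f (lo i)))"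
        unfolding sum_subtractf[symmetric] by (intro sum.cong) (use pk in \<open>auto simp: lo_def hi_def\<close>)
      also have "norm \<dots> \<le> (\<Sum>i\<in>p. norm ((hi i - lo i) *\<^sub>R g (fst i) - (f (hi i) - f (lo i))))"
        by (rule norm_sum)
      also have "\<dots> = (\<Sum>i\<in>?P. norm ((hi i - lo i) *\<^sub>R g (fst i) - (f (hi i) - f (lo i)))) +
           (\<Sum>i\<in>?R. norm ((hi i - lo i) *\<^sub>R g (fst i) - (f (hi i) - f (lo i))))"
      proof -
        have p_eq: "p = ?P \<union> ?R" by blast
        have "sum F p = sum F ?P + sum F ?R" for F :: "real \<times> real set \<Rightarrow> real"
          by (subst p_eq, rule sum.union_disjoint) (use fin in simp_all, blast)
        then show ?thesis .
      qed
      also have "(\<Sum>i\<in>?P. norm ((hi i - lo i) *\<^sub>R g (fst i) - (f (hi i) - f (lo i)))) = (\<Sum>i\<in>?P. norm (f (hi i) - f (lo i)))"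
        by (intro sum.cong) (auto simp: g_def norm_minus_commute)
      also have "(\<Sum>i\<in>?R. norm ((hi i - lo i) *\<^sub>R g (fst i) - (f (hi i) - f (lo i)))) =
           (\<Sum>i\<in>?R. norm ((hi i - lo i) *\<^sub>R f' (fst i) - (f (hi i) - f (lo i))))"
        by (intro sum.cong) (auto simp: g_def)
      finally show ?thesis using good bad by linarith
    qed
    show "\<exists>\<gamma>. gauge \<gamma> \<and> (\<forall>\<D>. \<D> tagged_division_of cbox c d \<and> \<gamma> fine \<D> \<longrightarrow>
        norm ((\<Sum>(x, k)\<in>\<D>. measure lborel k *\<^sub>R g x) - (f d - f c)) < e)"
      using gauge est by (intro exI[of _ \<gamma>] conjI allI impI) auto
  qed
  then have "(g has_integral (f d - f c)) {c..d}" by simp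
  then show ?thesis
    by (rule has_integral_spike[OF Z, rotated]) (auto simp: g_def)
qed

text \<open>
  The curve is a Lipschitz function of the value of \<open>V\<close>. Writing that value as a point of the line
  \<open>{p. snd p = 0}\<close> in the plane, which is a null set, makes the image the Lipschitz image of a null set
  of a space of no larger dimension.
\<close>

lemma negligible_variation_controlled_image:
  fixes f :: "real \<Rightarrow> 'a::euclidean_space" and V :: "real \<Rightarrow> real"
  assumes dim: "DIM('a) \<ge> 2"
    and V: "\<And>x y. c \<le> x \<Longrightarrow> x \<le> y \<Longrightarrow> y \<le> d \<Longrightarrow> norm (f y - f x) \<le> V y - V x"
  shows "negligible (f ` {c..d})"
proof -
  have V': "norm (f y - f x) \<le> \<bar>V y - V x\<bar>" if "x \<in> {c..d}" "y \<in> {c..d}" for x y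
    using V[of x y] V[of y x] that by (cases "x \<le> y") (auto simp: norm_minus_commute)
  define S where "S = (\<lambda>t. (V t, 0 :: real)) ` {c..d}"
  define g where "g p = (SOME t. t \<in> {c..d} \<and> V t = fst p)" for p :: "real \<times> real"
  have g: "g p \<in> {c..d} \<and> V (g p) = fst p" if "p \<in> S" for p
    unfolding g_def by (rule someI_ex) (use that in \<open>auto simp: S_def\<close>)
  have "negligible {p :: real \<times> real. p \<bullet> (0, 1) = 0}"
    by (rule negligible_standard_hyperplane) (auto simp: Basis_prod_def)
  then have "negligible S" by (rule negligible_subset) (auto simp: S_def)
  then have "negligible ((\<lambda>p. f (g p)) ` S)"
  proof (rule negligible_locally_Lipschitz_image[rotated])
    show "DIM(real \<times> real) \<le> DIM('a)" using dim by simp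
    fix p assume p: "p \<in> S"
    have "norm (f (g q) - f (g p)) \<le> 1 * norm (q - p)" if "q \<in> S" for q
    proof -
      have "norm (f (g q) - f (g p)) \<le> \<bar>fst q - fst p\<bar>" using V'[of "g p" "g q"] g[OF p] g[OF that] by simp
      also have "\<dots> \<le> norm (q - p)" using dist_fst_le[of q p] by (simp add: dist_norm)
      finally show ?thesis by simp
    qed
    then show "\<exists>T B. open T \<and> p \<in> T \<and> (\<forall>y\<in>S \<inter> T. norm (f (g y) - f (g p)) \<le> B * norm (y - p))"
      by (intro exI[of _ UNIV] exI[of _ 1]) auto
  qed
  then show ?thesis
  proof (rule negligible_subset, intro subsetI)
    fix z assume "z \<in> f ` {c..d}"
    then obtain t where t: "t \<in> {c..d}" "z = f t" by auto
    have p: "(V t, 0) \<in> S" using t by (auto simp: S_def)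
    have "z = f (g (V t, 0))" using V'[of t "g (V t, 0)"] g[OF p] t by simp
    then show "z \<in> (\<lambda>p. f (g p)) ` S" using p by blast
  qed
qed

lemma negligible_absolutely_continuous_curve_image:
  fixes f :: "real \<Rightarrow> 'a::euclidean_space"
  assumes dim: "DIM('a) \<ge> 2" and ac: "absolutely_continuous_curve a b f"
  shows "negligible (f ` {a..b})"
proof -
  obtain \<delta> where \<delta>: "\<delta> > 0"
    "\<And>c d. a \<le> c \<Longrightarrow> d \<le> b \<Longrightarrow> d - c < \<delta> \<Longrightarrow>
      \<exists>V :: real \<Rightarrow> real. \<forall>x y. c \<le> x \<longrightarrow> x \<le> y \<longrightarrow> y \<le> d \<longrightarrow> norm (f y - f x) \<le> V y - V x"
    using absolutely_continuous_curve_local_control[OF ac] by blast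
  define I where "I k = {a + real k * (\<delta>/2)..min b (a + real (Suc k) * (\<delta>/2))}" for k
  have "negligible (f ` I k)" for k
  proof -
    have "a + real (Suc k) * (\<delta>/2) = a + real k * (\<delta>/2) + \<delta>/2" by (simp add: algebra_simps add_divide_distrib)
    moreover have "min b (a + real (Suc k) * (\<delta>/2)) \<le> a + real (Suc k) * (\<delta>/2)" by simp
    ultimately have "min b (a + real (Suc k) * (\<delta>/2)) - (a + real k * (\<delta>/2)) < \<delta>"
      using \<delta>(1) by linarith
    then obtain V :: "real \<Rightarrow> real" where "\<forall>x y. a + real k * (\<delta>/2) \<le> x \<longrightarrow> x \<le> y \<longrightarrow>
        y \<le> min b (a + real (Suc k) * (\<delta>/2)) \<longrightarrow> norm (f y - f x) \<le> V y - V x"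
      using \<delta>(2)[of "a + real k * (\<delta>/2)" "min b (a + real (Suc k) * (\<delta>/2))"] \<delta>(1) by auto
    then show ?thesis unfolding I_def by (intro negligible_variation_controlled_image[OF dim, of _ _ f V]) auto
  qed
  then have "negligible (\<Union>(range (\<lambda>k. f ` I k)))"
    by (intro negligible_countable_Union) blast+
  then show ?thesis
  proof (rule negligible_subset, intro subsetI)
    fix z assume "z \<in> f ` {a..b}"
    then obtain t where t: "t \<in> {a..b}" "z = f t" by auto
    define k where "k = nat \<lfloor>(t - a) / (\<delta>/2)\<rfloor>"
    have "0 \<le> (t - a) / (\<delta>/2)" using t \<delta>(1) by simp
    then have "real k \<le> (t - a) / (\<delta>/2)" "(t - a) / (\<delta>/2) < real (Suc k)"
      unfolding k_def by (auto simp: of_nat_nat) linarith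
    then have "real k * (\<delta>/2) \<le> t - a" "t - a < real (Suc k) * (\<delta>/2)"
      using \<delta>(1) by (simp_all only: pos_le_divide_eq pos_divide_less_eq half_gt_zero)
    then have "t \<in> I k" using t by (auto simp: I_def)
    then show "z \<in> \<Union>(range (\<lambda>k. f ` I k))" using t by blast
  qed
qed

section \<open>Curves that are integrals of their velocity\<close>

abbreviation velocity :: "real \<Rightarrow> real \<Rightarrow> (real \<Rightarrow> 'a::real_normed_vector) \<Rightarrow> real \<Rightarrow> 'a"
  where "velocity a b \<gamma> t \<equiv> vector_derivative \<gamma> (at t within {a..b})"

text \<open>
  The property shared by absolutely continuous curves and by piecewise \<open>C\<^sup>1\<close> curves. The latter are not
  always absolutely continuous, because the derivative may be unbounded near the exceptional points; therefore the
  integral is a Henstock-Kurzweil integral.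
\<close>

definition ftc_curve :: "real \<Rightarrow> real \<Rightarrow> (real \<Rightarrow> 'a::real_normed_vector) \<Rightarrow> bool"
  where "ftc_curve a b \<gamma> \<longleftrightarrow> continuous_on {a..b} \<gamma> \<and> negligible {t \<in> {a<..<b}. \<not> \<gamma> differentiable (at t)} \<and>
    (\<forall>c d. a \<le> c \<longrightarrow> c \<le> d \<longrightarrow> d \<le> b \<longrightarrow> (velocity a b \<gamma> has_integral \<gamma> d - \<gamma> c) {c..d})"

lemma velocity_eq_at:
  assumes "t \<in> {a<..<b}" "(\<gamma> has_vector_derivative v) (at t)"
  shows "velocity a b \<gamma> t = v"
proof -
  have "at t within {a..b} = at t" using assms(1) by (intro at_within_Icc_at) auto
  then show ?thesis using assms(2) by (simp add: vector_derivative_at)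
qed

lemma velocity_eq_within:
  assumes "a < b" "t \<in> {a..b}" "(\<gamma> has_vector_derivative v) (at t within {a..b})"
  shows "velocity a b \<gamma> t = v"
  using vector_derivative_within_cbox[of a b t \<gamma> v] assms by simp

lemma velocity_add_const: "velocity a b (\<lambda>t. \<gamma> t + w) t = velocity a b \<gamma> t"
  by (simp add: vector_derivative_def has_vector_derivative_add_const)

lemma absolutely_continuous_curve_ftc:
  fixes \<gamma> :: "real \<Rightarrow> 'a::euclidean_space"
  assumes ac: "absolutely_continuous_curve a b \<gamma>"
  shows "ftc_curve a b \<gamma>"
  unfolding ftc_curve_def
proof (intro conjI allI impI)
  show "negligible {t \<in> {a<..<b}. \<not> \<gamma> differentiable (at t)}"
    by (rule absolutely_continuous_curve_differentiable_ae[OF ac])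
  show "continuous_on {a..b} \<gamma>" by (rule absolutely_continuous_curve_imp_continuous_on[OF ac])
  fix c d assume cd: "a \<le> c" "c \<le> d" "d \<le> b"
  define Z where "Z = {x \<in> {a<..<b}. \<not> \<gamma> differentiable (at x)} \<union> {a, b}"
  have "negligible Z" unfolding Z_def
    by (intro negligible_Un absolutely_continuous_curve_differentiable_ae[OF ac] negligible_finite) auto
  then show "(velocity a b \<gamma> has_integral \<gamma> d - \<gamma> c) {c..d}"
  proof (rule absolutely_continuous_curve_has_integral[OF ac cd])
    fix x assume x: "x \<in> {c..d} - Z"
    then have "\<gamma> differentiable (at x)" "x \<in> {a<..<b}" using cd by (auto simp: Z_def)
    then show "(\<gamma> has_vector_derivative velocity a b \<gamma> x) (at x)"
      using velocity_eq_at vector_derivative_works by metis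
  qed
qed

lemma piecewise_C1_ftc:
  fixes \<gamma> :: "real \<Rightarrow> 'a::euclidean_space"
  assumes "\<gamma> piecewise_C1_differentiable_on {a..b}"
  shows "ftc_curve a b \<gamma>"
proof -
  obtain S D where S: "continuous_on {a..b} \<gamma>" "finite S"
    and D: "\<And>x. x \<in> {a..b} - S \<Longrightarrow> (\<gamma> has_vector_derivative D x) (at x)"
    using assms unfolding piecewise_C1_differentiable_on_def C1_differentiable_on_def by blast
  show ?thesis
    unfolding ftc_curve_def
  proof (intro conjI allI impI)
    show "continuous_on {a..b} \<gamma>" by fact
    show "negligible {t \<in> {a<..<b}. \<not> \<gamma> differentiable (at t)}"
    proof (rule negligible_subset[OF negligible_finite[OF S(2)]])
      show "{t \<in> {a<..<b}. \<not> \<gamma> differentiable (at t)} \<subseteq> S"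
      proof (rule subsetI, rule ccontr)
        fix t assume t: "t \<in> {t \<in> {a<..<b}. \<not> \<gamma> differentiable (at t)}" and "t \<notin> S"
        then have "(\<gamma> has_vector_derivative D t) (at t)" by (intro D) auto
        then show False using t differentiableI_vector by blast
      qed
    qed
    fix c d assume cd: "a \<le> c" "c \<le> d" "d \<le> b"
    show "(velocity a b \<gamma> has_integral \<gamma> d - \<gamma> c) {c..d}"
    proof (rule fundamental_theorem_of_calculus_strong[of "S \<union> {a, b}"])
      show "continuous_on {c..d} \<gamma>" by (rule continuous_on_subset[OF S(1)]) (use cd in auto)
      fix x assume x: "x \<in> {c..d} - (S \<union> {a, b})"
      then have "x \<in> {a..b} - S" "x \<in> {a<..<b}" using cd by auto
      then show "(\<gamma> has_vector_derivative velocity a b \<gamma> x) (at x)"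
        using velocity_eq_at D by metis
    qed (use S cd in auto)
  qed
qed

lemma ftc_curve_velocity_measurable:
  fixes \<gamma> :: "real \<Rightarrow> 'a::euclidean_space"
  assumes "ftc_curve a b \<gamma>" "a \<le> b"
  shows "(\<lambda>t. indicator {a..b} t *\<^sub>R velocity a b \<gamma> t) \<in> borel_measurable lebesgue"
  using assms has_integral_implies_lebesgue_measurable unfolding ftc_curve_def by blast

text \<open>
  The map \<open>L\<close> will be the one that carries the mass norm to the Euclidean norm. If the right-hand side is finite, the
  velocity is Lebesgue integrable and the two notions of integral agree.
\<close>

lemma ftc_curve_norm_increment_le:
  fixes \<gamma> :: "real \<Rightarrow> 'a::euclidean_space" and L :: "'a \<Rightarrow> 'b::euclidean_space"
  assumes \<gamma>: "ftc_curve a b \<gamma>" and cd: "a \<le> c" "c \<le> d" "d \<le> b" and L: "bounded_linear L"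
  shows "ennreal (norm (L (\<gamma> d - \<gamma> c))) \<le> (\<integral>\<^sup>+ t\<in>{c..d}. ennreal (norm (L (velocity a b \<gamma> t))) \<partial>lebesgue)"
    (is "_ \<le> ?R")
proof (cases "?R < \<infinity>")
  case True
  define f where "f t = indicator {c..d} t *\<^sub>R L (velocity a b \<gamma> t)" for t
  have "(velocity a b \<gamma> has_integral \<gamma> d - \<gamma> c) {c..d}" using \<gamma> cd by (auto simp: ftc_curve_def)
  then have int: "((\<lambda>t. L (velocity a b \<gamma> t)) has_integral L (\<gamma> d - \<gamma> c)) {c..d}"
    using has_integral_linear[OF _ L] by (auto simp: o_def)
  then have "f \<in> borel_measurable lebesgue"
    unfolding f_def by (rule has_integral_implies_lebesgue_measurable)
  moreover have eq: "?R = (\<integral>\<^sup>+ t. ennreal (norm (f t)) \<partial>lebesgue)"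
    by (intro nn_integral_cong) (auto simp: f_def indicator_def)
  ultimately have f: "integrable lebesgue f" using True by (intro integrableI_bounded) auto
  have "(f has_integral L (\<gamma> d - \<gamma> c)) UNIV"
  proof -
    have "f = (\<lambda>t. if t \<in> {c..d} then L (velocity a b \<gamma> t) else 0)" by (auto simp: f_def indicator_def)
    then show ?thesis using int by (simp only: has_integral_restrict_UNIV)
  qed
  then have "L (\<gamma> d - \<gamma> c) = integral\<^sup>L lebesgue f"
    using has_integral_integral_lebesgue[OF f] has_integral_unique by blast
  then show ?thesis unfolding eq using integral_norm_bound_ennreal[OF f] by simp
next
  case False
  then have "?R = \<infinity>" by (simp add: less_top[symmetric])
  then show ?thesis by simp
qed

section \<open>Actions of curves and the costs that they define\<close>

definition curve_action :: "('a::real_normed_vector \<Rightarrow> 'a \<Rightarrow> ennreal) \<Rightarrow> real \<Rightarrow> real \<Rightarrow> (real \<Rightarrow> 'a) \<Rightarrow> ennreal"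
  where "curve_action L a b \<gamma> = (\<integral>\<^sup>+ t\<in>{a..b}. L (\<gamma> t) (velocity a b \<gamma> t) \<partial>lebesgue)"

definition curve_cost ::
  "(real \<Rightarrow> real \<Rightarrow> (real \<Rightarrow> 'a) \<Rightarrow> bool) \<Rightarrow> ('a::real_normed_vector \<Rightarrow> 'a \<Rightarrow> ennreal) \<Rightarrow> 'a \<Rightarrow> 'a \<Rightarrow> ennreal"
  where "curve_cost P L x y = Inf {curve_action L a b \<gamma> | a b \<gamma>. a < b \<and> P a b \<gamma> \<and> \<gamma> a = x \<and> \<gamma> b = y}"

lemma ftc_curve_path_measurable:
  fixes \<gamma> :: "real \<Rightarrow> 'a::euclidean_space"
  assumes "ftc_curve a b \<gamma>"
  shows "(\<lambda>t. indicator {a..b} t *\<^sub>R \<gamma> t) \<in> borel_measurable borel"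
  using assms by (intro borel_measurable_continuous_on_indicator) (auto simp: ftc_curve_def)

lemma curve_action_integrand_measurable:
  fixes \<gamma> :: "real \<Rightarrow> 'a::euclidean_space" and L :: "'a \<Rightarrow> 'a \<Rightarrow> ennreal"
  assumes \<gamma>: "ftc_curve a b \<gamma>" and ab: "a \<le> b" and L: "(\<lambda>(x, v). L x v) \<in> borel_measurable borel"
  shows "(\<lambda>t. L (\<gamma> t) (velocity a b \<gamma> t) * indicator {a..b} t) \<in> borel_measurable lebesgue"
proof -
  let ?I = "\<lambda>t. indicator {a..b} t :: real"
  have 1: "(\<lambda>t. ?I t *\<^sub>R \<gamma> t) \<in> borel_measurable lebesgue"
    using ftc_curve_path_measurable[OF \<gamma>] by (intro measurable_completion) simp
  have "(\<lambda>t. (?I t *\<^sub>R \<gamma> t, ?I t *\<^sub>R velocity a b \<gamma> t)) \<in> borel_measurable lebesgue"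
    by (rule borel_measurable_Pair[OF 1 ftc_curve_velocity_measurable[OF \<gamma> ab]])
  then have "(\<lambda>t. (\<lambda>(x, v). L x v) (?I t *\<^sub>R \<gamma> t, ?I t *\<^sub>R velocity a b \<gamma> t)) \<in> borel_measurable lebesgue"
    by (rule measurable_compose[OF _ L])
  then have "(\<lambda>t. L (?I t *\<^sub>R \<gamma> t) (?I t *\<^sub>R velocity a b \<gamma> t) * indicator {a..b} t) \<in> borel_measurable lebesgue"
    by (intro borel_measurable_times_ennreal borel_measurable_indicator) auto
  also have "(\<lambda>t. L (?I t *\<^sub>R \<gamma> t) (?I t *\<^sub>R velocity a b \<gamma> t) * indicator {a..b} t)
     = (\<lambda>t. L (\<gamma> t) (velocity a b \<gamma> t) * indicator {a..b} t)"
    by (auto simp: indicator_def)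
  finally show ?thesis .
qed

text \<open>
  With \<open>\<sigma> = 1\<close> this is translation of time, with \<open>\<sigma> = -1\<close> it is reversal. The velocities correspond only
  where the curve is differentiable, hence almost everywhere.
\<close>

lemma curve_action_affine:
  fixes \<gamma> :: "real \<Rightarrow> 'a::euclidean_space" and L :: "'a \<Rightarrow> 'a \<Rightarrow> ennreal" and \<sigma> s :: real
  assumes \<gamma>: "ftc_curve a b \<gamma>" and ab: "a \<le> b" and L: "(\<lambda>(x, v). L x v) \<in> borel_measurable borel"
    and \<sigma>: "\<sigma> * \<sigma> = 1" "\<And>x v. L x (\<sigma> *\<^sub>R v) = L x v"
    and ab': "\<And>t. t \<in> {a'..b'} \<longleftrightarrow> s + \<sigma> * t \<in> {a..b}" "\<And>t. t \<in> {a'<..<b'} \<longleftrightarrow> s + \<sigma> * t \<in> {a<..<b}"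
  shows "curve_action L a' b' (\<lambda>t. \<gamma> (s + \<sigma> * t)) = curve_action L a b \<gamma>"
proof -
  define N where "N = {t \<in> {a<..<b}. \<not> \<gamma> differentiable (at t)} \<union> {a, b}"
  define N' where "N' = (\<lambda>u. \<sigma> * (u - s)) ` N"
  have \<sigma>_nz: "\<sigma> \<noteq> 0" using \<sigma>(1) by auto
  have \<sigma>_abs: "\<bar>\<sigma>\<bar> = 1" using \<sigma>(1) by (metis abs_mult_self_eq abs_1 abs_mult mult_cancel_right2 abs_square_eq_1 power2_eq_square)
  have "negligible N" 
    using \<gamma> unfolding N_def ftc_curve_def by (intro negligible_Un) (auto simp: negligible_finite)
  then have "negligible N'" unfolding N'_def
    by (intro negligible_differentiable_image_negligible) (auto intro!: derivative_intros)
  then have "AE t in lebesgue. t \<notin> N'" by (intro AE_not_in) (simp add: negligible_iff_null_sets)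
  then have "AE t in lebesgue. L (\<gamma> (s + \<sigma> * t)) (velocity a' b' (\<lambda>t. \<gamma> (s + \<sigma> * t)) t) * indicator {a'..b'} t
      = L (\<gamma> (s + \<sigma> * t)) (velocity a b \<gamma> (s + \<sigma> * t)) * indicator {a..b} (s + \<sigma> * t)"
  proof eventually_elim
    case (elim t)
    let ?u = "s + \<sigma> * t"
    have "?u \<notin> N"
    proof
      assume "?u \<in> N"
      then have "\<sigma> * (?u - s) \<in> N'" unfolding N'_def by (rule imageI)
      then show False using elim \<sigma>(1) by (simp add: mult.assoc[symmetric])
    qed
    show ?case
    proof (cases "?u \<in> {a..b}")
      case True
      then have u: "?u \<in> {a<..<b}" and "\<gamma> differentiable (at ?u)" using \<open>?u \<notin> N\<close> by (auto simp: N_def)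
      then have w: "(\<gamma> has_vector_derivative velocity a b \<gamma> ?u) (at ?u)"
        using velocity_eq_at vector_derivative_works by metis
      have "((\<lambda>t. s + \<sigma> * t) has_vector_derivative \<sigma>) (at t)"
        by (auto intro!: derivative_eq_intros simp: has_real_derivative_iff_has_vector_derivative[symmetric])
      from vector_diff_chain_at[OF this w]
      have "velocity a' b' (\<lambda>t. \<gamma> (s + \<sigma> * t)) t = \<sigma> *\<^sub>R velocity a b \<gamma> ?u"
        using u ab'(2)[of t] by (intro velocity_eq_at) (auto simp: o_def)
      then show ?thesis using True ab'(1)[of t] \<sigma>(2) by (simp add: indicator_def)
    next
      case False
      then show ?thesis using ab'(1)[of t] by (auto simp: indicator_def)
    qed
  qed
  then have "curve_action L a' b' (\<lambda>t. \<gamma> (s + \<sigma> * t))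
     = (\<integral>\<^sup>+ t. L (\<gamma> (s + \<sigma> * t)) (velocity a b \<gamma> (s + \<sigma> * t)) * indicator {a..b} (s + \<sigma> * t) \<partial>lebesgue)"
    unfolding curve_action_def by (rule nn_integral_cong_AE)
  also have "\<dots> = curve_action L a b \<gamma>"
    using nn_integral_real_affine_lebesgue[OF curve_action_integrand_measurable[OF \<gamma> ab L] \<sigma>_nz, of s] \<sigma>_abs
    by (simp add: curve_action_def)
  finally show ?thesis .
qed

lemma curve_action_join:
  fixes \<gamma>1 \<gamma>2 :: "real \<Rightarrow> 'a::euclidean_space" and L :: "'a \<Rightarrow> 'a \<Rightarrow> ennreal"
  assumes 1: "ftc_curve a c \<gamma>1" and 2: "ftc_curve c b \<gamma>2" and c: "a \<le> c" "c \<le> b"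
    and L: "(\<lambda>(x, v). L x v) \<in> borel_measurable borel"
  shows "curve_action L a b (\<lambda>t. if t \<le> c then \<gamma>1 t else \<gamma>2 t) = curve_action L a c \<gamma>1 + curve_action L c b \<gamma>2"
    (is "curve_action L a b ?j = _")
proof -
  have "negligible {a, b, c}" by (intro negligible_finite) auto
  then have "AE t in lebesgue. t \<notin> {a, b, c}" by (intro AE_not_in) (simp add: negligible_iff_null_sets)
  then have "AE t in lebesgue. L (?j t) (velocity a b ?j t) * indicator {a..b} t
     = L (\<gamma>1 t) (velocity a c \<gamma>1 t) * indicator {a..c} t + L (\<gamma>2 t) (velocity c b \<gamma>2 t) * indicator {c..b} t"
  proof eventually_elim
    case (elim t)
    consider "t \<in> {a<..<c}" | "t \<in> {c<..<b}" | "t \<notin> {a..b}" using elim by force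
    then show ?case
    proof cases
      case 1
      have "at t within {a..b} = at t" "at t within {a..c} = at t"
        using 1 c by (auto intro!: at_within_Icc_at)
      moreover have "vector_derivative ?j (at t) = vector_derivative \<gamma>1 (at t)"
        using 1 by (intro vector_derivative_cong_eq eventually_nhds_in_open[of "{a<..<c}", THEN eventually_mono]) auto
      ultimately show ?thesis using 1 c by simp
    next
      case 2
      have "at t within {a..b} = at t" "at t within {c..b} = at t"
        using 2 c by (auto intro!: at_within_Icc_at)
      moreover have "vector_derivative ?j (at t) = vector_derivative \<gamma>2 (at t)"
        using 2 by (intro vector_derivative_cong_eq eventually_nhds_in_open[of "{c<..<b}", THEN eventually_mono]) auto
      ultimately show ?thesis using 2 c by simp
    qed (use c in auto)
  qed
  then have "curve_action L a b ?j = (\<integral>\<^sup>+ t. L (\<gamma>1 t) (velocity a c \<gamma>1 t) * indicator {a..c} t +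
      L (\<gamma>2 t) (velocity c b \<gamma>2 t) * indicator {c..b} t \<partial>lebesgue)"
    unfolding curve_action_def by (rule nn_integral_cong_AE)
  also have "\<dots> = curve_action L a c \<gamma>1 + curve_action L c b \<gamma>2"
    unfolding curve_action_def
    by (rule nn_integral_add) (intro curve_action_integrand_measurable 1 2 c L)+
  finally show ?thesis .
qed

lemma curve_action_le_const:
  assumes "\<And>t. t \<in> {a..b} \<Longrightarrow> L (\<gamma> t) (velocity a b \<gamma> t) \<le> K" "a \<le> b"
  shows "curve_action L a b \<gamma> \<le> K * ennreal (b - a)"
proof -
  have "curve_action L a b \<gamma> \<le> (\<integral>\<^sup>+ t. K * indicator {a..b} t \<partial>lebesgue)"
    unfolding curve_action_def using assms by (intro nn_integral_mono) (auto simp: indicator_def)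
  also have "\<dots> = K * ennreal (b - a)"
    using assms(2) by (subst nn_integral_cmult_indicator) (auto simp: emeasure_lborel_Icc_eq)
  finally show ?thesis .
qed

lemma curve_cost_le:
  assumes "a < b" "P a b \<gamma>" "\<gamma> a = x" "\<gamma> b = y"
  shows "curve_cost P L x y \<le> curve_action L a b \<gamma>"
  unfolding curve_cost_def using assms by (intro Inf_lower) auto

lemma curve_cost_less:
  assumes "curve_cost P L x y < r"
  obtains a b \<gamma> where "a < b" "P a b \<gamma>" "\<gamma> a = x" "\<gamma> b = y" "curve_action L a b \<gamma> < r"
  using assms unfolding curve_cost_def Inf_less_iff by blast

lemma curve_cost_approx:
  assumes "curve_cost P L x y < \<infinity>" "e > 0"
  obtains a b \<gamma> where "a < b" "P a b \<gamma>" "\<gamma> a = x" "\<gamma> b = y" "curve_action L a b \<gamma> \<le> curve_cost P L x y + ennreal e"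
proof -
  have "curve_cost P L x y < curve_cost P L x y + ennreal e"
    using assms by (cases "curve_cost P L x y")
      (auto simp: ennreal_plus[symmetric] ennreal_less_iff simp del: ennreal_plus)
  then show ?thesis using that by (elim curve_cost_less) (auto dest: less_imp_le)
qed

text \<open>
  Concatenation of an almost optimal curve with a translate in time of another one.
\<close>

lemma curve_cost_triangle:
  fixes L :: "'a::euclidean_space \<Rightarrow> 'a \<Rightarrow> ennreal"
  assumes ftc: "\<And>a b \<gamma>. P a b \<gamma> \<Longrightarrow> ftc_curve a b \<gamma>"
    and shift: "\<And>a b s \<gamma>. P a b \<gamma> \<Longrightarrow> P (a - s) (b - s) (\<lambda>t. \<gamma> (s + 1 * t))"
    and join: "\<And>a b c \<gamma>1 \<gamma>2. \<lbrakk>P a c \<gamma>1; P c b \<gamma>2; a < c; c < b; \<gamma>1 c = \<gamma>2 c\<rbrakk> \<Longrightarrow>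
        P a b (\<lambda>t. if t \<le> c then \<gamma>1 t else \<gamma>2 t)"
    and L: "(\<lambda>(x, v). L x v) \<in> borel_measurable borel"
  shows "curve_cost P L x z \<le> curve_cost P L x y + curve_cost P L y z"
proof (rule ennreal_le_epsilon)
  fix e :: real assume fin: "curve_cost P L x y + curve_cost P L y z < top" and e: "0 < e"
  then have "curve_cost P L x y < \<infinity>" "curve_cost P L y z < \<infinity>" by (auto simp: less_top)
  then obtain a b \<gamma>1 c d \<gamma>2 where
    1: "a < b" "P a b \<gamma>1" "\<gamma>1 a = x" "\<gamma>1 b = y" "curve_action L a b \<gamma>1 \<le> curve_cost P L x y + ennreal (e/2)" and
    2: "c < d" "P c d \<gamma>2" "\<gamma>2 c = y" "\<gamma>2 d = z" "curve_action L c d \<gamma>2 \<le> curve_cost P L y z + ennreal (e/2)"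
    using e by (metis curve_cost_approx half_gt_zero)
  define s where "s = c - b"
  let ?\<gamma>2 = "\<lambda>t. \<gamma>2 (s + 1 * t)"
  have P2: "P b (d - s) ?\<gamma>2" using shift[OF 2(2), of s] by (simp add: s_def)
  let ?j = "\<lambda>t. if t \<le> b then \<gamma>1 t else ?\<gamma>2 t"
  have bd: "b < d - s" using 2(1) by (simp add: s_def)
  have "curve_cost P L x z \<le> curve_action L a (d - s) ?j"
    using 1 2 bd by (intro curve_cost_le join[OF 1(2) P2]) (auto simp: s_def)
  also have "\<dots> = curve_action L a b \<gamma>1 + curve_action L b (d - s) ?\<gamma>2"
    using 1(1) bd by (intro curve_action_join ftc 1(2) P2 L) auto
  also have "curve_action L b (d - s) ?\<gamma>2 = curve_action L c d \<gamma>2"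
    by (rule curve_action_affine[OF ftc[OF 2(2)] _ L]) (use 2(1) in \<open>auto simp: s_def\<close>)
  also have "curve_action L a b \<gamma>1 + curve_action L c d \<gamma>2 \<le>
      (curve_cost P L x y + ennreal (e/2)) + (curve_cost P L y z + ennreal (e/2))"
    by (intro add_mono 1(5) 2(5))
  also have "\<dots> = curve_cost P L x y + curve_cost P L y z + (ennreal (e/2) + ennreal (e/2))"
    by (simp add: ac_simps)
  also have "ennreal (e/2) + ennreal (e/2) = ennreal e"
    using e by (subst ennreal_plus[symmetric]) auto
  finally show "curve_cost P L x z \<le> curve_cost P L x y + curve_cost P L y z + ennreal e" .
qed

lemma curve_cost_commute_le:
  fixes L :: "'a::euclidean_space \<Rightarrow> 'a \<Rightarrow> ennreal"
  assumes ftc: "\<And>a b \<gamma>. P a b \<gamma> \<Longrightarrow> ftc_curve a b \<gamma>"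
    and reverse: "\<And>a b \<gamma>. P a b \<gamma> \<Longrightarrow> P (- b) (- a) (\<lambda>t. \<gamma> (0 + (- 1) * t))"
    and L: "(\<lambda>(x, v). L x v) \<in> borel_measurable borel" and even: "\<And>x v. L x (- v) = L x v"
  shows "curve_cost P L y x \<le> curve_cost P L x y"
  unfolding curve_cost_def[of P L x y]
proof (rule Inf_greatest, clarify)
  fix a b \<gamma> assume *: "a < b" "P a b \<gamma>" "x = \<gamma> a" "y = \<gamma> b"
  have "curve_cost P L (\<gamma> b) (\<gamma> a) \<le> curve_action L (- b) (- a) (\<lambda>t. \<gamma> (0 + (- 1) * t))"
    using * by (intro curve_cost_le reverse) auto
  also have "\<dots> = curve_action L a b \<gamma>"
    using * even by (intro curve_action_affine ftc L) auto
  finally show "curve_cost P L (\<gamma> b) (\<gamma> a) \<le> curve_action L a b \<gamma>" .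
qed

section \<open>The mass norm, the potential and the collisions\<close>

text \<open>
  The linear isomorphism that carries the mass norm to the Euclidean norm and through which the mass norm
  inherits the properties of the latter.
\<close>

definition mass_scale :: "('n::finite \<Rightarrow> real) \<Rightarrow> ('e::euclidean_space, 'n) vec \<Rightarrow> ('e, 'n) vec"
  where "mass_scale m x = (\<chi> i. sqrt (m i) *\<^sub>R x $ i)"

lemma linear_mass_scale: "linear (mass_scale m)"
  by (rule linearI) (simp_all add: mass_scale_def vec_eq_iff scaleR_add_right)

lemma bounded_linear_mass_scale: "bounded_linear (mass_scale m)"
  using linear_mass_scale linear_conv_bounded_linear by blast

lemma mass_norm_eq_norm_mass_scale:
  assumes "\<And>i. m i > 0"
  shows "mass_norm m x = norm (mass_scale m x)"
proof -
  have eq: "(sqrt (m i) *\<^sub>R x $ i) \<bullet> (sqrt (m i) *\<^sub>R x $ i) = m i * (x $ i \<bullet> x $ i)" for i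
  proof -
    have "sqrt (m i) * sqrt (m i) = m i" using assms[of i] by simp
    then show ?thesis by (simp add: mult.assoc[symmetric])
  qed
  show ?thesis
    unfolding mass_norm_def mass_inner_def norm_eq_sqrt_inner inner_vec_def mass_scale_def vec_lambda_beta eq ..
qed

lemma mass_scale_bounded_below:
  fixes m :: "'n::finite \<Rightarrow> real"
  assumes m: "\<And>i. m i > 0"
  obtains B where "B > 0" "\<And>x :: ('e::euclidean_space, 'n) vec. B * norm x \<le> norm (mass_scale m x)"
proof -
  have "inj (mass_scale m :: ('e, 'n) vec \<Rightarrow> _)"
    using m by (intro injI) (auto simp: mass_scale_def vec_eq_iff less_imp_neq[OF m, symmetric])
  then show ?thesis using linear_inj_bounded_below_pos[OF linear_mass_scale] that by blast
qed

definition real_potential :: "('n::{finite,linorder} \<Rightarrow> real) \<Rightarrow> ('e::euclidean_space, 'n) vec \<Rightarrow> real"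
  where "real_potential m x = (\<Sum>(i, j)\<in>{(i, j). i < j}. m i * m j / norm (x $ i - x $ j))"

lemma pair_potential:
  assumes "0 < a"
  shows "ennreal a / ennreal (norm z) = (if z = 0 then \<infinity> else ennreal (a / norm z))"
  using assms by (simp add: divide_ennreal ennreal_divide_eq_top_iff)

lemma collision_free_iff:
  fixes m :: "'n::{finite,linorder} \<Rightarrow> real" and x :: "('e::euclidean_space, 'n) vec"
  assumes m: "\<And>i. m i > 0"
  shows "x \<in> collision_free m \<longleftrightarrow> (\<forall>i j. i < j \<longrightarrow> x $ i \<noteq> x $ j)"
proof -
  have "newton_potential m x < \<infinity> \<longleftrightarrow> (\<forall>(i, j)\<in>{(i, j). i < j}. ennreal (m i * m j) / ennreal (norm (x $ i - x $ j)) < \<infinity>)"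
    unfolding newton_potential_def by (subst ennreal_sum_less_top[unfolded infinity_ennreal_def[symmetric]]) (auto simp: finite_subset[OF subset_UNIV])
  also have "\<dots> \<longleftrightarrow> (\<forall>i j. i < j \<longrightarrow> x $ i \<noteq> x $ j)"
    using m by (auto simp: pair_potential split: if_splits)
  finally show ?thesis by (simp add: collision_free_def)
qed

lemma real_potential_nonneg:
  assumes m: "\<And>i. m i > 0" shows "0 \<le> real_potential m x"
  unfolding real_potential_def
  by (rule sum_nonneg) (auto intro!: divide_nonneg_nonneg mult_nonneg_nonneg less_imp_le[OF m])

lemma newton_potential_eq_real:
  assumes m: "\<And>i. m i > 0" and x: "x \<in> collision_free m"
  shows "newton_potential m x = ennreal (real_potential m x)"
proof -
  have "newton_potential m x = (\<Sum>p\<in>{(i, j). i < j}. ennreal (case p of (i, j) \<Rightarrow> m i * m j / norm (x $ i - x $ j)))"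
    unfolding newton_potential_def
    using x by (intro sum.cong) (auto simp: collision_free_iff[OF m] pair_potential m)
  also have "\<dots> = ennreal (real_potential m x)"
    unfolding real_potential_def
    by (rule sum_ennreal) (auto intro!: divide_nonneg_nonneg mult_nonneg_nonneg less_imp_le[OF m])
  finally show ?thesis .
qed

lemma collision_free_eq_Inter:
  assumes m: "\<And>i. m i > 0"
  shows "collision_free m = (\<Inter>(i, j)\<in>{(i, j). i < j}. {x. x $ i - x $ j \<noteq> 0})"
  by (auto simp: collision_free_iff[OF m])

lemma open_collision_free:
  fixes m :: "'n::{finite,linorder} \<Rightarrow> real"
  assumes m: "\<And>i. m i > 0"
  shows "open (collision_free m :: ('e::euclidean_space, 'n) vec set)"
  unfolding collision_free_eq_Inter[OF m]
  by (intro open_INT) (auto intro!: open_Collect_neq continuous_intros finite_subset[OF subset_UNIV])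

lemma continuous_on_real_potential:
  assumes m: "\<And>i. m i > 0"
  shows "continuous_on (collision_free m) (real_potential m)"
  unfolding real_potential_def split_beta
  by (intro continuous_intros) (auto simp: collision_free_iff[OF m])

lemma newton_potential_measurable [measurable]:
  "(newton_potential m :: ('e::euclidean_space, 'n::{finite,linorder}) vec \<Rightarrow> ennreal) \<in> borel_measurable borel"
proof -
  have [measurable]: "(\<lambda>x :: ('e, 'n) vec. norm (x $ i - x $ j)) \<in> borel_measurable borel" for i j
    by (intro borel_measurable_continuous_onI continuous_intros)
  show ?thesis unfolding newton_potential_def[abs_def] split_beta by measurable
qed

text \<open>
  One pair of bodies suffices: their distance is at most twice the norm of the configuration.
\<close>

lemma newton_potential_lower_bound:
  fixes m :: "'n::{finite,linorder} \<Rightarrow> real"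
  assumes m: "\<And>i. m i > 0" and n: "CARD('n) \<ge> 2"
  obtains c where "c > 0"
    "\<And>(x :: ('e::euclidean_space, 'n) vec) R. norm x \<le> R \<Longrightarrow> 0 < R \<Longrightarrow> ennreal (c / R) \<le> newton_potential m x"
proof -
  obtain i j :: 'n where "i \<noteq> j"
    using n by (metis card_2_iff' ex_card UNIV_I)
  then obtain i j :: 'n where ij: "i < j" by (metis linorder_neqE)
  show ?thesis
  proof (rule that[of "m i * m j / 2"])
    show "m i * m j / 2 > 0" using m by simp
    fix x :: "('e, 'n) vec" and R :: real assume R: "norm x \<le> R" "0 < R"
    have le: "norm (x $ i - x $ j) \<le> 2 * R"
      using norm_triangle_ineq4[of "x $ i" "x $ j"] R Finite_Cartesian_Product.norm_nth_le[of x i]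
        Finite_Cartesian_Product.norm_nth_le[of x j] by linarith
    have "ennreal (m i * m j / 2 / R) \<le> ennreal (m i * m j) / ennreal (norm (x $ i - x $ j))"
    proof (cases "x $ i - x $ j = 0")
      case True
      then show ?thesis by (subst pair_potential[OF mult_pos_pos[OF m m]]) simp
    next
      case False
      have "m i * m j / 2 / R \<le> m i * m j / norm (x $ i - x $ j)"
      proof -
        have "m i * m j / (2 * R) \<le> m i * m j / norm (x $ i - x $ j)"
          using False le mult_pos_pos[OF m m] by (intro frac_le) (auto intro: less_imp_le)
        then show ?thesis by simp
      qed
      then show ?thesis using False by (simp add: pair_potential m ennreal_leI)
    qed
    also have "\<dots> \<le> newton_potential m x"
      unfolding newton_potential_def
      by (rule order_trans[OF _ member_le_sum[of "(i, j)"]]) (use ij in \<open>auto simp: finite_subset[OF subset_UNIV]\<close>)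
    finally show "ennreal (m i * m j / 2 / R) \<le> newton_potential m x" .
  qed
qed

lemma jm_metric_eq:
  assumes m: "\<And>i. m i > 0" and h: "h \<ge> 0" and x: "x \<in> collision_free m"
  shows "sqrt (jm_metric m h x v v) = sqrt (2 * (h + real_potential m x)) * norm (mass_scale m v)"
proof -
  have "mass_inner m v v = (norm (mass_scale m v))\<^sup>2"
  proof -
    have "0 \<le> mass_inner m v v" 
      unfolding mass_inner_def by (rule sum_nonneg) (simp add: less_imp_le[OF m])
    then show ?thesis by (simp add: mass_norm_eq_norm_mass_scale[OF m, symmetric] mass_norm_def)
  qed
  then show ?thesis
    using real_potential_nonneg[of m x, OF m] by (simp add: jm_metric_def newton_potential_eq_real[OF m x] real_sqrt_mult)
qed

text \<open>
  The direction in which a configuration is shifted: body \<open>i\<close> moves by \<open>c i\<close> times a common vector. One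
  vector of the ambient space, rather than one for each body, suffices to separate all pairs.
\<close>

definition spread :: "('n::finite \<Rightarrow> real) \<Rightarrow> 'e::euclidean_space \<Rightarrow> ('e, 'n) vec"
  where "spread c v = (\<chi> i. c i *\<^sub>R v)"

lemma bounded_linear_spread: "bounded_linear (spread c)"
proof -
  have "linear (spread c)"
    by (rule linearI) (simp_all add: spread_def vec_eq_iff scaleR_add_right)
  then show ?thesis using linear_conv_bounded_linear by blast
qed

lemma exists_separated_weights:
  obtains c :: "'n::finite \<Rightarrow> real" where "\<And>i j. i \<noteq> j \<Longrightarrow> 1 \<le> \<bar>c i - c j\<bar>"
proof -
  obtain f :: "'n \<Rightarrow> nat" where f: "inj f"
    using finite_imp_inj_to_nat_seg[of "UNIV :: 'n set"] by auto
  have "1 \<le> \<bar>real (f i) - real (f j)\<bar>" if "i \<noteq> j" for i j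
    using injD[OF f, of i j] that by linarith
  then show ?thesis using that[of "\<lambda>i. real (f i)"] by blast
qed

lemma spread_bounded:
  fixes c :: "'n::finite \<Rightarrow> real"
  obtains K where "K > 0" "\<And>v :: 'e::euclidean_space. v \<in> ball 0 1 \<Longrightarrow> norm (spread c v :: ('e, 'n) vec) \<le> K"
proof -
  obtain K where K: "K > 0" "\<And>v :: 'e. norm (spread c v :: ('e, 'n) vec) \<le> norm v * K"
    using bounded_linear.pos_bounded[OF bounded_linear_spread] by blast
  have "norm (spread c v :: ('e, 'n) vec) \<le> K" if "v \<in> ball 0 1" for v :: 'e
  proof -
    have "norm v * K \<le> 1 * K" using that K(1) by (intro mult_right_mono) auto
    then show ?thesis using K(2)[of v] by simp
  qed
  then show ?thesis using that K(1) by blast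
qed

section \<open>The two distances as costs\<close>

definition jm_curve :: "('n::{finite,linorder} \<Rightarrow> real) \<Rightarrow> real \<Rightarrow> real \<Rightarrow> (real \<Rightarrow> ('e::euclidean_space, 'n) vec) \<Rightarrow> bool"
  where "jm_curve m a b \<gamma> \<longleftrightarrow> \<gamma> piecewise_C1_differentiable_on {a..b} \<and> \<gamma> ` {a..b} \<subseteq> collision_free m"

definition jm_speed :: "('n::{finite,linorder} \<Rightarrow> real) \<Rightarrow> real \<Rightarrow> ('e::euclidean_space, 'n) vec \<Rightarrow> ('e, 'n) vec \<Rightarrow> ennreal"
  where "jm_speed m h x v = ennreal (sqrt (jm_metric m h x v v))"

definition lagrangian :: "('n::{finite,linorder} \<Rightarrow> real) \<Rightarrow> real \<Rightarrow> ('e::euclidean_space, 'n) vec \<Rightarrow> ('e, 'n) vec \<Rightarrow> ennreal"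
  where "lagrangian m h x v = ennreal (1/2 * (mass_norm m v)\<^sup>2) + newton_potential m x + ennreal h"

definition free_lagrangian :: "('n::{finite,linorder} \<Rightarrow> real) \<Rightarrow> real \<Rightarrow> ('e::euclidean_space, 'n) vec \<Rightarrow> ('e, 'n) vec \<Rightarrow> ennreal"
  where "free_lagrangian m h x v = ennreal (1/2 * (mass_norm m v)\<^sup>2) + ennreal h"

lemma jm_length_eq: "jm_length m h = curve_action (jm_speed m h)"
  by (intro ext) (simp add: jm_length_def curve_action_def jm_speed_def)

lemma jm_dist_eq: "jm_dist m h = curve_cost (jm_curve m) (jm_speed m h)"
  by (intro ext) (simp add: jm_dist_def curve_cost_def jm_length_eq jm_curve_def conj_ac)

lemma lagrangian_action_eq: "lagrangian_action m h = curve_action (lagrangian m h)"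
  by (intro ext) (simp add: lagrangian_action_def curve_action_def lagrangian_def)

lemma action_potential_eq: "action_potential m h = curve_cost absolutely_continuous_curve (lagrangian m h)"
  by (intro ext) (simp add: action_potential_def curve_cost_def lagrangian_action_eq)

lemma mass_inner_measurable:
  "(\<lambda>v :: ('e::euclidean_space, 'n::finite) vec. mass_inner m v v) \<in> borel_measurable borel"
  unfolding mass_inner_def by (intro borel_measurable_continuous_onI continuous_intros)

lemma jm_speed_measurable: "(\<lambda>(x :: ('e::euclidean_space, 'n::{finite,linorder}) vec, v). jm_speed m h x v) \<in> borel_measurable borel"
proof -
  note [measurable] = mass_inner_measurable[where 'e = 'e and 'n = 'n]
  have "(\<lambda>(x :: ('e, 'n) vec, v). jm_speed m h x v) \<in> borel_measurable (borel \<Otimes>\<^sub>M borel)"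
    unfolding jm_speed_def jm_metric_def by measurable
  then show ?thesis by (simp add: borel_prod)
qed

lemma lagrangian_measurable: "(\<lambda>(x :: ('e::euclidean_space, 'n::{finite,linorder}) vec, v). lagrangian m h x v) \<in> borel_measurable borel"
proof -
  note [measurable] = mass_inner_measurable[where 'e = 'e and 'n = 'n]
  have "(\<lambda>(x :: ('e, 'n) vec, v). lagrangian m h x v) \<in> borel_measurable (borel \<Otimes>\<^sub>M borel)"
    unfolding lagrangian_def mass_norm_def by measurable
  then show ?thesis by (simp add: borel_prod)
qed

text \<open>
  A shift of the curve changes the second summand only.
\<close>

lemma lagrangian_action_split:
  fixes m :: "'n::{finite,linorder} \<Rightarrow> real" and \<gamma> :: "real \<Rightarrow> ('e::euclidean_space, 'n) vec"
  assumes \<gamma>: "ftc_curve a b \<gamma>" and ab: "a \<le> b"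
  shows "lagrangian_action m h a b \<gamma> =
    curve_action (free_lagrangian m h) a b \<gamma> + (\<integral>\<^sup>+ t\<in>{a..b}. newton_potential m (\<gamma> t) \<partial>lborel)"
proof -
  have "(\<lambda>(x, v). free_lagrangian m h (x :: ('e, 'n) vec) v) \<in> borel_measurable (borel \<Otimes>\<^sub>M borel)"
  proof -
    note [measurable] = mass_inner_measurable[where 'e = 'e and 'n = 'n]
    show ?thesis unfolding free_lagrangian_def mass_norm_def by measurable
  qed
  then have 1: "(\<lambda>(x, v). free_lagrangian m h (x :: ('e, 'n) vec) v) \<in> borel_measurable borel" by (simp add: borel_prod)
  have "(\<lambda>(x :: ('e, 'n) vec, v :: ('e, 'n) vec). newton_potential m x) \<in> borel_measurable (borel \<Otimes>\<^sub>M borel)"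
    by measurable
  then have 2: "(\<lambda>(x :: ('e, 'n) vec, v :: ('e, 'n) vec). newton_potential m x) \<in> borel_measurable borel" by (simp add: borel_prod)
  have "lagrangian_action m h a b \<gamma> = (\<integral>\<^sup>+ t. free_lagrangian m h (\<gamma> t) (velocity a b \<gamma> t) * indicator {a..b} t
      + newton_potential m (\<gamma> t) * indicator {a..b} t \<partial>lebesgue)"
    unfolding lagrangian_action_def by (intro nn_integral_cong) (auto simp: free_lagrangian_def indicator_def ac_simps)
  also have "\<dots> = curve_action (free_lagrangian m h) a b \<gamma> + (\<integral>\<^sup>+ t\<in>{a..b}. newton_potential m (\<gamma> t) \<partial>lebesgue)"
    unfolding curve_action_def
    by (intro nn_integral_add curve_action_integrand_measurable[OF \<gamma> ab 1] curve_action_integrand_measurable[OF \<gamma> ab 2])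
  finally show ?thesis by (simp add: nn_integral_completion)
qed

lemma jm_dist_triangle: "jm_dist m h x z \<le> jm_dist m h x y + jm_dist m h y z"
  unfolding jm_dist_eq
proof (rule curve_cost_triangle[OF _ _ _ jm_speed_measurable])
  show "ftc_curve a b \<gamma>" if "jm_curve m a b \<gamma>" for a b \<gamma>
    using that piecewise_C1_ftc by (auto simp: jm_curve_def)
  show "jm_curve m (a - s) (b - s) (\<lambda>t. \<gamma> (s + 1 * t))" if "jm_curve m a b \<gamma>" for a b s \<gamma>
  proof -
    have "(\<lambda>x. 1 * x + s) ` {a - s..b - s} = {a..b}" by (auto intro!: image_eqI[of _ _ "_ - s"])
    then have "(\<gamma> \<circ> (\<lambda>x. 1 *\<^sub>R x + s)) piecewise_C1_differentiable_on {a - s..b - s}"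
      using that by (intro piecewise_C1_differentiable_affine) (simp add: jm_curve_def)
    then show ?thesis using that by (auto simp: jm_curve_def o_def add.commute)
  qed
  show "jm_curve m a b (\<lambda>t. if t \<le> c then \<gamma>1 t else \<gamma>2 t)"
    if "jm_curve m a c \<gamma>1" "jm_curve m c b \<gamma>2" "a < c" "c < b" "\<gamma>1 c = \<gamma>2 c" for a b c \<gamma>1 \<gamma>2
    using that piecewise_C1_differentiable_cases[of \<gamma>1 a c \<gamma>2 b] by (auto simp: jm_curve_def)
qed

lemma action_potential_triangle:
  fixes x y z :: "('e::euclidean_space, 'n::{finite,linorder}) vec"
  shows "action_potential m h x z \<le> action_potential m h x y + action_potential m h y z"
  unfolding action_potential_eq
proof (rule curve_cost_triangle[OF absolutely_continuous_curve_ftc _ _ lagrangian_measurable])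
  show "absolutely_continuous_curve (a - s) (b - s) (\<lambda>t. \<gamma> (s + 1 * t))"
    if "absolutely_continuous_curve a b \<gamma>" for a b s and \<gamma> :: "real \<Rightarrow> ('e, 'n) vec"
    by (rule absolutely_continuous_curve_compose_monotone[OF that]) auto
qed (auto intro: absolutely_continuous_curve_join)

lemma action_potential_commute:
  fixes x y :: "('e::euclidean_space, 'n::{finite,linorder}) vec"
  shows "action_potential m h x y = action_potential m h y x"
proof -
  have "action_potential m h y x \<le> action_potential m h x y" for x y :: "('e, 'n) vec"
    unfolding action_potential_eq
  proof (rule curve_cost_commute_le[OF absolutely_continuous_curve_ftc _ lagrangian_measurable])
    show "absolutely_continuous_curve (- b) (- a) (\<lambda>t. \<gamma> (0 + (- 1) * t))"
      if "absolutely_continuous_curve a b \<gamma>" for a b and \<gamma> :: "real \<Rightarrow> ('e, 'n) vec"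
      by (rule absolutely_continuous_curve_compose_monotone[OF that]) auto
  qed (auto simp: lagrangian_def mass_norm_def mass_inner_def)
  then show ?thesis by (intro antisym) auto
qed

section \<open>Comparison with the Jacobi-Maupertuis length\<close>

text \<open>
  The factor by which the Jacobi-Maupertuis metric rescales mass lengths, \<open>\<rho>\<close> in the introduction.
\<close>

definition jm_factor :: "('n::{finite,linorder} \<Rightarrow> real) \<Rightarrow> real \<Rightarrow> ('e::euclidean_space, 'n) vec \<Rightarrow> real"
  where "jm_factor m h x = sqrt (2 * (h + real_potential m x))"

lemma jm_speed_eq:
  assumes m: "\<And>i. m i > 0" and h: "h \<ge> 0" and x: "x \<in> collision_free m"
  shows "jm_speed m h x v = ennreal (jm_factor m h x * norm (mass_scale m v))"
  by (simp add: jm_speed_def jm_factor_def jm_metric_eq[of m, OF m h x])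

lemma real_potential_pos:
  fixes m :: "'n::{finite,linorder} \<Rightarrow> real" and x :: "('e::euclidean_space, 'n) vec"
  assumes m: "\<And>i. m i > 0" and n: "CARD('n) \<ge> 2" and x: "x \<in> collision_free m"
  shows "0 < real_potential m x"
proof -
  obtain c where c: "c > 0"
    "\<And>(x :: ('e, 'n) vec) R. norm x \<le> R \<Longrightarrow> 0 < R \<Longrightarrow> ennreal (c / R) \<le> newton_potential m x"
    using newton_potential_lower_bound[of m, OF m n] by blast
  have pos: "0 < norm x + 1" using norm_ge_zero[of x] by linarith
  have "ennreal (c / (norm x + 1)) \<le> ennreal (real_potential m x)"
    using c(2)[of x "norm x + 1"] pos by (simp add: newton_potential_eq_real[of m, OF m x])
  moreover have "0 < c / (norm x + 1)" using c(1) pos by simp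
  ultimately show ?thesis using real_potential_nonneg[of m x, OF m] by (simp add: ennreal_le_iff)
qed

lemma jm_factor_nonneg:
  fixes m :: "'n::{finite,linorder} \<Rightarrow> real"
  assumes m: "\<And>i. m i > 0" and h: "h \<ge> 0"
  shows "0 \<le> jm_factor m h x"
  unfolding jm_factor_def using real_potential_nonneg[of m x, OF m] h by simp

lemma jm_factor_pos:
  fixes m :: "'n::{finite,linorder} \<Rightarrow> real" and x :: "('e::euclidean_space, 'n) vec"
  assumes m: "\<And>i. m i > 0" and n: "CARD('n) \<ge> 2" and h: "h \<ge> 0" and x: "x \<in> collision_free m"
  shows "0 < jm_factor m h x"
  using real_potential_pos[of m x, OF m n x] h by (simp add: jm_factor_def)

lemma jm_factor_nearby:
  fixes m :: "'n::{finite,linorder} \<Rightarrow> real" and x :: "('e::euclidean_space, 'n) vec"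
  assumes m: "\<And>i. m i > 0" and x: "x \<in> collision_free m" and e: "e > 0"
  obtains r where "r > 0"
    "\<And>z. z \<in> ball x r \<Longrightarrow> z \<in> collision_free m \<and> \<bar>jm_factor m h z - jm_factor m h x\<bar> < e"
proof -
  let ?\<Omega> = "collision_free m :: ('e, 'n) vec set"
  have op: "open ?\<Omega>" by (rule open_collision_free[of m, OF m])
  have "continuous_on ?\<Omega> (jm_factor m h)"
    unfolding jm_factor_def by (intro continuous_intros continuous_on_real_potential m)
  then have "isCont (jm_factor m h) x" using op x continuous_on_eq_continuous_at by blast
  then obtain r1 where r1: "r1 > 0" "\<And>z. dist z x < r1 \<Longrightarrow> dist (jm_factor m h z) (jm_factor m h x) < e"
    unfolding continuous_at_eps_delta using e by metis
  obtain r2 where r2: "r2 > 0" "ball x r2 \<subseteq> ?\<Omega>" using op x openE by blast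
  have "z \<in> ?\<Omega> \<and> \<bar>jm_factor m h z - jm_factor m h x\<bar> < e" if "z \<in> ball x (min r1 r2)" for z
    using that r1(2)[of z] r2 by (auto simp: dist_real_def dist_commute)
  then show ?thesis using that[of "min r1 r2"] r1(1) r2(1) by simp
qed

lemma nn_integral_Icc_split:
  fixes f :: "real \<Rightarrow> ennreal"
  assumes f: "f \<in> borel_measurable lebesgue" and "a \<le> b" "b \<le> c"
  shows "(\<integral>\<^sup>+ t\<in>{a..c}. f t \<partial>lebesgue) = (\<integral>\<^sup>+ t\<in>{a..b}. f t \<partial>lebesgue) + (\<integral>\<^sup>+ t\<in>{b..c}. f t \<partial>lebesgue)"
proof -
  have "negligible {b}" by simp
  then have "AE t in lebesgue. t \<notin> {b}" by (intro AE_not_in) (simp add: negligible_iff_null_sets)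
  then have "AE t in lebesgue. f t * indicator {a..c} t = f t * indicator {a..b} t + f t * indicator {b..c} t"
    by eventually_elim (use assms in \<open>auto simp: indicator_def\<close>)
  then have "(\<integral>\<^sup>+ t\<in>{a..c}. f t \<partial>lebesgue) = (\<integral>\<^sup>+ t. f t * indicator {a..b} t + f t * indicator {b..c} t \<partial>lebesgue)"
    by (rule nn_integral_cong_AE)
  also have "\<dots> = (\<integral>\<^sup>+ t\<in>{a..b}. f t \<partial>lebesgue) + (\<integral>\<^sup>+ t\<in>{b..c}. f t \<partial>lebesgue)"
    using f by (intro nn_integral_add) (auto intro!: borel_measurable_times_ennreal borel_measurable_indicator)
  finally show ?thesis .
qed

text \<open>
  The inequality up to a factor \<open>1 + e\<close> passes from two adjacent intervals of time to their union, so by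
  the Bolzano principle it need only be shown for short intervals around each time. There the
  curve stays in a ball in which \<open>\<rho>\<close> is nearly constant, and the segment between two of its points is
  no longer than the curve.
\<close>

lemma cost_le_jm_length:
  fixes m :: "'n::{finite,linorder} \<Rightarrow> real" and \<gamma> :: "real \<Rightarrow> ('e::euclidean_space, 'n) vec"
    and D :: "('e, 'n) vec \<Rightarrow> ('e, 'n) vec \<Rightarrow> ennreal"
  assumes m: "\<And>i. m i > 0" and n: "CARD('n) \<ge> 2" and h: "h \<ge> 0"
    and triangle: "\<And>x y z. D x z \<le> D x y + D y z"
    and segment: "\<And>x y R. \<lbrakk>closed_segment x y \<subseteq> collision_free m; \<And>z. z \<in> closed_segment x y \<Longrightarrow> jm_factor m h z \<le> R\<rbrakk>
      \<Longrightarrow> D x y \<le> ennreal (R * norm (mass_scale m (y - x)))"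
    and ab: "a \<le> b" and \<gamma>: "ftc_curve a b \<gamma>" and free: "\<gamma> ` {a..b} \<subseteq> collision_free m"
  shows "D (\<gamma> a) (\<gamma> b) \<le> jm_length m h a b \<gamma>"
proof -
  define W where "W t = norm (mass_scale m (velocity a b \<gamma> t)) * indicator {a..b} t" for t
  define G where "G t = ennreal (jm_factor m h (\<gamma> t) * W t) * indicator {a..b} t" for t
  have G_eq: "G t = jm_speed m h (\<gamma> t) (velocity a b \<gamma> t) * indicator {a..b} t" for t
    using free by (auto simp: G_def W_def indicator_def jm_speed_eq[of m, OF m h] image_subset_iff)
  have G_meas: "G \<in> borel_measurable lebesgue"
    unfolding G_eq[abs_def] by (rule curve_action_integrand_measurable[OF \<gamma> ab jm_speed_measurable])
  have W_meas: "W \<in> borel_measurable lebesgue"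
  proof -
    have "(\<lambda>t. norm (mass_scale m (indicator {a..b} t *\<^sub>R velocity a b \<gamma> t))) \<in> borel_measurable lebesgue"
      by (rule measurable_compose[OF ftc_curve_velocity_measurable[OF \<gamma> ab]])
        (intro borel_measurable_continuous_onI continuous_intros bounded_linear.continuous_on[OF bounded_linear_mass_scale])
    also have "(\<lambda>t. norm (mass_scale m (indicator {a..b} t *\<^sub>R velocity a b \<gamma> t))) = W"
      by (auto simp: W_def indicator_def linear_0[OF linear_mass_scale])
    finally show ?thesis .
  qed
  have key: "D (\<gamma> a) (\<gamma> b) \<le> ennreal (1 + e) * (\<integral>\<^sup>+ t\<in>{a..b}. G t \<partial>lebesgue)" if e: "e > 0" for e
  proof -
    define P where "P s t \<longleftrightarrow> (a \<le> s \<longrightarrow> s \<le> t \<longrightarrow> t \<le> b \<longrightarrow>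
        D (\<gamma> s) (\<gamma> t) \<le> ennreal (1 + e) * (\<integral>\<^sup>+ u\<in>{s..t}. G u \<partial>lebesgue))" for s t
    have "P a b"
    proof (rule Bolzano[OF ab])
      fix r s t assume P: "P r s" "P s t" and le: "r \<le> s" "s \<le> t"
      show "P r t"
        unfolding P_def
      proof (intro impI)
        assume *: "a \<le> r" "r \<le> t" "t \<le> b"
        have "D (\<gamma> r) (\<gamma> t) \<le> D (\<gamma> r) (\<gamma> s) + D (\<gamma> s) (\<gamma> t)" by (rule triangle)
        also have "\<dots> \<le> ennreal (1 + e) * (\<integral>\<^sup>+ u\<in>{r..s}. G u \<partial>lebesgue) + ennreal (1 + e) * (\<integral>\<^sup>+ u\<in>{s..t}. G u \<partial>lebesgue)"
          using P le * unfolding P_def by (intro add_mono) auto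
        also have "\<dots> = ennreal (1 + e) * (\<integral>\<^sup>+ u\<in>{r..t}. G u \<partial>lebesgue)"
          using nn_integral_Icc_split[OF G_meas le] by (simp add: distrib_left)
        finally show "D (\<gamma> r) (\<gamma> t) \<le> ennreal (1 + e) * (\<integral>\<^sup>+ u\<in>{r..t}. G u \<partial>lebesgue)" .
      qed
    next
      fix x assume x: "a \<le> x" "x \<le> b"
      let ?\<Omega> = "collision_free m :: ('e, 'n) vec set"
      let ?\<rho> = "jm_factor m h"
      have \<gamma>x: "\<gamma> x \<in> ?\<Omega>" using free x by auto
      define \<rho>0 where "\<rho>0 = ?\<rho> (\<gamma> x)"
      have \<rho>0: "\<rho>0 > 0" unfolding \<rho>0_def by (rule jm_factor_pos[of m, OF m n h \<gamma>x])
      \<comment> \<open>With this \<open>\<eta>\<close> the ratio of the bounds \<open>(1 + \<eta>) * \<rho>0\<close> and \<open>(1 - \<eta>) * \<rho>0\<close> is \<open>1 + e\<close>.\<close>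
      define \<eta> where "\<eta> = e / (e + 2)"
      have \<eta>: "0 < \<eta>" "1 + \<eta> = (1 + e) * (1 - \<eta>)" using e by (auto simp: \<eta>_def field_simps)
      obtain r where r: "r > 0"
        and near: "\<And>z. z \<in> ball (\<gamma> x) r \<Longrightarrow> z \<in> ?\<Omega> \<and> \<bar>?\<rho> z - \<rho>0\<bar> < \<eta> * \<rho>0"
        using jm_factor_nearby[of m, OF m \<gamma>x mult_pos_pos[OF \<eta>(1) \<rho>0]] unfolding \<rho>0_def by blast
      have ball: "z \<in> ?\<Omega> \<and> ?\<rho> z \<le> (1 + \<eta>) * \<rho>0 \<and> (1 - \<eta>) * \<rho>0 \<le> ?\<rho> z" if "z \<in> ball (\<gamma> x) r" for z
        using near[OF that] by (auto simp: algebra_simps)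
      obtain d where d: "d > 0" "\<And>s. s \<in> {a..b} \<Longrightarrow> dist s x < d \<Longrightarrow> dist (\<gamma> s) (\<gamma> x) < r"
        using \<gamma> x r unfolding ftc_curve_def continuous_on_iff by (metis atLeastAtMost_iff)
      have "P s t" if st: "s \<le> x" "x \<le> t" "t - s < d" for s t
        unfolding P_def
      proof (intro impI)
        assume *: "a \<le> s" "s \<le> t" "t \<le> b"
        have in_ball: "\<gamma> u \<in> ball (\<gamma> x) r" if "u \<in> {s..t}" for u
        proof -
          have "dist (\<gamma> u) (\<gamma> x) < r" using that st * by (intro d(2)) (auto simp: dist_real_def)
          then show ?thesis by (simp add: dist_commute)
        qed
        have seg: "closed_segment (\<gamma> s) (\<gamma> t) \<subseteq> ball (\<gamma> x) r"
          using in_ball[of s] in_ball[of t] * by (intro closed_segment_subset) auto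
        have "D (\<gamma> s) (\<gamma> t) \<le> ennreal ((1 + \<eta>) * \<rho>0 * norm (mass_scale m (\<gamma> t - \<gamma> s)))"
          using seg ball by (intro segment) blast+
        also have "\<dots> = ennreal ((1 + \<eta>) * \<rho>0) * ennreal (norm (mass_scale m (\<gamma> t - \<gamma> s)))"
          using \<eta>(1) \<rho>0 by (intro ennreal_mult) auto
        also have "\<dots> \<le> ennreal ((1 + \<eta>) * \<rho>0) * (\<integral>\<^sup>+ u\<in>{s..t}. ennreal (norm (mass_scale m (velocity a b \<gamma> u))) \<partial>lebesgue)"
          by (intro mult_left_mono ftc_curve_norm_increment_le[OF \<gamma> * bounded_linear_mass_scale]) auto
        also have "(\<integral>\<^sup>+ u\<in>{s..t}. ennreal (norm (mass_scale m (velocity a b \<gamma> u))) \<partial>lebesgue) = (\<integral>\<^sup>+ u\<in>{s..t}. ennreal (W u) \<partial>lebesgue)"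
          using * by (intro nn_integral_cong) (auto simp: W_def indicator_def)
        also have "ennreal ((1 + \<eta>) * \<rho>0) * \<dots> = (\<integral>\<^sup>+ u. ennreal ((1 + \<eta>) * \<rho>0) * (ennreal (W u) * indicator {s..t} u) \<partial>lebesgue)"
          using W_meas by (intro nn_integral_cmult[symmetric] borel_measurable_times_ennreal borel_measurable_indicator) auto
        also have "\<dots> \<le> (\<integral>\<^sup>+ u. ennreal (1 + e) * (G u * indicator {s..t} u) \<partial>lebesgue)"
        proof (intro nn_integral_mono)
          fix u :: real
          show "ennreal ((1 + \<eta>) * \<rho>0) * (ennreal (W u) * indicator {s..t} u) \<le> ennreal (1 + e) * (G u * indicator {s..t} u)"
          proof (cases "u \<in> {s..t}")
            case True
            then have u: "u \<in> {a..b}" using * by auto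
            have W0: "0 \<le> W u" by (simp add: W_def)
            have "(1 + \<eta>) * \<rho>0 \<le> (1 + e) * ?\<rho> (\<gamma> u)"
              unfolding \<eta>(2) using ball[OF in_ball[OF True]] e by (simp add: mult.assoc mult_left_mono)
            then have "(1 + \<eta>) * \<rho>0 * W u \<le> (1 + e) * (?\<rho> (\<gamma> u) * W u)"
              using W0 by (simp add: mult.assoc[symmetric] mult_right_mono)
            then have "ennreal ((1 + \<eta>) * \<rho>0 * W u) \<le> ennreal ((1 + e) * (?\<rho> (\<gamma> u) * W u))" by (rule ennreal_leI)
            then have "ennreal ((1 + \<eta>) * \<rho>0) * ennreal (W u) \<le> ennreal (1 + e) * ennreal (?\<rho> (\<gamma> u) * W u)"
            proof -
              have "0 \<le> (1 + \<eta>) * \<rho>0" "0 \<le> 1 + e" using e \<eta>(1) \<rho>0 by auto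
              moreover have "0 \<le> ?\<rho> (\<gamma> u) * W u"
                by (intro mult_nonneg_nonneg jm_factor_nonneg m h W0)
              ultimately show ?thesis
                using \<open>ennreal ((1 + \<eta>) * \<rho>0 * W u) \<le> _\<close> W0 by (simp only: ennreal_mult)
            qed
            then show ?thesis using True u by (simp add: G_def)
          qed simp
        qed
        also have "\<dots> = ennreal (1 + e) * (\<integral>\<^sup>+ u\<in>{s..t}. G u \<partial>lebesgue)"
          using G_meas by (intro nn_integral_cmult borel_measurable_times_ennreal borel_measurable_indicator) auto
        finally show "D (\<gamma> s) (\<gamma> t) \<le> ennreal (1 + e) * (\<integral>\<^sup>+ u\<in>{s..t}. G u \<partial>lebesgue)" .
      qed
      then show "\<exists>d>0. \<forall>s t. s \<le> x \<and> x \<le> t \<and> t - s < d \<longrightarrow> P s t" using d(1) by blast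
    qed
    then show ?thesis using ab by (simp add: P_def)
  qed
  have len: "jm_length m h a b \<gamma> = (\<integral>\<^sup>+ t\<in>{a..b}. G t \<partial>lebesgue)"
    unfolding jm_length_eq curve_action_def by (intro nn_integral_cong) (auto simp: G_eq indicator_def)
  show ?thesis
  proof (cases "jm_length m h a b \<gamma> = \<infinity>")
    case False
    then obtain l where l: "jm_length m h a b \<gamma> = ennreal l" "0 \<le> l" by (cases "jm_length m h a b \<gamma>") auto
    show ?thesis
    proof (rule ennreal_le_epsilon)
      fix e :: real assume e: "0 < e"
      have "D (\<gamma> a) (\<gamma> b) \<le> ennreal (1 + e / (l + 1)) * ennreal l"
        using key[of "e / (l + 1)"] e l by (simp add: len[symmetric])
      also have "\<dots> = ennreal (l + e * (l / (l + 1)))"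
        using l e by (simp add: ennreal_mult[symmetric] algebra_simps)
      also have "\<dots> \<le> ennreal (l + e)"
        using l e by (intro ennreal_leI add_left_mono mult_left_le) auto
      also have "\<dots> = jm_length m h a b \<gamma> + ennreal e" using l e by simp
      finally show "D (\<gamma> a) (\<gamma> b) \<le> jm_length m h a b \<gamma> + ennreal e" .
    qed
  qed simp
qed

section \<open>Costs of segments\<close>

lemma uniform_segment_velocity:
  fixes x y :: "'a::real_normed_vector"
  assumes "T > 0" "t \<in> {0..T}"
  shows "velocity 0 T (\<lambda>t. x + (t / T) *\<^sub>R (y - x)) t = (1 / T) *\<^sub>R (y - x)"
  using assms by (intro velocity_eq_within) (auto intro!: derivative_eq_intros simp: divide_inverse)

lemma uniform_segment_range:
  assumes "T > 0" "t \<in> {0..T}"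
  shows "x + (t / T) *\<^sub>R (y - x) \<in> closed_segment x y"
  using assms unfolding closed_segment_def
  by (intro CollectI exI[of _ "t / T"]) (auto simp: algebra_simps)

lemma jm_dist_segment_le:
  fixes m :: "'n::{finite,linorder} \<Rightarrow> real" and x y :: "('e::euclidean_space, 'n) vec"
  assumes m: "\<And>i. m i > 0" and h: "h \<ge> 0"
    and free: "closed_segment x y \<subseteq> collision_free m"
    and R: "\<And>z. z \<in> closed_segment x y \<Longrightarrow> jm_factor m h z \<le> R"
  shows "jm_dist m h x y \<le> ennreal (R * norm (mass_scale m (y - x)))"
proof -
  let ?\<gamma> = "\<lambda>t. x + (t / 1) *\<^sub>R (y - x)"
  have "?\<gamma> C1_differentiable_on {0..1}"
    unfolding C1_differentiable_on_def
    by (intro exI[of _ "\<lambda>_. y - x"]) (auto intro!: derivative_eq_intros)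
  then have "jm_curve m 0 1 ?\<gamma>"
    using free uniform_segment_range[of 1 _ x y]
    by (auto simp: jm_curve_def intro: C1_differentiable_imp_piecewise)
  then have "jm_dist m h x y \<le> curve_action (jm_speed m h) 0 1 ?\<gamma>"
    unfolding jm_dist_eq by (intro curve_cost_le) auto
  also have "\<dots> \<le> ennreal (R * norm (mass_scale m (y - x))) * ennreal (1 - 0)"
  proof (rule curve_action_le_const)
    fix t :: real assume t: "t \<in> {0..1}"
    have "?\<gamma> t \<in> closed_segment x y" using uniform_segment_range[of 1 t x y] t by simp
    then show "jm_speed m h (?\<gamma> t) (velocity 0 1 ?\<gamma> t) \<le> ennreal (R * norm (mass_scale m (y - x)))"
      using R[of "?\<gamma> t"] free t
      by (subst jm_speed_eq[of m, OF m h], blast, subst uniform_segment_velocity)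
        (auto intro!: ennreal_leI mult_right_mono)
  qed simp
  finally show ?thesis by simp
qed

lemma lagrangian_eq:
  assumes m: "\<And>i. m i > 0" and h: "h \<ge> 0" and x: "x \<in> collision_free m"
  shows "lagrangian m h x v = ennreal ((norm (mass_scale m v))\<^sup>2 / 2 + (jm_factor m h x)\<^sup>2 / 2)"
proof -
  have "(jm_factor m h x)\<^sup>2 = 2 * (h + real_potential m x)"
    using real_potential_nonneg[of m x, OF m] h by (simp add: jm_factor_def)
  then show ?thesis
    using real_potential_nonneg[of m x, OF m] h
    by (simp add: lagrangian_def newton_potential_eq_real[of m, OF m x] mass_norm_eq_norm_mass_scale[of m, OF m]
        ennreal_plus[symmetric] add_ac del: ennreal_plus)
qed

lemma jm_speed_le_lagrangian:
  assumes m: "\<And>i. m i > 0" and h: "h \<ge> 0" and x: "x \<in> collision_free m"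
  shows "jm_speed m h x v \<le> lagrangian m h x v"
proof -
  have "2 * (jm_factor m h x * norm (mass_scale m v)) \<le> (norm (mass_scale m v))\<^sup>2 + (jm_factor m h x)\<^sup>2"
    using sum_squares_bound[of "jm_factor m h x" "norm (mass_scale m v)"] by (simp add: algebra_simps)
  then show ?thesis
    unfolding jm_speed_eq[of m, OF m h x] lagrangian_eq[of m, OF m h x] by (intro ennreal_leI) simp
qed

lemma action_potential_segment_le_time:
  fixes m :: "'n::{finite,linorder} \<Rightarrow> real" and x y :: "('e::euclidean_space, 'n) vec"
  assumes m: "\<And>i. m i > 0" and h: "h \<ge> 0" and T: "T > 0"
    and free: "closed_segment x y \<subseteq> collision_free m"
    and R: "\<And>z. z \<in> closed_segment x y \<Longrightarrow> jm_factor m h z \<le> R"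
  shows "action_potential m h x y \<le> ennreal ((norm (mass_scale m (y - x)))\<^sup>2 / (2 * T) + R\<^sup>2 * T / 2)"
proof -
  let ?\<gamma> = "\<lambda>t. x + (t / T) *\<^sub>R (y - x)"
  let ?l = "norm (mass_scale m (y - x))"
  have "absolutely_continuous_curve 0 T ?\<gamma>" by (rule absolutely_continuous_curve_affine)
  then have "action_potential m h x y \<le> curve_action (lagrangian m h) 0 T ?\<gamma>"
    unfolding action_potential_eq using T by (intro curve_cost_le) auto
  also have "\<dots> \<le> ennreal ((?l / T)\<^sup>2 / 2 + R\<^sup>2 / 2) * ennreal (T - 0)"
  proof (rule curve_action_le_const)
    fix t :: real assume t: "t \<in> {0..T}"
    have seg: "?\<gamma> t \<in> closed_segment x y" by (rule uniform_segment_range[OF T t])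
    have 0: "0 \<le> jm_factor m h (?\<gamma> t)"
      by (rule jm_factor_nonneg[of m, OF m h])
    have "norm (mass_scale m (velocity 0 T ?\<gamma> t)) = ?l / T"
      using T by (simp add: uniform_segment_velocity[OF T t] linear_scale[OF linear_mass_scale])
    moreover have "(jm_factor m h (?\<gamma> t))\<^sup>2 \<le> R\<^sup>2" using R[OF seg] 0 by (intro power_mono)
    ultimately show "lagrangian m h (?\<gamma> t) (velocity 0 T ?\<gamma> t) \<le> ennreal ((?l / T)\<^sup>2 / 2 + R\<^sup>2 / 2)"
      using seg free by (subst lagrangian_eq[of m, OF m h]) (auto intro!: ennreal_leI)
  qed (use T in simp)
  also have "\<dots> = ennreal (?l\<^sup>2 / (2 * T) + R\<^sup>2 * T / 2)"
  proof -
    have "((?l / T)\<^sup>2 / 2 + R\<^sup>2 / 2) * (T - 0) = ?l\<^sup>2 / (2 * T) + R\<^sup>2 * T / 2"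
      using T by (simp add: field_simps power2_eq_square)
    moreover have "0 \<le> (?l / T)\<^sup>2 / 2 + R\<^sup>2 / 2" "0 \<le> T - 0" using T by auto
    ultimately show ?thesis by (simp only: ennreal_mult[symmetric])
  qed
  finally show ?thesis .
qed

text \<open>
  The segment is run at the constant speed \<open>R\<close>, which makes kinetic and potential part of the bound
  equal. A segment that is a point has no such parametrization; there, short stays at the point are used.
\<close>

lemma action_potential_segment_le:
  fixes m :: "'n::{finite,linorder} \<Rightarrow> real" and x y :: "('e::euclidean_space, 'n) vec"
  assumes m: "\<And>i. m i > 0" and n: "CARD('n) \<ge> 2" and h: "h \<ge> 0"
    and free: "closed_segment x y \<subseteq> collision_free m"
    and R: "\<And>z. z \<in> closed_segment x y \<Longrightarrow> jm_factor m h z \<le> R"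
  shows "action_potential m h x y \<le> ennreal (R * norm (mass_scale m (y - x)))"
proof -
  let ?l = "norm (mass_scale m (y - x))"
  have x: "x \<in> closed_segment x y" by simp
  have R0: "R > 0" using jm_factor_pos[of m, OF m n h] R[OF x] free x by fastforce
  show ?thesis
  proof (cases "?l = 0")
    case False
    then have T: "?l / R > 0" using R0 by simp
    have "?l\<^sup>2 / (2 * (?l / R)) + R\<^sup>2 * (?l / R) / 2 = R * ?l"
      using False R0 by (simp add: field_simps power2_eq_square)
    then show ?thesis using action_potential_segment_le_time[of m, OF m h T free R] by simp
  next
    case True
    show ?thesis
    proof (rule ennreal_le_epsilon)
      fix e :: real assume e: "0 < e"
      define T where "T = e / R\<^sup>2"
      have T: "T > 0" using e R0 by (simp add: T_def)
      have "action_potential m h x y \<le> ennreal (R\<^sup>2 * T / 2)"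
        using action_potential_segment_le_time[of m, OF m h T free R] True by simp
      also have "\<dots> \<le> ennreal e" using e R0 by (intro ennreal_leI) (simp add: T_def)
      finally show "action_potential m h x y \<le> ennreal (R * ?l) + ennreal e" using True by simp
    qed
  qed
qed

lemma action_potential_le_jm_dist:
  fixes m :: "'n::{finite,linorder} \<Rightarrow> real" and x y :: "('e::euclidean_space, 'n) vec"
  assumes m: "\<And>i. m i > 0" and n: "CARD('n) \<ge> 2" and h: "h \<ge> 0"
  shows "action_potential m h x y \<le> jm_dist m h x y"
  unfolding jm_dist_eq curve_cost_def
proof (rule Inf_greatest, clarify)
  fix a b \<gamma> assume ab: "a < b" and \<gamma>: "jm_curve m a b \<gamma>" and xy: "x = \<gamma> a" "y = \<gamma> b"
  have "action_potential m h (\<gamma> a) (\<gamma> b) \<le> jm_length m h a b \<gamma>"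
    using ab \<gamma> by (intro cost_le_jm_length m n h action_potential_triangle action_potential_segment_le piecewise_C1_ftc)
      (auto simp: jm_curve_def)
  then show "action_potential m h (\<gamma> a) (\<gamma> b) \<le> curve_action (jm_speed m h) a b \<gamma>"
    by (simp add: jm_length_eq)
qed

lemma jm_dist_le_lagrangian_action:
  fixes m :: "'n::{finite,linorder} \<Rightarrow> real" and \<gamma> :: "real \<Rightarrow> ('e::euclidean_space, 'n) vec"
  assumes m: "\<And>i. m i > 0" and n: "CARD('n) \<ge> 2" and h: "h \<ge> 0"
    and ab: "a \<le> b" and \<gamma>: "ftc_curve a b \<gamma>" and free: "\<gamma> ` {a..b} \<subseteq> collision_free m"
  shows "jm_dist m h (\<gamma> a) (\<gamma> b) \<le> lagrangian_action m h a b \<gamma>"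
proof -
  have "jm_dist m h (\<gamma> a) (\<gamma> b) \<le> jm_length m h a b \<gamma>"
    by (intro cost_le_jm_length m n h jm_dist_triangle jm_dist_segment_le ab \<gamma> free)
  also have "\<dots> \<le> lagrangian_action m h a b \<gamma>"
    unfolding jm_length_eq lagrangian_action_eq curve_action_def
    using free by (intro nn_integral_mono) (auto simp: indicator_def image_subset_iff intro!: jm_speed_le_lagrangian m h)
  finally show ?thesis .
qed

lemma jm_dist_small_nearby:
  fixes m :: "'n::{finite,linorder} \<Rightarrow> real" and x :: "('e::euclidean_space, 'n) vec"
  assumes m: "\<And>i. m i > 0" and h: "h \<ge> 0" and x: "x \<in> collision_free m" and e: "e > 0"
  obtains r where "r > 0" "\<And>y. norm (y - x) < r \<Longrightarrow> jm_dist m h x y \<le> ennreal e \<and> jm_dist m h y x \<le> ennreal e"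
proof -
  let ?\<Omega> = "collision_free m :: ('e, 'n) vec set"
  let ?\<rho> = "jm_factor m h"
  obtain r1 where r1: "r1 > 0" "\<And>z. z \<in> ball x r1 \<Longrightarrow> z \<in> ?\<Omega> \<and> \<bar>?\<rho> z - ?\<rho> x\<bar> < 1"
    using jm_factor_nearby[of m, OF m x zero_less_one] by blast
  obtain K where K: "K > 0" "\<And>v. norm (mass_scale m v :: ('e, 'n) vec) \<le> norm v * K"
    using bounded_linear.pos_bounded[OF bounded_linear_mass_scale] by blast
  have \<rho>0: "0 \<le> ?\<rho> x" using real_potential_nonneg[of m x, OF m] h by (simp add: jm_factor_def)
  define R where "R = ?\<rho> x + 1"
  have R: "R > 0" using \<rho>0 by (simp add: R_def)
  define r where "r = min r1 (e / (R * K))"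
  have r: "r > 0" using r1 e R K by (simp add: r_def)
  have ball: "z \<in> ?\<Omega> \<and> ?\<rho> z \<le> R" if "z \<in> ball x r" for z
    using r1(2)[of z] that by (auto simp: r_def R_def)
  have "jm_dist m h x y \<le> ennreal e \<and> jm_dist m h y x \<le> ennreal e" if y: "norm (y - x) < r" for y
  proof -
    have yb: "y \<in> ball x r" using y by (simp add: dist_norm norm_minus_commute)
    have seg: "closed_segment x y \<subseteq> ball x r" "closed_segment y x \<subseteq> ball x r"
      using yb r by (intro closed_segment_subset; simp)+
    have bound: "R * norm (mass_scale m v) \<le> e" if "norm v = norm (y - x)" for v :: "('e, 'n) vec"
    proof -
      have "R * norm (mass_scale m v) \<le> R * (norm v * K)" using K(2)[of v] R by simp
      also have "\<dots> \<le> R * (e / (R * K) * K)" using y that R K by (intro mult_left_mono mult_right_mono) (auto simp: r_def)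
      also have "\<dots> = e" using R K by simp
      finally show ?thesis .
    qed
    have "jm_dist m h x y \<le> ennreal (R * norm (mass_scale m (y - x)))"
      using seg ball by (intro jm_dist_segment_le m h) blast+
    moreover have "jm_dist m h y x \<le> ennreal (R * norm (mass_scale m (x - y)))"
      using seg ball by (intro jm_dist_segment_le m h) blast+
    ultimately show ?thesis
      using bound[of "y - x"] bound[of "x - y"] by (auto simp: norm_minus_commute intro: order_trans ennreal_leI)
  qed
  then show ?thesis using that r by blast
qed

section \<open>Averages of the potential over shifts\<close>

text \<open>
  Comparing \<open>1 / norm z\<close> with the sum of \<open>2 ^ (k + 1)\<close> over the dyadic balls of radius \<open>(1/2) ^ k\<close>
  that contain \<open>z\<close> reduces the integral to a geometric series. In dimension at least two the volume of the \<open>k\<close>-th ball is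
  at most \<open>(1/4) ^ k\<close> times that of the unit ball, and the series converges.
\<close>

lemma nn_integral_inverse_norm_ball:
  fixes w :: "'e::euclidean_space"
  assumes dim: "DIM('e) \<ge> 2"
  shows "(\<integral>\<^sup>+ v\<in>ball 0 1. 1 / ennreal (norm (w + v)) \<partial>lborel) \<le> 5 * emeasure lborel (ball (0::'e) 1)"
proof -
  let ?\<beta> = "emeasure lborel (ball (0::'e) 1)"
  let ?B = "\<lambda>k::nat. ball (- w) ((1/2) ^ k)"
  have ball: "emeasure lborel (?B k) \<le> ennreal ((1/4) ^ k) * ?\<beta>" for k
  proof -
    have "emeasure lborel (?B k) = ennreal (unit_ball_vol (real DIM('e)) * ((1/2) ^ k) ^ DIM('e))"
      by (rule emeasure_ball) simp
    also have "\<dots> \<le> ennreal ((1/4) ^ k * unit_ball_vol (real DIM('e)))"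
    proof (rule ennreal_leI)
      have "(((1/2) ^ k) ^ DIM('e) :: real) \<le> ((1/2) ^ k) ^ 2"
        using dim by (intro power_decreasing) (auto simp: power_le_one)
      also have "\<dots> = (1/4) ^ k" by (simp add: power_mult[symmetric] power_even_eq power2_eq_square power_mult_distrib[symmetric])
      finally show "unit_ball_vol (real DIM('e)) * ((1/2) ^ k) ^ DIM('e) \<le> (1/4) ^ k * unit_ball_vol (real DIM('e))"
        by (subst mult.commute) (auto intro!: mult_right_mono)
    qed
    also have "\<dots> = ennreal ((1/4) ^ k) * ?\<beta>"
      by (subst emeasure_ball) (auto simp: ennreal_mult)
    finally show ?thesis .
  qed
  have pt: "1 / ennreal (norm (w + v)) \<le> 1 + (\<Sum>k. ennreal (2 ^ (k + 1)) * indicator (?B k) v)" if v: "v \<noteq> - w" for v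
  proof (cases "norm (w + v) < 1")
    case False
    then have z: "1 \<le> norm (w + v)" by simp
    have "1 / ennreal (norm (w + v)) = ennreal (1 / norm (w + v))"
      using z by (subst ennreal_1[symmetric], subst divide_ennreal) auto
    also have "\<dots> \<le> ennreal 1" using z by (intro ennreal_leI) (auto simp: divide_le_eq_1)
    finally have "1 / ennreal (norm (w + v)) \<le> 1" by simp
    then show ?thesis by (rule order_trans) simp
  next
    case True
    have z: "0 < norm (w + v)" using v by (simp add: add_eq_0_iff)
    \<comment> \<open>\<open>k\<close> is the dyadic scale of \<open>w + v\<close>; the \<open>k\<close>-th term alone dominates the left-hand side.\<close>
    define k where "k = (LEAST k::nat. (1/2) ^ (k + 1) \<le> norm (w + v))"
    obtain k0 :: nat where "(1/2) ^ k0 < norm (w + v)" using real_arch_pow_inv[OF z, of "1/2"] by auto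
    moreover have "(1/2 :: real) ^ (k0 + 1) = (1/2) ^ k0 / 2" by simp
    ultimately have "(1/2) ^ (k0 + 1) \<le> norm (w + v)" using z by linarith
    then have k: "(1/2) ^ (k + 1) \<le> norm (w + v)" unfolding k_def by (rule LeastI)
    have k': "norm (w + v) < (1/2) ^ k"
    proof (cases k)
      case (Suc j)
      then have "j < k" by simp
      then have "\<not> (1/2) ^ (j + 1) \<le> norm (w + v)" unfolding k_def by (rule not_less_Least)
      then show ?thesis using Suc by simp
    qed (use True in simp)
    have "1 / ennreal (norm (w + v)) = ennreal (1 / norm (w + v))"
      using z by (subst ennreal_1[symmetric], subst divide_ennreal) auto
    also have "\<dots> \<le> ennreal (2 ^ (k + 1))"
    proof (rule ennreal_leI)
      have "1 / norm (w + v) \<le> 1 / (1/2) ^ (k + 1)" using k z by (intro divide_left_mono) auto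
      then show "1 / norm (w + v) \<le> 2 ^ (k + 1)" by (simp add: power_divide)
    qed
    also have "\<dots> = (\<Sum>j\<in>{k}. ennreal (2 ^ (j + 1)) * indicator (?B j) v)"
    proof -
      have "dist (- w) v = norm (w + v)"
        by (metis add.commute dist_norm norm_minus_commute diff_minus_eq_add)
      then show ?thesis using k' by simp
    qed
    also have "\<dots> \<le> (\<Sum>k. ennreal (2 ^ (k + 1)) * indicator (?B k) v)"
      by (rule sum_le_suminf) auto
    finally show ?thesis by (rule order_trans) simp
  qed
  have ind [measurable]: "(indicator (ball c r) :: 'e \<Rightarrow> ennreal) \<in> borel_measurable borel" for c r
    by (simp add: borel_measurable_indicator)
  have "AE v in lborel. v \<noteq> - w" by (rule AE_lborel_singleton)
  then have "(\<integral>\<^sup>+ v\<in>ball 0 1. 1 / ennreal (norm (w + v)) \<partial>lborel)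
     \<le> (\<integral>\<^sup>+ v. indicator (ball 0 1) v + (\<Sum>k. ennreal (2 ^ (k + 1)) * indicator (?B k) v) \<partial>lborel)"
  proof (intro nn_integral_mono_AE, eventually_elim)
    case (elim v)
    show ?case
    proof (cases "v \<in> ball 0 1")
      case True
      then show ?thesis using pt[OF elim(2)] by simp
    qed simp
  qed
  also have "\<dots> = ?\<beta> + (\<integral>\<^sup>+ v. (\<Sum>k. ennreal (2 ^ (k + 1)) * indicator (?B k) v) \<partial>lborel)"
  proof (subst nn_integral_add)
    show "(\<lambda>v. \<Sum>k. ennreal (2 ^ (k + 1)) * indicator (?B k) v) \<in> borel_measurable lborel" by measurable
  qed (auto simp: borel_measurable_indicator)
  also have "(\<integral>\<^sup>+ v. (\<Sum>k. ennreal (2 ^ (k + 1)) * indicator (?B k) v) \<partial>lborel)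
     = (\<Sum>k. ennreal (2 ^ (k + 1)) * emeasure lborel (?B k))"
    by (subst nn_integral_suminf)
      (auto simp: nn_integral_cmult_indicator intro!: borel_measurable_indicator borel_measurable_times_ennreal)
  also have "\<dots> \<le> (\<Sum>k. ennreal (2 * (1/2) ^ k) * ?\<beta>)"
  proof (rule suminf_le)
    fix k :: nat
    have "ennreal (2 ^ (k + 1)) * emeasure lborel (?B k) \<le> ennreal (2 ^ (k + 1)) * (ennreal ((1/4) ^ k) * ?\<beta>)"
      by (intro mult_left_mono ball) auto
    also have "\<dots> = ennreal (2 ^ (k + 1) * (1/4) ^ k) * ?\<beta>"
      by (simp add: ennreal_mult mult.assoc)
    also have "(2 ^ (k + 1) * (1/4) ^ k :: real) = 2 * (1/2) ^ k"
      by (simp add: power_mult_distrib[symmetric])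
    finally show "ennreal (2 ^ (k + 1)) * emeasure lborel (?B k) \<le> ennreal (2 * (1/2) ^ k) * ?\<beta>" .
  qed auto
  also have "\<dots> = (\<Sum>k. ennreal (2 * (1/2) ^ k)) * ?\<beta>" by simp
  also have "(\<Sum>k. ennreal (2 * (1/2) ^ k)) = ennreal 4"
    using sums_mult[OF geometric_sums[of "1/2 :: real"], of 2] by (intro suminf_ennreal_eq) auto
  also have "?\<beta> + ennreal 4 * ?\<beta> = 5 * ?\<beta>"
  proof -
    have "(1 + 4 :: ennreal) * ?\<beta> = ?\<beta> + 4 * ?\<beta>" by (simp only: distrib_right mult_1)
    then show ?thesis by simp
  qed
  finally show ?thesis by (simp add: add_left_mono)
qed

lemma inverse_norm_measurable [measurable]:
  fixes r :: "'e::euclidean_space"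
  shows "(\<lambda>v. 1 / ennreal (norm (r + \<mu> *\<^sub>R v))) \<in> borel_measurable borel"
  by measurable

lemma nn_integral_inverse_norm_ball_scaled:
  fixes r :: "'e::euclidean_space"
  assumes dim: "DIM('e) \<ge> 2" and \<mu>: "\<mu> \<noteq> 0"
  shows "(\<integral>\<^sup>+ v\<in>ball 0 1. 1 / ennreal (norm (r + \<mu> *\<^sub>R v)) \<partial>lborel) \<le> ennreal (5 / \<bar>\<mu>\<bar>) * emeasure lborel (ball (0::'e) 1)"
proof -
  have "1 / ennreal (norm (r + \<mu> *\<^sub>R v)) = ennreal (1 / \<bar>\<mu>\<bar>) * (1 / ennreal (norm ((1 / \<mu>) *\<^sub>R r + v)))" for v
  proof -
    have "r + \<mu> *\<^sub>R v = \<mu> *\<^sub>R ((1 / \<mu>) *\<^sub>R r + v)" using \<mu> by (simp add: scaleR_add_right)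
    then have eq: "norm (r + \<mu> *\<^sub>R v) = \<bar>\<mu>\<bar> * norm ((1 / \<mu>) *\<^sub>R r + v)" by simp
    show ?thesis
    proof (cases "(1 / \<mu>) *\<^sub>R r + v = 0")
      case True
      then show ?thesis using \<mu> unfolding eq by (simp add: ennreal_mult_top ennreal_top_mult)
    next
      case False
      then show ?thesis using \<mu> unfolding eq
        by (subst (1 2) ennreal_1[symmetric], subst (1 2) divide_ennreal)
          (auto simp: ennreal_mult[symmetric] simp del: ennreal_1)
    qed
  qed
  then have "(\<integral>\<^sup>+ v\<in>ball 0 1. 1 / ennreal (norm (r + \<mu> *\<^sub>R v)) \<partial>lborel)
     = (\<integral>\<^sup>+ v. ennreal (1 / \<bar>\<mu>\<bar>) * (1 / ennreal (norm ((1 / \<mu>) *\<^sub>R r + v)) * indicator (ball 0 1) v) \<partial>lborel)"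
    by (simp add: mult.assoc)
  also have "\<dots> = ennreal (1 / \<bar>\<mu>\<bar>) * (\<integral>\<^sup>+ v\<in>ball 0 1. 1 / ennreal (norm ((1 / \<mu>) *\<^sub>R r + v)) \<partial>lborel)"
    using inverse_norm_measurable[of "(1 / \<mu>) *\<^sub>R r" 1]
    by (intro nn_integral_cmult borel_measurable_times_ennreal borel_measurable_indicator) auto
  also have "\<dots> \<le> ennreal (1 / \<bar>\<mu>\<bar>) * (5 * emeasure lborel (ball (0::'e) 1))"
    by (intro mult_left_mono nn_integral_inverse_norm_ball dim) auto
  also have "\<dots> = ennreal (5 / \<bar>\<mu>\<bar>) * emeasure lborel (ball (0::'e) 1)"
  proof -
    have "ennreal (5 / \<bar>\<mu>\<bar>) = ennreal (1 / \<bar>\<mu>\<bar>) * ennreal 5" by (subst ennreal_mult[symmetric]) auto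
    then show ?thesis by (simp add: mult.assoc)
  qed
  finally show ?thesis .
qed

text \<open>
  If \<open>\<mu>\<close> is large compared with \<open>r\<close>, scaling gives the bound \<open>5 / \<bar>\<mu>\<bar>\<close> for the average; otherwise the
  shifted point keeps at least half of its distance from the origin.
\<close>

lemma nn_integral_inverse_norm_ball_le_centre:
  fixes r :: "'e::euclidean_space"
  assumes dim: "DIM('e) \<ge> 2"
  shows "(\<integral>\<^sup>+ v\<in>ball 0 1. 1 / ennreal (norm (r + \<mu> *\<^sub>R v)) \<partial>lborel)
    \<le> 10 * emeasure lborel (ball (0::'e) 1) * (1 / ennreal (norm r))"
proof (cases "r = 0")
  case True
  have "emeasure lborel (ball (0::'e) 1) \<noteq> 0" 
    by (simp add: emeasure_ball less_imp_neq[OF unit_ball_vol_pos, symmetric])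
  then show ?thesis using True by (simp add: ennreal_mult_top)
next
  case False
  let ?\<beta> = "emeasure lborel (ball (0::'e) 1)"
  have r: "0 < norm r" using False by simp
  have inv: "1 / ennreal (norm r) = ennreal (1 / norm r)"
    using r by (subst ennreal_1[symmetric], subst divide_ennreal) auto
  have ten: "10 * ?\<beta> * (1 / ennreal (norm r)) = ennreal (10 / norm r) * ?\<beta>"
  proof -
    have "ennreal (10 / norm r) = ennreal 10 * ennreal (1 / norm r)" by (subst ennreal_mult[symmetric]) auto
    then show ?thesis unfolding inv by (simp add: ac_simps)
  qed
  show ?thesis
  proof (cases "norm r \<le> 2 * \<bar>\<mu>\<bar>")
    case True
    then have \<mu>: "\<mu> \<noteq> 0" using r by auto
    have "5 / \<bar>\<mu>\<bar> \<le> 10 / norm r" using True r \<mu> by (simp add: field_simps)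
    then have "ennreal (5 / \<bar>\<mu>\<bar>) * ?\<beta> \<le> ennreal (10 / norm r) * ?\<beta>"
      by (intro mult_right_mono ennreal_leI) auto
    then show ?thesis unfolding ten using nn_integral_inverse_norm_ball_scaled[OF dim \<mu>, of r] by (rule order_trans[rotated])
  next
    case big: False
    have "(\<integral>\<^sup>+ v\<in>ball 0 1. 1 / ennreal (norm (r + \<mu> *\<^sub>R v)) \<partial>lborel)
       \<le> (\<integral>\<^sup>+ v. ennreal (10 / norm r) * indicator (ball (0::'e) 1) v \<partial>lborel)"
    proof (rule nn_integral_mono)
      fix v :: 'e
      show "1 / ennreal (norm (r + \<mu> *\<^sub>R v)) * indicator (ball 0 1) v \<le> ennreal (10 / norm r) * indicator (ball 0 1) v"
      proof (cases "v \<in> ball 0 1")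
        case True
        then have "norm (\<mu> *\<^sub>R v) \<le> \<bar>\<mu>\<bar>" by (simp add: mult_left_le)
        moreover have "norm r - norm (\<mu> *\<^sub>R v) \<le> norm (r + \<mu> *\<^sub>R v)" by (rule norm_diff_ineq)
        ultimately have half: "norm r / 2 \<le> norm (r + \<mu> *\<^sub>R v)" using big by linarith
        then have pos: "0 < norm (r + \<mu> *\<^sub>R v)" using r by linarith
        have "1 / ennreal (norm (r + \<mu> *\<^sub>R v)) = ennreal (1 / norm (r + \<mu> *\<^sub>R v))"
          using pos by (subst ennreal_1[symmetric], subst divide_ennreal) auto
        also have "1 / norm (r + \<mu> *\<^sub>R v) \<le> 1 / (norm r / 2)"
          using half r by (intro divide_left_mono) (auto intro: mult_pos_pos pos)
        also have "\<dots> \<le> 10 / norm r" using r by (simp add: field_simps)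
        finally show ?thesis using True by (simp add: ennreal_leI)
      qed simp
    qed
    also have "\<dots> = ennreal (10 / norm r) * ?\<beta>" by (subst nn_integral_cmult_indicator) auto
    finally show ?thesis unfolding ten .
  qed
qed

lemma newton_potential_eq_weighted:
  fixes m :: "'n::{finite,linorder} \<Rightarrow> real"
  shows "newton_potential m x = (\<Sum>(i, j)\<in>{(i, j). i < j}. ennreal (m i * m j) * (1 / ennreal (norm (x $ i - x $ j))))"
  unfolding newton_potential_def by (intro sum.cong) (auto simp: ennreal_times_divide)

lemma spread_diff: "(x + \<kappa> *\<^sub>R spread c v) $ i - (x + \<kappa> *\<^sub>R spread c v) $ j = (x $ i - x $ j) + (\<kappa> * (c i - c j)) *\<^sub>R v"
  by (simp add: spread_def algebra_simps)

text \<open>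
  The average of the potential over the shifts of \<open>x\<close>, up to the factor given by the volume of the ball.
\<close>

definition spread_average ::
  "('n::{finite,linorder} \<Rightarrow> real) \<Rightarrow> ('n \<Rightarrow> real) \<Rightarrow> real \<Rightarrow> ('e::euclidean_space, 'n) vec \<Rightarrow> ennreal"
  where "spread_average m c \<kappa> x = (\<integral>\<^sup>+ v\<in>ball 0 1. newton_potential m (x + \<kappa> *\<^sub>R spread c v) \<partial>lborel)"

lemma spread_average_eq:
  fixes m :: "'n::{finite,linorder} \<Rightarrow> real" and x :: "('e::euclidean_space, 'n) vec"
  shows "spread_average m c \<kappa> x = (\<Sum>(i, j)\<in>{(i, j). i < j}. ennreal (m i * m j) *
    (\<integral>\<^sup>+ v\<in>ball 0 1. 1 / ennreal (norm ((x $ i - x $ j) + (\<kappa> * (c i - c j)) *\<^sub>R v)) \<partial>lborel))"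
proof -
  let ?f = "\<lambda>(i, j) v. 1 / ennreal (norm ((x $ i - x $ j) + (\<kappa> * (c i - c j)) *\<^sub>R v)) * indicator (ball 0 1) v"
  have [measurable]: "?f p \<in> borel_measurable lborel" for p
    by (cases p) (auto intro!: borel_measurable_times_ennreal borel_measurable_indicator inverse_norm_measurable)
  have "spread_average m c \<kappa> x = (\<integral>\<^sup>+ v. (\<Sum>p\<in>{(i, j). i < j}. ennreal (m (fst p) * m (snd p)) * ?f p v) \<partial>lborel)"
    unfolding spread_average_def newton_potential_eq_weighted spread_diff sum_distrib_right
    by (intro nn_integral_cong sum.cong) (auto simp: mult.assoc)
  also have "\<dots> = (\<Sum>p\<in>{(i, j). i < j}. \<integral>\<^sup>+ v. ennreal (m (fst p) * m (snd p)) * ?f p v \<partial>lborel)"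
    by (intro nn_integral_sum) measurable
  also have "\<dots> = (\<Sum>p\<in>{(i, j). i < j}. ennreal (m (fst p) * m (snd p)) * (\<integral>\<^sup>+ v. ?f p v \<partial>lborel))"
    by (intro sum.cong refl nn_integral_cmult) measurable
  finally show ?thesis by (simp add: split_beta)
qed

text \<open>
  The bound does not depend on \<open>\<kappa>\<close>: it provides the dominating function for the passage to the limit
  \<open>\<kappa> \<longlonglongrightarrow> 0\<close>.
\<close>

lemma spread_average_le_potential:
  fixes m :: "'n::{finite,linorder} \<Rightarrow> real" and x :: "('e::euclidean_space, 'n) vec"
  assumes dim: "DIM('e) \<ge> 2"
  shows "spread_average m c \<kappa> x \<le> 10 * emeasure lborel (ball (0::'e) 1) * newton_potential m x"
  unfolding spread_average_eq newton_potential_eq_weighted sum_distrib_left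
proof (intro sum_mono, clarify)
  fix i j :: 'n
  show "ennreal (m i * m j) * (\<integral>\<^sup>+ v\<in>ball 0 1. 1 / ennreal (norm ((x $ i - x $ j) + (\<kappa> * (c i - c j)) *\<^sub>R v)) \<partial>lborel)
    \<le> 10 * emeasure lborel (ball (0::'e) 1) * (ennreal (m i * m j) * (1 / ennreal (norm (x $ i - x $ j))))"
    using mult_left_mono[OF nn_integral_inverse_norm_ball_le_centre[OF dim, of "x $ i - x $ j" "\<kappa> * (c i - c j)"], of "ennreal (m i * m j)"]
    by (simp add: ac_simps)
qed

text \<open>
  The bound does not depend on \<open>x\<close>, which may be a collision: it controls curves that start at a
  collision.
\<close>

lemma spread_average_le_inverse:
  fixes m :: "'n::{finite,linorder} \<Rightarrow> real"
  assumes dim: "DIM('e::euclidean_space) \<ge> 2" and m: "\<And>i. m i > 0"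
    and c: "\<And>i j. i \<noteq> j \<Longrightarrow> 1 \<le> \<bar>c i - c j\<bar>"
  obtains K where "K > 0" "\<And>\<kappa> (x :: ('e, 'n) vec). \<kappa> > 0 \<Longrightarrow>
    spread_average m c \<kappa> x \<le> ennreal (K / \<kappa>) * emeasure lborel (ball (0::'e) 1)"
proof -
  define M where "M = (\<Sum>(i, j)\<in>{(i, j). i < j}. m i * m j)"
  have M: "M \<ge> 0" unfolding M_def by (rule sum_nonneg) (auto intro!: mult_nonneg_nonneg less_imp_le[OF m])
  show ?thesis
  proof (rule that[of "5 * M + 1"])
    show "5 * M + 1 > 0" using M by simp
    fix \<kappa> :: real and x :: "('e, 'n) vec" assume \<kappa>: "\<kappa> > 0"
    let ?\<beta> = "emeasure lborel (ball (0::'e) 1)"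
    have "spread_average m c \<kappa> x \<le> (\<Sum>(i, j)\<in>{(i, j). i < j}. ennreal (m i * m j * (5 / \<kappa>)) * ?\<beta>)"
      unfolding spread_average_eq
    proof (intro sum_mono, clarify)
      fix i j :: 'n assume ij: "i < j"
      have c': "1 \<le> \<bar>c i - c j\<bar>" using c[of i j] ij by auto
      have nz: "\<kappa> * (c i - c j) \<noteq> 0" using \<kappa> c' by auto
      have "\<kappa> * 1 \<le> \<kappa> * \<bar>c i - c j\<bar>" using c' \<kappa> by (intro mult_left_mono) auto
      then have "5 / \<bar>\<kappa> * (c i - c j)\<bar> \<le> 5 / \<kappa>" using \<kappa> by (intro frac_le) (auto simp: abs_mult)
      then have "ennreal (5 / \<bar>\<kappa> * (c i - c j)\<bar>) * ?\<beta> \<le> ennreal (5 / \<kappa>) * ?\<beta>"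
        by (intro mult_right_mono ennreal_leI) auto
      with nn_integral_inverse_norm_ball_scaled[OF dim nz, of "x $ i - x $ j"]
      have "(\<integral>\<^sup>+ v\<in>ball 0 1. 1 / ennreal (norm ((x $ i - x $ j) + (\<kappa> * (c i - c j)) *\<^sub>R v)) \<partial>lborel) \<le> ennreal (5 / \<kappa>) * ?\<beta>"
        by (rule order_trans)
      then have "ennreal (m i * m j) * (\<integral>\<^sup>+ v\<in>ball 0 1. 1 / ennreal (norm ((x $ i - x $ j) + (\<kappa> * (c i - c j)) *\<^sub>R v)) \<partial>lborel)
          \<le> ennreal (m i * m j) * (ennreal (5 / \<kappa>) * ?\<beta>)" by (rule mult_left_mono) simp
      also have "\<dots> = ennreal (m i * m j * (5 / \<kappa>)) * ?\<beta>"
        using \<kappa> by (subst ennreal_mult) (auto simp: mult.assoc intro!: mult_nonneg_nonneg less_imp_le[OF m])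
      finally show "ennreal (m i * m j) * (\<integral>\<^sup>+ v\<in>ball 0 1. 1 / ennreal (norm ((x $ i - x $ j) + (\<kappa> * (c i - c j)) *\<^sub>R v)) \<partial>lborel)
          \<le> ennreal (m i * m j * (5 / \<kappa>)) * ?\<beta>" .
    qed
    also have "\<dots> = ennreal (M * (5 / \<kappa>)) * ?\<beta>"
    proof -
      have "(\<Sum>(i, j)\<in>{(i, j). i < j}. ennreal (m i * m j * (5 / \<kappa>))) = ennreal (\<Sum>(i, j)\<in>{(i, j). i < j}. m i * m j * (5 / \<kappa>))"
        unfolding split_beta
        by (rule sum_ennreal) (use \<kappa> in \<open>auto intro!: mult_nonneg_nonneg divide_nonneg_nonneg less_imp_le[OF m]\<close>)
      also have "(\<Sum>(i, j)\<in>{(i, j). i < j}. m i * m j * (5 / \<kappa>)) = M * (5 / \<kappa>)"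
        unfolding M_def sum_distrib_right split_beta ..
      finally have "(\<Sum>(i, j)\<in>{(i, j). i < j}. ennreal (m i * m j * (5 / \<kappa>))) * ?\<beta> = ennreal (M * (5 / \<kappa>)) * ?\<beta>"
        by (rule arg_cong)
      then show ?thesis unfolding sum_distrib_right by (simp only: split_beta split_beta')
    qed
    also have "\<dots> \<le> ennreal ((5 * M + 1) / \<kappa>) * ?\<beta>"
      using \<kappa> by (intro mult_right_mono ennreal_leI) (auto simp: field_simps)
    finally show "spread_average m c \<kappa> x \<le> ennreal ((5 * M + 1) / \<kappa>) * ?\<beta>" .
  qed
qed

lemma spread_average_eventually_le:
  fixes m :: "'n::{finite,linorder} \<Rightarrow> real" and x :: "('e::euclidean_space, 'n) vec"
  assumes m: "\<And>i. m i > 0" and x: "x \<in> collision_free m" and e: "e > 0"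
    and \<kappa>: "\<kappa> \<longlonglongrightarrow> 0"
  shows "eventually (\<lambda>n. spread_average m c (\<kappa> n) x \<le> (newton_potential m x + ennreal e) * emeasure lborel (ball (0::'e) 1)) sequentially"
proof -
  let ?\<Omega> = "collision_free m :: ('e, 'n) vec set"
  have op: "open ?\<Omega>" by (rule open_collision_free[of m, OF m])
  have "isCont (real_potential m) x" using continuous_on_real_potential[of m, OF m] op x continuous_on_eq_continuous_at by blast
  then obtain r1 where r1: "r1 > 0" "\<And>z. dist z x < r1 \<Longrightarrow> dist (real_potential m z) (real_potential m x) < e"
    unfolding continuous_at_eps_delta using e by metis
  obtain r2 where r2: "r2 > 0" "ball x r2 \<subseteq> ?\<Omega>" using op x openE by blast
  obtain K where K: "K > 0" "\<And>v :: 'e. v \<in> ball 0 1 \<Longrightarrow> norm (spread c v :: ('e, 'n) vec) \<le> K"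
    using spread_bounded by blast
  have "0 < min r1 r2 / K" using r1 r2 K by simp
  then have "eventually (\<lambda>n. dist (\<kappa> n) 0 < min r1 r2 / K) sequentially" using \<kappa> tendstoD by blast
  then show ?thesis
  proof eventually_elim
    case (elim n)
    have pt: "newton_potential m (x + \<kappa> n *\<^sub>R spread c v) \<le> newton_potential m x + ennreal e" if v: "v \<in> ball 0 1" for v :: 'e
    proof -
      have "norm (\<kappa> n *\<^sub>R spread c v :: ('e, 'n) vec) \<le> \<bar>\<kappa> n\<bar> * K"
        using K(2)[OF v] by (simp add: mult_left_mono)
      also have "\<dots> < min r1 r2" using elim K(1) by (simp add: pos_less_divide_eq)
      finally have d: "dist (x + \<kappa> n *\<^sub>R spread c v) x < min r1 r2" by (simp add: dist_norm)
      then have free: "x + \<kappa> n *\<^sub>R spread c v \<in> ?\<Omega>" using r2 by (auto simp: dist_commute subset_iff)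
      have "real_potential m (x + \<kappa> n *\<^sub>R spread c v) \<le> real_potential m x + e"
        using r1(2)[of "x + \<kappa> n *\<^sub>R spread c v"] d by (auto simp: dist_real_def)
      then have "ennreal (real_potential m (x + \<kappa> n *\<^sub>R spread c v)) \<le> ennreal (real_potential m x + e)" by (rule ennreal_leI)
      also have "\<dots> = ennreal (real_potential m x) + ennreal e"
        using real_potential_nonneg[of m x, OF m] e by simp
      finally show ?thesis
        by (simp add: newton_potential_eq_real[of m, OF m free] newton_potential_eq_real[of m, OF m x])
    qed
    have "spread_average m c (\<kappa> n) x \<le> (\<integral>\<^sup>+ v. (newton_potential m x + ennreal e) * indicator (ball (0::'e) 1) v \<partial>lborel)"
      unfolding spread_average_def using pt by (intro nn_integral_mono) (auto simp: indicator_def)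
    also have "\<dots> = (newton_potential m x + ennreal e) * emeasure lborel (ball (0::'e) 1)"
      by (subst nn_integral_cmult_indicator) auto
    finally show ?case .
  qed
qed

lemma newton_potential_spread_measurable:
  fixes m :: "'n::{finite,linorder} \<Rightarrow> real"
  shows "(\<lambda>(\<kappa>, x, v). newton_potential m ((x :: ('e::euclidean_space, 'n) vec) + \<kappa> *\<^sub>R spread c v))
    \<in> borel_measurable borel"
proof -
  have "continuous_on UNIV (\<lambda>(\<kappa>, x, v). (x :: ('e, 'n) vec) + \<kappa> *\<^sub>R spread c v)"
    unfolding split_beta
    by (intro continuous_intros bounded_linear.continuous_on[OF bounded_linear_spread])
  then have "(\<lambda>(\<kappa>, x, v). (x :: ('e, 'n) vec) + \<kappa> *\<^sub>R spread c v) \<in> borel_measurable borel"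
    by (rule borel_measurable_continuous_onI)
  from measurable_compose[OF this newton_potential_measurable]
  show ?thesis by (simp add: split_beta)
qed

lemma newton_potential_path_spread_measurable:
  fixes m :: "'n::{finite,linorder} \<Rightarrow> real" and g :: "real \<Rightarrow> ('e::euclidean_space, 'n) vec"
  assumes [measurable]: "g \<in> borel_measurable borel" "\<tau> \<in> borel_measurable borel"
  shows "(\<lambda>(t, v). newton_potential m (g t + \<tau> t *\<^sub>R spread c v)) \<in> borel_measurable (lborel \<Otimes>\<^sub>M lborel)"
proof -
  have "(\<lambda>(t :: real, v :: 'e). (\<tau> t, g t, v)) \<in> (lborel \<Otimes>\<^sub>M lborel) \<rightarrow>\<^sub>M (borel \<Otimes>\<^sub>M borel \<Otimes>\<^sub>M borel)"
    by measurable
  then have "(\<lambda>(t :: real, v :: 'e). (\<tau> t, g t, v)) \<in> borel_measurable (lborel \<Otimes>\<^sub>M lborel)"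
    by (simp add: borel_prod)
  from measurable_compose[OF this newton_potential_spread_measurable[of m c]]
  show ?thesis by (simp add: split_beta)
qed

text \<open>
  By Tonelli's theorem the average over \<open>v\<close> of the integrated potential is the integral of the averages.
  Hence a bound on the latter is met by some \<open>v\<close>, even one outside a given null set.
\<close>

lemma exists_good_spread:
  fixes m :: "'n::{finite,linorder} \<Rightarrow> real" and g :: "real \<Rightarrow> ('e::euclidean_space, 'n) vec" and N :: "'e set"
  assumes g: "g \<in> borel_measurable borel" and \<tau>: "\<tau> \<in> borel_measurable borel"
    and N: "negligible N"
    and less: "(\<integral>\<^sup>+ t\<in>{a..b}. spread_average m c (\<tau> t) (g t) \<partial>lborel) < X * emeasure lborel (ball (0::'e) 1)"
  obtains v where "v \<in> ball 0 1" "v \<notin> N" "(\<integral>\<^sup>+ t\<in>{a..b}. newton_potential m (g t + \<tau> t *\<^sub>R spread c v) \<partial>lborel) < X"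
proof (rule ccontr)
  assume none: "\<not> thesis"
  note good = that
  have ge: "X \<le> (\<integral>\<^sup>+ t\<in>{a..b}. newton_potential m (g t + \<tau> t *\<^sub>R spread c v) \<partial>lborel)"
    if "v \<in> ball 0 1" "v \<notin> N" for v
    using good[OF that] none by (auto simp: not_le[symmetric])
  let ?F = "\<lambda>(t, v). newton_potential m (g t + \<tau> t *\<^sub>R spread c v) * indicator (ball (0::'e) 1) v * indicator {a..b} t"
  have meas [measurable]: "?F \<in> borel_measurable (lborel \<Otimes>\<^sub>M lborel)"
  proof -
    have [measurable]: "(\<lambda>p. newton_potential m (g (fst p) + \<tau> (fst p) *\<^sub>R spread c (snd p))) \<in> borel_measurable (lborel \<Otimes>\<^sub>M lborel)"
      using newton_potential_path_spread_measurable[OF g \<tau>, of m c] by (simp add: split_beta')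
    have [measurable]: "(\<lambda>p :: real \<times> 'e. indicator (ball (0::'e) 1) (snd p) :: ennreal) \<in> borel_measurable (lborel \<Otimes>\<^sub>M lborel)"
      by (rule measurable_compose[OF measurable_snd]) (simp add: borel_measurable_indicator)
    have [measurable]: "(\<lambda>p :: real \<times> 'e. indicator {a..b} (fst p) :: ennreal) \<in> borel_measurable (lborel \<Otimes>\<^sub>M lborel)"
      by (rule measurable_compose[OF measurable_fst]) (simp add: borel_measurable_indicator)
    show ?thesis unfolding split_beta' by measurable
  qed
  have mt: "(\<lambda>v. newton_potential m (g t + \<tau> t *\<^sub>R spread c v) * indicator (ball (0::'e) 1) v) \<in> borel_measurable lborel" for t
  proof -
    have "(\<lambda>v. (\<lambda>(\<kappa>, x, v). newton_potential m (x + \<kappa> *\<^sub>R spread c v)) (\<tau> t, g t, v)) \<in> borel_measurable borel"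
      by (rule measurable_compose[OF _ newton_potential_spread_measurable]) (simp add: borel_measurable_Pair)
    then show ?thesis by (intro borel_measurable_times_ennreal borel_measurable_indicator) auto
  qed
  have "AE v in lebesgue. v \<notin> N" using N by (intro AE_not_in) (simp add: negligible_iff_null_sets)
  then have ae: "AE v in lborel. v \<notin> N" by (simp add: AE_completion_iff)
  have "X * emeasure lborel (ball (0::'e) 1) = (\<integral>\<^sup>+ v. X * indicator (ball (0::'e) 1) v \<partial>lborel)"
    by (subst nn_integral_cmult_indicator) auto
  also have "\<dots> \<le> (\<integral>\<^sup>+ v. (\<integral>\<^sup>+ t. ?F (t, v) \<partial>lborel) \<partial>lborel)"
  proof (rule nn_integral_mono_AE, use ae in eventually_elim)
    case (elim v)
    show ?case
    proof (cases "v \<in> ball 0 1")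
      case True
      then show ?thesis using ge[OF True elim] by simp
    qed simp
  qed
  also have "\<dots> = (\<integral>\<^sup>+ t. (\<integral>\<^sup>+ v. ?F (t, v) \<partial>lborel) \<partial>lborel)"
    using lborel_pair.Fubini'[OF meas] by simp
  also have "\<dots> = (\<integral>\<^sup>+ t\<in>{a..b}. spread_average m c (\<tau> t) (g t) \<partial>lborel)"
    unfolding spread_average_def using mt by (intro nn_integral_cong) (simp add: nn_integral_multc)
  finally show False using less by simp
qed

lemma spread_average_path_measurable:
  fixes m :: "'n::{finite,linorder} \<Rightarrow> real" and g :: "real \<Rightarrow> ('e::euclidean_space, 'n) vec"
  assumes g: "g \<in> borel_measurable borel"
  shows "(\<lambda>t. spread_average m c \<kappa> (g t)) \<in> borel_measurable lborel"
proof -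
  have [measurable]: "(\<lambda>p. newton_potential m (g (fst p) + \<kappa> *\<^sub>R spread c (snd p))) \<in> borel_measurable (lborel \<Otimes>\<^sub>M lborel)"
    using newton_potential_path_spread_measurable[OF g, of "\<lambda>_. \<kappa>" m c] by (simp add: split_beta')
  have [measurable]: "(\<lambda>p :: real \<times> 'e. indicator (ball (0::'e) 1) (snd p) :: ennreal) \<in> borel_measurable (lborel \<Otimes>\<^sub>M lborel)"
    by (rule measurable_compose[OF measurable_snd]) (simp add: borel_measurable_indicator)
  have "(\<lambda>(t, v). newton_potential m (g t + \<kappa> *\<^sub>R spread c v) * indicator (ball (0::'e) 1) v) \<in> borel_measurable (lborel \<Otimes>\<^sub>M lborel)"
    unfolding split_beta' by measurable
  then show ?thesis unfolding spread_average_def by (rule lborel.borel_measurable_nn_integral)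
qed

text \<open>
  The reverse Fatou lemma, with the domination of \<open>spread_average_le_potential\<close>. Almost all times are free
  of collisions because the integral of the potential is finite.
\<close>

lemma spread_average_integral_eventually_less:
  fixes m :: "'n::{finite,linorder} \<Rightarrow> real" and g :: "real \<Rightarrow> ('e::euclidean_space, 'n) vec"
  assumes dim: "DIM('e) \<ge> 2" and m: "\<And>i. m i > 0" and g [measurable]: "g \<in> borel_measurable borel"
    and ab: "a \<le> b" and e: "e > 0" and \<kappa>: "\<kappa> \<longlonglongrightarrow> 0"
    and fin: "(\<integral>\<^sup>+ t\<in>{a..b}. newton_potential m (g t) \<partial>lborel) < \<infinity>"
  shows "eventually (\<lambda>n. (\<integral>\<^sup>+ t\<in>{a..b}. spread_average m c (\<kappa> n) (g t) \<partial>lborel)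
    < ((\<integral>\<^sup>+ t\<in>{a..b}. newton_potential m (g t) \<partial>lborel) + ennreal e) * emeasure lborel (ball (0::'e) 1)) sequentially"
proof -
  let ?\<beta> = "emeasure lborel (ball (0::'e) 1)"
  let ?I = "\<integral>\<^sup>+ t\<in>{a..b}. newton_potential m (g t) \<partial>lborel"
  have \<beta>: "0 < ?\<beta>" "?\<beta> < \<infinity>"
    using unit_ball_vol_pos[of "real DIM('e)"] by (simp_all add: emeasure_ball)
  define e1 where "e1 = e / (b - a + 1)"
  have e1: "e1 > 0" "e1 * (b - a) < e" using e ab by (auto simp: e1_def field_simps)
  have ind [measurable]: "(indicator {a..b} :: real \<Rightarrow> ennreal) \<in> borel_measurable lborel" by (simp add: borel_measurable_indicator)
  define u where "u n t = spread_average m c (\<kappa> n) (g t) * indicator {a..b} t" for n t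
  have um [measurable]: "u n \<in> borel_measurable lborel" for n
    unfolding u_def using spread_average_path_measurable[OF g] by (intro borel_measurable_times_ennreal ind) auto
  have Um [measurable]: "(\<lambda>t. newton_potential m (g t) * indicator {a..b} t) \<in> borel_measurable lborel"
    by (intro borel_measurable_times_ennreal ind) (simp add: measurable_compose[OF g newton_potential_measurable])
  have "limsup (\<lambda>n. integral\<^sup>N lborel (u n)) \<le> (\<integral>\<^sup>+ t. limsup (\<lambda>n. u n t) \<partial>lborel)"
  proof (rule nn_integral_limsup[where w = "\<lambda>t. 10 * ?\<beta> * (newton_potential m (g t) * indicator {a..b} t)"])
    show "AE t in lborel. u n t \<le> 10 * ?\<beta> * (newton_potential m (g t) * indicator {a..b} t)" for n
      using spread_average_le_potential[OF dim, of m c "\<kappa> n"] by (auto simp: u_def indicator_def)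
    have "(\<integral>\<^sup>+ t. 10 * ?\<beta> * (newton_potential m (g t) * indicator {a..b} t) \<partial>lborel) = 10 * ?\<beta> * ?I"
      by (rule nn_integral_cmult[OF Um])
    then show "(\<integral>\<^sup>+ t. 10 * ?\<beta> * (newton_potential m (g t) * indicator {a..b} t) \<partial>lborel) < \<infinity>"
      using \<beta> fin by (simp add: ennreal_mult_less_top)
  qed (use Um in measurable)
  also have "\<dots> \<le> (\<integral>\<^sup>+ t. (newton_potential m (g t) * indicator {a..b} t + ennreal e1 * indicator {a..b} t) * ?\<beta> \<partial>lborel)"
  proof (rule nn_integral_mono_AE)
    have "AE t in lborel. newton_potential m (g t) * indicator {a..b} t \<noteq> \<infinity>"
      using fin by (intro nn_integral_PInf_AE[OF Um]) auto
    then show "AE t in lborel. limsup (\<lambda>n. u n t) \<le> (newton_potential m (g t) * indicator {a..b} t + ennreal e1 * indicator {a..b} t) * ?\<beta>"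
    proof eventually_elim
      case (elim t)
      show ?case
      proof (cases "t \<in> {a..b}")
        case True
        then have "g t \<in> collision_free m" using elim by (simp add: collision_free_def less_top)
        from spread_average_eventually_le[of m, OF m this e1(1) \<kappa>]
        have "eventually (\<lambda>n. u n t \<le> (newton_potential m (g t) + ennreal e1) * ?\<beta>) sequentially"
          using True by (simp add: u_def)
        then show ?thesis using True by (intro Limsup_bounded) (auto elim: eventually_mono)
      qed (simp add: u_def Limsup_const)
    qed
  qed
  also have "\<dots> = (\<integral>\<^sup>+ t. newton_potential m (g t) * indicator {a..b} t + ennreal e1 * indicator {a..b} t \<partial>lborel) * ?\<beta>"
    by (rule nn_integral_multc) measurable
  also have "(\<integral>\<^sup>+ t. newton_potential m (g t) * indicator {a..b} t + ennreal e1 * indicator {a..b} t \<partial>lborel) = ?I + ennreal (e1 * (b - a))"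
    using ab e1(1) by (subst nn_integral_add[OF Um]) (auto simp: nn_integral_cmult_indicator ennreal_mult)
  also have "(?I + ennreal (e1 * (b - a))) * ?\<beta> < (?I + ennreal e) * ?\<beta>"
  proof -
    have "?I + ennreal (e1 * (b - a)) < ?I + ennreal e"
      using fin e1 e ab by (cases ?I) (auto simp: ennreal_plus[symmetric] ennreal_less_iff simp del: ennreal_plus)
    then show ?thesis using \<beta> by (intro ennreal_mult_strict_right_mono) auto
  qed
  finally have "limsup (\<lambda>n. integral\<^sup>N lborel (u n)) < (?I + ennreal e) * ?\<beta>" .
  then show ?thesis unfolding u_def by (rule Limsup_lessD)
qed

section \<open>Equality of the two distances off the collisions\<close>

text \<open>
  An almost optimal curve is shifted off the collisions, at little cost in the potential and none in the
  velocity. Its new ends are joined to the old ones inside a neighbourhood where the Jacobi-Maupertuis distance is small.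
\<close>

lemma jm_dist_le_action_potential:
  fixes m :: "'n::{finite,linorder} \<Rightarrow> real" and x y :: "('e::euclidean_space, 'n) vec"
  assumes dim: "DIM('e) \<ge> 2" and n: "CARD('n) \<ge> 2" and m: "\<And>i. m i > 0" and h: "h \<ge> 0"
    and x: "x \<in> collision_free m" and y: "y \<in> collision_free m"
  shows "jm_dist m h x y \<le> action_potential m h x y"
proof (rule ennreal_le_epsilon)
  fix e :: real assume fin: "action_potential m h x y < top" and e: "0 < e"
  have e4: "e / 4 > 0" using e by simp
  obtain a b \<gamma> where ab: "a < b" and ac: "absolutely_continuous_curve a b \<gamma>" and ends: "\<gamma> a = x" "\<gamma> b = y"
    and act: "curve_action (lagrangian m h) a b \<gamma> \<le> action_potential m h x y + ennreal (e/4)"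
    using fin e4 unfolding action_potential_eq by (elim curve_cost_approx[rotated]) auto
  have ftc: "ftc_curve a b \<gamma>" by (rule absolutely_continuous_curve_ftc[OF ac])
  let ?I = "\<integral>\<^sup>+ t\<in>{a..b}. newton_potential m (\<gamma> t) \<partial>lborel"
  let ?K = "curve_action (free_lagrangian m h) a b \<gamma>"
  have KI: "?K + ?I \<le> action_potential m h x y + ennreal (e/4)"
    using act lagrangian_action_split[OF ftc, of m h] ab by (simp add: lagrangian_action_eq)
  then have finI: "?I < \<infinity>" using fin by (auto simp: less_top[symmetric] top_unique)
  define g where "g t = indicator {a..b} t *\<^sub>R \<gamma> t" for t
  have g: "g \<in> borel_measurable borel" unfolding g_def by (rule ftc_curve_path_measurable[OF ftc])
  have gI: "(\<integral>\<^sup>+ t\<in>{a..b}. newton_potential m (g t + w) \<partial>lborel) = (\<integral>\<^sup>+ t\<in>{a..b}. newton_potential m (\<gamma> t + w) \<partial>lborel)" for w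
    by (intro nn_integral_cong) (auto simp: g_def indicator_def)
  obtain c :: "'n \<Rightarrow> real" where c: "\<And>i j. i \<noteq> j \<Longrightarrow> 1 \<le> \<bar>c i - c j\<bar>" using exists_separated_weights by blast
  obtain Kc where Kc: "Kc > 0" "\<And>v :: 'e. v \<in> ball 0 1 \<Longrightarrow> norm (spread c v :: ('e, 'n) vec) \<le> Kc"
    using spread_bounded by blast
  obtain rx where rx: "rx > 0" "\<And>z. norm (z - x) < rx \<Longrightarrow> jm_dist m h x z \<le> ennreal (e/4) \<and> jm_dist m h z x \<le> ennreal (e/4)"
    using jm_dist_small_nearby[of m, OF m h x e4] by blast
  obtain ry where ry: "ry > 0" "\<And>z. norm (z - y) < ry \<Longrightarrow> jm_dist m h y z \<le> ennreal (e/4) \<and> jm_dist m h z y \<le> ennreal (e/4)"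
    using jm_dist_small_nearby[of m, OF m h y e4] by blast
  define \<kappa> where "\<kappa> n = inverse (real (Suc n))" for n
  have \<kappa>: "\<kappa> \<longlonglongrightarrow> 0" unfolding \<kappa>_def by (rule LIMSEQ_inverse_real_of_nat)
  have fin': "(\<integral>\<^sup>+ t\<in>{a..b}. newton_potential m (g t) \<partial>lborel) < \<infinity>" using finI gI[of 0] by simp
  have "0 < min rx ry / Kc" using rx ry Kc by simp
  then have ev: "eventually (\<lambda>n. dist (\<kappa> n) 0 < min rx ry / Kc) sequentially" using \<kappa> tendstoD by blast
  have "eventually (\<lambda>n. dist (\<kappa> n) 0 < min rx ry / Kc \<and>
      (\<integral>\<^sup>+ t\<in>{a..b}. spread_average m c (\<kappa> n) (g t) \<partial>lborel) < (?I + ennreal (e/4)) * emeasure lborel (ball (0::'e) 1)) sequentially"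
    using spread_average_integral_eventually_less[of m, OF dim m g less_imp_le[OF ab] e4 \<kappa> fin', of c] ev gI[of 0]
    by (auto intro: eventually_conj)
  then obtain n where small: "dist (\<kappa> n) 0 < min rx ry / Kc"
    and avg: "(\<integral>\<^sup>+ t\<in>{a..b}. spread_average m c (\<kappa> n) (g t) \<partial>lborel) < (?I + ennreal (e/4)) * emeasure lborel (ball (0::'e) 1)"
    by (auto dest: eventually_happens)
  have \<kappa>n: "\<kappa> n > 0" by (simp add: \<kappa>_def)
  \<comment> \<open>The vectors \<open>v\<close> for which the shifted curve has a collision of the bodies \<open>i\<close> and \<open>j\<close>.\<close>
  define N where "N = (\<Union>(i, j)\<in>{(i, j). i < j}. (\<lambda>t. (- 1 / (\<kappa> n * (c i - c j))) *\<^sub>R (\<gamma> t $ i - \<gamma> t $ j)) ` {a..b})"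
  have "negligible N"
    unfolding N_def
  proof (intro negligible_Union, goal_cases)
    case (2 S)
    then obtain i j where S: "S = (\<lambda>t. (- 1 / (\<kappa> n * (c i - c j))) *\<^sub>R (\<gamma> t $ i - \<gamma> t $ j)) ` {a..b}" by auto
    have "bounded_linear (\<lambda>x :: ('e, 'n) vec. (- 1 / (\<kappa> n * (c i - c j))) *\<^sub>R (x $ i - x $ j))"
      by (intro bounded_linear_intros bounded_linear_vec_nth)
    from absolutely_continuous_curve_bounded_linear[OF ac this]
    show ?case unfolding S by (rule negligible_absolutely_continuous_curve_image[OF dim])
  qed (simp add: finite_subset[OF subset_UNIV])
  from exists_good_spread[OF g borel_measurable_const this avg]
  obtain v where v: "v \<in> ball 0 1" "v \<notin> N"
    and less: "(\<integral>\<^sup>+ t\<in>{a..b}. newton_potential m (g t + \<kappa> n *\<^sub>R spread c v) \<partial>lborel) < ?I + ennreal (e/4)" by blast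
  let ?w = "\<kappa> n *\<^sub>R spread c v :: ('e, 'n) vec"
  let ?\<gamma> = "\<lambda>t. \<gamma> t + ?w"
  have ftc': "ftc_curve a b ?\<gamma>"
    by (intro absolutely_continuous_curve_ftc absolutely_continuous_curve_add_const ac)
  have free: "?\<gamma> ` {a..b} \<subseteq> collision_free m"
  proof (clarsimp simp: collision_free_iff[of m, OF m])
    fix t i j assume t: "a \<le> t" "t \<le> b" and ij: "i < j"
      and eq: "\<gamma> t $ i + \<kappa> n *\<^sub>R spread c v $ i = \<gamma> t $ j + \<kappa> n *\<^sub>R spread c v $ j"
    let ?q = "\<kappa> n * (c i - c j)"
    have q: "?q \<noteq> 0" using \<kappa>n c[OF less_imp_neq[OF ij]] by auto
    have "?q *\<^sub>R v = - (\<gamma> t $ i - \<gamma> t $ j)" using eq by (simp add: spread_def algebra_simps)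
    then have "(1 / ?q) *\<^sub>R (?q *\<^sub>R v) = (1 / ?q) *\<^sub>R (- (\<gamma> t $ i - \<gamma> t $ j))" by (rule arg_cong)
    moreover have "(1 / ?q) *\<^sub>R (?q *\<^sub>R v) = v" using q by simp
    moreover have "(1 / ?q) *\<^sub>R (- (\<gamma> t $ i - \<gamma> t $ j)) = (- 1 / ?q) *\<^sub>R (\<gamma> t $ i - \<gamma> t $ j)"
      by (simp only: scaleR_minus_right scaleR_minus_left[symmetric] minus_divide_left)
    ultimately have "v = (- 1 / ?q) *\<^sub>R (\<gamma> t $ i - \<gamma> t $ j)" by simp
    then have "v \<in> N" unfolding N_def using t ij by (intro UN_I[of "(i, j)"]) auto
    then show False using v(2) by simp
  qed
  have "norm ?w \<le> \<kappa> n * Kc"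
    using Kc(2)[OF v(1)] \<kappa>n by (simp add: mult_left_mono)
  also have "\<dots> < min rx ry" using small Kc(1) \<kappa>n by (simp add: pos_less_divide_eq)
  finally have w: "norm (x + ?w - x) < rx" "norm (y + ?w - y) < ry" by auto
  have "jm_dist m h (?\<gamma> a) (?\<gamma> b) \<le> lagrangian_action m h a b ?\<gamma>"
    using ab by (intro jm_dist_le_lagrangian_action m n h ftc' free) auto
  also have "\<dots> = ?K + (\<integral>\<^sup>+ t\<in>{a..b}. newton_potential m (\<gamma> t + ?w) \<partial>lborel)"
    using lagrangian_action_split[OF ftc', of m h] ab
    by (simp add: curve_action_def free_lagrangian_def velocity_add_const)
  also have "\<dots> \<le> ?K + (?I + ennreal (e/4))"
    using less gI[of ?w] by (intro add_left_mono) auto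
  also have "\<dots> \<le> action_potential m h x y + ennreal (e/4) + ennreal (e/4)"
    using KI by (simp add: add.assoc[symmetric] add_right_mono)
  finally have mid: "jm_dist m h (x + ?w) (y + ?w) \<le> action_potential m h x y + ennreal (e/4) + ennreal (e/4)"
    by (simp add: ends)
  have "jm_dist m h x y \<le> jm_dist m h x (x + ?w) + (jm_dist m h (x + ?w) (y + ?w) + jm_dist m h (y + ?w) y)"
    by (rule order_trans[OF jm_dist_triangle add_left_mono[OF jm_dist_triangle]])
  also have "\<dots> \<le> ennreal (e/4) + ((action_potential m h x y + ennreal (e/4) + ennreal (e/4)) + ennreal (e/4))"
    using rx(2)[OF w(1)] ry(2)[OF w(2)] mid by (intro add_mono) auto
  also have "\<dots> = action_potential m h x y + (ennreal (e/4) + ennreal (e/4) + ennreal (e/4) + ennreal (e/4))"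
    by (simp add: ac_simps)
  also have "ennreal (e/4) + ennreal (e/4) + ennreal (e/4) + ennreal (e/4) = ennreal e"
    using e by (simp add: ennreal_plus[symmetric] del: ennreal_plus)
  finally show "jm_dist m h x y \<le> action_potential m h x y + ennreal e" .
qed

section \<open>Leaving a collision with little action\<close>

lemma cube_increment_le:
  fixes q r l :: real
  assumes "0 \<le> r" "r \<le> q" "0 < l"
  shows "q ^ 3 - r ^ 3 \<le> l * (q ^ 2 - r ^ 2) + (q ^ 4 - r ^ 4) / l"
proof -
  define p where "p = q + r"
  have p: "0 \<le> p" using assms by (simp add: p_def)
  have Q: "p\<^sup>2 / 2 \<le> q\<^sup>2 + r\<^sup>2"
    using sum_squares_bound[of q r] by (simp add: p_def power2_eq_square algebra_simps)
  have "l * (q\<^sup>2 + q * r + r\<^sup>2) \<le> l * p\<^sup>2"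
    using assms by (intro mult_left_mono) (auto simp: p_def power2_eq_square algebra_simps)
  also have "\<dots> \<le> p * (l\<^sup>2 + p\<^sup>2 / 2)"
  proof -
    have "0 \<le> p * ((l - p / 2)\<^sup>2 + p\<^sup>2 / 4)" using p by simp
    also have "\<dots> = p * (l\<^sup>2 + p\<^sup>2 / 2) - l * p\<^sup>2"
      by (simp add: power2_eq_square field_simps)
    finally show ?thesis by simp
  qed
  also have "\<dots> \<le> p * (l\<^sup>2 + (q\<^sup>2 + r\<^sup>2))" using Q p by (intro mult_left_mono) auto
  finally have br: "0 \<le> p * (l\<^sup>2 + (q\<^sup>2 + r\<^sup>2)) - l * (q\<^sup>2 + q * r + r\<^sup>2)" by simp
  have "0 \<le> (q - r) * (p * (l\<^sup>2 + (q\<^sup>2 + r\<^sup>2)) - l * (q\<^sup>2 + q * r + r\<^sup>2))"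
    using br assms by (intro mult_nonneg_nonneg) auto
  also have "\<dots> = l * (l * (q ^ 2 - r ^ 2) - (q ^ 3 - r ^ 3)) + (q ^ 4 - r ^ 4)"
    by (simp add: p_def power2_eq_square power3_eq_cube power4_eq_xxxx algebra_simps)
  finally have "l * (q ^ 3 - r ^ 3) \<le> l * (l * (q ^ 2 - r ^ 2)) + (q ^ 4 - r ^ 4)"
    unfolding right_diff_distrib[of l] by linarith
  moreover have "l * (l * (q ^ 2 - r ^ 2) + (q ^ 4 - r ^ 4) / l) = l * (l * (q ^ 2 - r ^ 2)) + (q ^ 4 - r ^ 4)"
    using assms(3) by (simp add: distrib_left)
  ultimately have "l * (q ^ 3 - r ^ 3) \<le> l * (l * (q ^ 2 - r ^ 2) + (q ^ 4 - r ^ 4) / l)" by simp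
  then show ?thesis using assms(3) by (simp only: mult_le_cancel_left_pos)
qed

text \<open>
  The first term on the right sums to at most \<open>l * sqrt T\<close> over disjoint intervals in \<open>{0..T}\<close>, the
  second one is small with the total length. In terms of \<open>q = t powr (1/4)\<close> and \<open>r = s powr (1/4)\<close> the
  claim is \<open>cube_increment_le\<close>.
\<close>

lemma powr_three_quarters_increment_le:
  fixes s t l :: real
  assumes "0 \<le> s" "s \<le> t" "0 < l"
  shows "t powr (3/4) - s powr (3/4) \<le> l * (sqrt t - sqrt s) + (t - s) / l"
proof -
  have e: "(u powr (1/4)) ^ 3 = u powr (3/4) \<and> (u powr (1/4)) ^ 2 = sqrt u \<and> (u powr (1/4)) ^ 4 = u"
    if "0 \<le> u" for u :: real
    using that by (cases "u = 0") (simp_all add: powr_power powr_half_sqrt)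
  have "s powr (1/4) \<le> t powr (1/4)" using assms by (intro powr_mono2) auto
  from cube_increment_le[OF _ this assms(3)] show ?thesis
    using assms by (simp add: e)
qed

lemma absolutely_continuous_curve_powr:
  assumes T: "0 \<le> T"
  shows "absolutely_continuous_curve 0 T (\<lambda>t. t powr (3/4) :: real)"
proof (rule absolutely_continuous_curveI)
  fix e :: real assume e: "e > 0"
  define l where "l = e / (2 * (sqrt T + 1))"
  have sT: "0 \<le> sqrt T" using T by simp
  have l: "l > 0" unfolding l_def using e sT by (intro divide_pos_pos mult_pos_pos add_nonneg_pos) auto
  have lT: "l * sqrt T \<le> e / 2"
  proof -
    have "l * sqrt T \<le> l * (sqrt T + 1)" using l by simp
    also have "\<dots> = e / 2"
    proof -
      have "2 * sqrt T + 2 \<noteq> 0" using sT by linarith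
      then show ?thesis by (simp add: l_def field_simps)
    qed
    finally show ?thesis .
  qed
  have "(\<Sum>(s, t)\<in>I. norm (t powr (3/4) - s powr (3/4))) < e"
    if I: "finite I" "\<forall>(s, t)\<in>I. 0 \<le> s \<and> s \<le> t \<and> t \<le> T"
       "disjoint_family_on (\<lambda>(s, t). {s<..<t}) I" "(\<Sum>(s, t)\<in>I. t - s) < l * (e / 2)" for I :: "(real \<times> real) set"
  proof -
    have "(\<Sum>(s, t)\<in>I. norm (t powr (3/4) - s powr (3/4))) \<le> (\<Sum>(s, t)\<in>I. l * (sqrt t - sqrt s) + (t - s) / l)"
    proof (rule sum_mono, clarify)
      fix s t assume "(s, t) \<in> I"
      then have st: "0 \<le> s" "s \<le> t" using I(2) by auto
      then have "s powr (3/4) \<le> t powr (3/4)" by (intro powr_mono2) auto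
      then show "norm (t powr (3/4) - s powr (3/4)) \<le> l * (sqrt t - sqrt s) + (t - s) / l"
        using powr_three_quarters_increment_le[OF st l] by simp
    qed
    also have "\<dots> = l * (\<Sum>(s, t)\<in>I. sqrt t - sqrt s) + (\<Sum>(s, t)\<in>I. t - s) / l"
      by (simp add: split_beta sum.distrib sum_distrib_left sum_divide_distrib)
    also have "(\<Sum>(s, t)\<in>I. sqrt t - sqrt s) \<le> sqrt T - sqrt 0"
      using I T by (intro sum_increments_le) (auto simp: mono_on_def)
    also have "l * (sqrt T - sqrt 0) \<le> e / 2" using lT by simp
    also have "(\<Sum>(s, t)\<in>I. t - s) / l < e / 2" using I(4) l by (simp add: pos_divide_less_eq mult.commute)
    finally show ?thesis using l by (simp add: mult_left_mono)
  qed
  then show "\<exists>\<delta>>0. \<forall>I. interval_family 0 T I \<and> total_length I < \<delta> \<longrightarrow> total_increment (\<lambda>t. t powr (3/4)) I < e"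
    using l e by (intro exI[of _ "l * (e / 2)"]) auto
qed

text \<open>
  The size of the shift along a curve that runs from time \<open>0\<close> to \<open>T\<close>. The exponent is chosen
  such that both the square of the derivative and the inverse are integrable; every exponent strictly between \<open>1/2\<close> and \<open>1\<close>
  would do.
\<close>

definition bump :: "real \<Rightarrow> real \<Rightarrow> real"
  where "bump T t = (if t \<le> T / 2 then t powr (3/4) else (T - t) powr (3/4))"

lemma absolutely_continuous_curve_bump:
  assumes T: "0 < T"
  shows "absolutely_continuous_curve 0 T (bump T)"
proof -
  have 1: "absolutely_continuous_curve 0 (T/2) (\<lambda>t. t powr (3/4) :: real)"
    using T by (intro absolutely_continuous_curve_powr) simp
  have "absolutely_continuous_curve (T/2) T (\<lambda>t. (T - t) powr (3/4))"
    by (rule absolutely_continuous_curve_compose_monotone[OF 1, of "T/2" T "\<lambda>t. T - t"]) auto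
  from absolutely_continuous_curve_join[OF 1 this] show ?thesis
    using T by (simp add: bump_def[abs_def])
qed

lemma bump_ends [simp]: "0 < T \<Longrightarrow> bump T 0 = 0" "0 < T \<Longrightarrow> bump T T = 0"
  by (simp_all add: bump_def)

lemma bump_has_derivative:
  assumes t: "t \<in> {0<..<T}" "t \<noteq> T / 2"
  obtains D where "(bump T has_real_derivative D) (at t)" "D\<^sup>2 \<le> 9/16 * (t powr (-1/2) + (T - t) powr (-1/2))"
proof -
  have sq: "(3/4 * u powr (-1/4))\<^sup>2 = 9/16 * u powr (-1/2)" if "u > 0" for u :: real
    using that by (simp add: power_mult_distrib powr_power power_divide)
  show ?thesis
  proof (cases "t < T / 2")
    case True
    have "((\<lambda>t. t powr (3/4)) has_real_derivative (3/4 * t powr (3/4 - 1))) (at t)"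
      using t by (intro has_real_derivative_powr) auto
    then have "(bump T has_real_derivative (3/4 * t powr (3/4 - 1))) (at t)"
      by (rule DERIV_cong_ev[THEN iffD1, rotated -1, OF _ refl _ refl])
        (use True in \<open>auto simp: bump_def intro!: eventually_mono[OF eventually_nhds_in_open[of "{..<T/2}"]]\<close>)
    moreover have "3/4 - 1 = (-1/4 :: real)" by simp
    ultimately show ?thesis using that sq[of t] t by simp
  next
    case False
    have "((\<lambda>t. (T - t) powr (3/4)) has_real_derivative (- (3/4 * (T - t) powr (3/4 - 1)))) (at t)"
      using t by (auto intro!: derivative_eq_intros simp: powr_diff)
    then have "(bump T has_real_derivative (- (3/4 * (T - t) powr (3/4 - 1)))) (at t)"
      by (rule DERIV_cong_ev[THEN iffD1, rotated -1, OF _ refl _ refl])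
        (use False t in \<open>auto simp: bump_def intro!: eventually_mono[OF eventually_nhds_in_open[of "{T/2<..}"]]\<close>)
    moreover have "3/4 - 1 = (-1/4 :: real)" by simp
    ultimately show ?thesis using that sq[of "T - t"] t by simp
  qed
qed

lemma inverse_bump_le:
  assumes "t \<in> {0<..<T}"
  shows "0 < bump T t" "1 / bump T t \<le> t powr (-3/4) + (T - t) powr (-3/4)"
  using assms by (auto simp: bump_def powr_minus_divide)

lemma has_integral_powr_both_ends:
  fixes p :: real
  assumes p: "p > -1" and T: "T \<ge> 0"
  shows "((\<lambda>t. t powr p + (T - t) powr p) has_integral 2 * (T powr (p + 1) / (p + 1))) {0..T}"
proof -
  have 1: "((\<lambda>t. t powr p) has_integral T powr (p + 1) / (p + 1)) {0..T}"
    by (rule has_integral_powr_from_0[OF p T])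
  have "((\<lambda>t. (T - t) powr p) has_integral (- ((T - T) powr (p + 1) / (p + 1)) - (- ((T - 0) powr (p + 1) / (p + 1))))) {0..T}"
  proof (rule fundamental_theorem_of_calculus_interior[OF T])
    show "continuous_on {0..T} (\<lambda>t. - ((T - t) powr (p + 1) / (p + 1)))"
      using p by (intro continuous_intros continuous_on_powr') auto
    fix t assume t: "t \<in> {0<..<T}"
    have "((\<lambda>u. u powr (p + 1)) has_real_derivative (p + 1) * (T - t) powr p) (at (T - t))"
      using has_real_derivative_powr[of "T - t" "p + 1"] t by simp
    moreover have "((\<lambda>t. T - t) has_real_derivative - 1) (at t)" by (auto intro!: derivative_eq_intros)
    ultimately have "((\<lambda>t. (T - t) powr (p + 1)) has_real_derivative (p + 1) * (T - t) powr p * (- 1)) (at t)"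
      by (rule DERIV_chain2)
    from DERIV_minus[OF DERIV_cdivide[OF this, of "p + 1"]]
    have "((\<lambda>t. - ((T - t) powr (p + 1) / (p + 1))) has_real_derivative (T - t) powr p) (at t)"
      using p by simp
    then show "((\<lambda>t. - ((T - t) powr (p + 1) / (p + 1))) has_vector_derivative (T - t) powr p) (at t)"
      by (simp add: has_real_derivative_iff_has_vector_derivative)
  qed
  from has_integral_add[OF 1 this] show ?thesis using p by simp
qed

lemma AE_interior_except_midpoint: "AE t in lborel. t \<in> {0..T} \<longrightarrow> t \<in> {0<..<T} \<and> t \<noteq> T / (2 :: real)"
proof -
  have "AE t in lborel. t \<noteq> 0 \<and> t \<noteq> T \<and> t \<noteq> T / 2"
    using AE_lborel_singleton[of "0 :: real"] AE_lborel_singleton[of T] AE_lborel_singleton[of "T / 2"]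
    by eventually_elim auto
  then show ?thesis by eventually_elim auto
qed

lemma bump_measurable: "bump T \<in> borel_measurable borel"
  unfolding bump_def[abs_def] by measurable

text \<open>
  The segment from \<open>x\<close> to \<open>y\<close>, run in time \<open>T\<close>, is shifted at time \<open>t\<close> by \<open>bump T t\<close> times the spread
  of a vector \<open>v\<close>. For a suitable \<open>v\<close> the integral of the potential is at most a constant times that of
  \<open>1 / bump T t\<close>, no matter where the segment meets collisions.
\<close>

lemma action_potential_upper_bound:
  fixes m :: "'n::{finite,linorder} \<Rightarrow> real"
  assumes dim: "DIM('e::euclidean_space) \<ge> 2" and m: "\<And>i. m i > 0" and h: "h \<ge> 0"
  obtains C where "C > 0" "\<And>(x :: ('e, 'n) vec) y T. T > 0 \<Longrightarrow>
    action_potential m h x y \<le> ennreal (C * ((norm (y - x))\<^sup>2 / T + T + sqrt T + T powr (1/4)))"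
proof -
  let ?\<beta> = "emeasure lborel (ball (0::'e) 1)"
  have \<beta>: "0 < ?\<beta>" "?\<beta> < \<infinity>"
    using unit_ball_vol_pos[of "real DIM('e)"] by (simp_all add: emeasure_ball)
  obtain c :: "'n \<Rightarrow> real" where c: "\<And>i j. i \<noteq> j \<Longrightarrow> 1 \<le> \<bar>c i - c j\<bar>" using exists_separated_weights by blast
  obtain K where K: "K > 0" "\<And>\<kappa> (x :: ('e, 'n) vec). \<kappa> > 0 \<Longrightarrow> spread_average m c \<kappa> x \<le> ennreal (K / \<kappa>) * ?\<beta>"
    using spread_average_le_inverse[where m = m and c = c, OF dim m c] by blast
  obtain KM where KM: "KM > 0" "\<And>v :: ('e, 'n) vec. norm (mass_scale m v) \<le> norm v * KM"
    using bounded_linear.pos_bounded[OF bounded_linear_mass_scale] by blast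
  obtain Kc where Kc: "Kc > 0" "\<And>v :: 'e. v \<in> ball 0 1 \<Longrightarrow> norm (spread c v :: ('e, 'n) vec) \<le> Kc"
    using spread_bounded by blast
  define Ks where "Ks = Kc * KM"
  have Ks: "norm (mass_scale m (spread c v :: ('e, 'n) vec)) \<le> Ks" if v: "v \<in> ball 0 1" for v :: 'e
    using order_trans[OF KM(2) mult_right_mono[OF Kc(2)[OF v]]] KM(1) by (simp add: Ks_def)
  define C where "C = KM\<^sup>2 + h + 1 + 9/4 * Ks\<^sup>2 + 8 * K"
  have C: "C > 0"
  proof -
    have "0 \<le> KM\<^sup>2" "0 \<le> 9/4 * Ks\<^sup>2" by auto
    then show ?thesis unfolding C_def using h K(1) by linarith
  qed
  have "action_potential m h x y \<le> ennreal (C * ((norm (y - x))\<^sup>2 / T + T + sqrt T + T powr (1/4)))"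
    if T: "T > 0" for x y :: "('e, 'n) vec" and T
  proof -
    define \<beta>' where "\<beta>' t = x + (t / T) *\<^sub>R (y - x)" for t
    have \<beta>'_meas: "\<beta>' \<in> borel_measurable borel"
      unfolding \<beta>'_def by (intro borel_measurable_continuous_onI continuous_intros)
        (use T in auto)
    define w where "w t = t powr (-3/4) + (T - t) powr (-3/4)" for t
    have w0: "0 \<le> w t" for t by (simp add: w_def)
    have w_int: "(w has_integral 8 * T powr (1/4)) {0..T}"
      using has_integral_powr_both_ends[of "-3/4" T] T by (simp add: w_def[abs_def])
    have w_nn: "(\<integral>\<^sup>+ t\<in>{0..T}. ennreal (w t) \<partial>lborel) = ennreal (8 * T powr (1/4))"
      using w0 by (intro nn_integral_has_integral_lebesgue' w_int)
    have w_meas: "w \<in> borel_measurable borel" unfolding w_def by measurable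
    have "(\<integral>\<^sup>+ t\<in>{0..T}. spread_average m c (bump T t) (\<beta>' t) \<partial>lborel)
       \<le> (\<integral>\<^sup>+ t. ennreal K * ?\<beta> * (ennreal (w t) * indicator {0..T} t) \<partial>lborel)"
    proof (rule nn_integral_mono_AE, use AE_interior_except_midpoint[of T] in eventually_elim)
      case (elim t)
      show ?case
      proof (cases "t \<in> {0..T}")
        case True
        then have t: "t \<in> {0<..<T}" using elim by simp
        have "spread_average m c (bump T t) (\<beta>' t) \<le> ennreal (K / bump T t) * ?\<beta>"
          by (rule K(2)[OF inverse_bump_le(1)[OF t]])
        also have "\<dots> \<le> ennreal (K * w t) * ?\<beta>"
          using mult_left_mono[OF inverse_bump_le(2)[OF t], of K] K(1)
          by (intro mult_right_mono ennreal_leI) (auto simp: w_def)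
        also have "\<dots> = ennreal K * ?\<beta> * ennreal (w t)"
          using K(1) w0[of t] by (simp add: ennreal_mult ac_simps)
        finally show ?thesis using True by simp
      qed simp
    qed
    also have "\<dots> = ennreal K * ?\<beta> * ennreal (8 * T powr (1/4))"
      using w_meas by (subst nn_integral_cmult)
        (auto simp: w_nn intro!: borel_measurable_times_ennreal borel_measurable_indicator)
    also have "\<dots> = ennreal (8 * K * T powr (1/4)) * ?\<beta>"
      using K(1) by (simp add: ennreal_mult ac_simps)
    also have "\<dots> < ennreal (8 * K * T powr (1/4) + T) * ?\<beta>"
      using \<beta> K(1) T by (intro ennreal_mult_strict_right_mono) (auto intro!: ennreal_lessI add_nonneg_pos)
    finally obtain v where v: "v \<in> ball 0 1"
      and pot: "(\<integral>\<^sup>+ t\<in>{0..T}. newton_potential m (\<beta>' t + bump T t *\<^sub>R spread c v) \<partial>lborel) < ennreal (8 * K * T powr (1/4) + T)"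
      using exists_good_spread[OF \<beta>'_meas bump_measurable negligible_empty] by blast
    let ?S = "spread c v :: ('e, 'n) vec"
    define f where "f t = \<beta>' t + bump T t *\<^sub>R ?S" for t
    have ac: "absolutely_continuous_curve 0 T f"
    proof (rule absolutely_continuous_curve_dominated[where f = \<beta>' and g = "\<lambda>t. bump T t *\<^sub>R ?S"])
      have "bounded_linear (\<lambda>r. r *\<^sub>R ?S)" by (rule bounded_linear_scaleR_left)
      from absolutely_continuous_curve_bounded_linear[OF absolutely_continuous_curve_bump[OF T] this]
      show "absolutely_continuous_curve 0 T (\<lambda>t. bump T t *\<^sub>R ?S)" .
      show "absolutely_continuous_curve 0 T \<beta>'"
        unfolding \<beta>'_def by (rule absolutely_continuous_curve_affine)
      fix s t
      have "f t - f s = (\<beta>' t - \<beta>' s) + (bump T t *\<^sub>R ?S - bump T s *\<^sub>R ?S)" by (simp add: f_def)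
      then show "norm (f t - f s) \<le> norm (\<beta>' t - \<beta>' s) + norm (bump T t *\<^sub>R ?S - bump T s *\<^sub>R ?S)"
        using norm_triangle_ineq by metis
    qed
    have ends: "f 0 = x" "f T = y" using T by (simp_all add: f_def \<beta>'_def)
    define A where "A = (norm (mass_scale m (y - x)))\<^sup>2"
    define B where "B t = A / T\<^sup>2 + h + 9/16 * Ks\<^sup>2 * (t powr (-1/2) + (T - t) powr (-1/2))" for t
    have B0: "0 \<le> B t" for t using h by (simp add: B_def A_def)
    have "(B has_integral (T - 0) *\<^sub>R (A / T\<^sup>2 + h) + 9/16 * Ks\<^sup>2 * (2 * (T powr (-1/2 + 1) / (-1/2 + 1)))) {0..T}"
      unfolding B_def
      by (intro has_integral_add has_integral_mult_right has_integral_powr_both_ends has_integral_const_real[THEN has_integral_eq_rhs])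
        (use T in auto)
    moreover have "(T - 0) *\<^sub>R (A / T\<^sup>2 + h) + 9/16 * Ks\<^sup>2 * (2 * (T powr (-1/2 + 1) / (-1/2 + 1))) = A / T + h * T + 9/4 * Ks\<^sup>2 * sqrt T"
      using T by (simp add: powr_half_sqrt field_simps power2_eq_square)
    ultimately have B_int: "(B has_integral A / T + h * T + 9/4 * Ks\<^sup>2 * sqrt T) {0..T}" by simp
    have "curve_action (free_lagrangian m h) 0 T f \<le> (\<integral>\<^sup>+ t\<in>{0..T}. ennreal (B t) \<partial>lborel)"
      unfolding curve_action_def nn_integral_completion
    proof (rule nn_integral_mono_AE, use AE_interior_except_midpoint[of T] in eventually_elim)
      case (elim t)
      show ?case
      proof (cases "t \<in> {0..T}")
        case True
        then have t: "t \<in> {0<..<T}" "t \<noteq> T / 2" using elim by auto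
        obtain D where D: "(bump T has_real_derivative D) (at t)" "D\<^sup>2 \<le> 9/16 * (t powr (-1/2) + (T - t) powr (-1/2))"
          using bump_has_derivative[OF t] by blast
        have "((\<lambda>t. bump T t *\<^sub>R ?S) has_vector_derivative D *\<^sub>R ?S) (at t)"
          using has_vector_derivative_scaleR[OF D(1) has_vector_derivative_const[of ?S]] by simp
        moreover have "(\<beta>' has_vector_derivative (1 / T) *\<^sub>R (y - x)) (at t)"
          unfolding \<beta>'_def using T by (auto intro!: derivative_eq_intros simp: divide_inverse)
        ultimately have "(f has_vector_derivative (1 / T) *\<^sub>R (y - x) + D *\<^sub>R ?S) (at t)"
          unfolding f_def by (rule has_vector_derivative_add[rotated])
        then have vel: "velocity 0 T f t = (1 / T) *\<^sub>R (y - x) + D *\<^sub>R ?S" by (rule velocity_eq_at[OF t(1)])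
        have "norm (mass_scale m (velocity 0 T f t)) \<le> sqrt A / T + \<bar>D\<bar> * Ks"
        proof -
          have "mass_scale m (velocity 0 T f t) = (1 / T) *\<^sub>R mass_scale m (y - x) + D *\<^sub>R mass_scale m ?S"
            unfolding vel by (simp add: linear_add[OF linear_mass_scale] linear_scale[OF linear_mass_scale])
          then have "norm (mass_scale m (velocity 0 T f t)) \<le> norm ((1 / T) *\<^sub>R mass_scale m (y - x)) + norm (D *\<^sub>R mass_scale m ?S)"
            using norm_triangle_ineq by metis
          also have "\<dots> \<le> sqrt A / T + \<bar>D\<bar> * Ks"
            using T Ks[OF v] by (auto simp: A_def intro!: mult_left_mono)
          finally show ?thesis .
        qed
        then have "(norm (mass_scale m (velocity 0 T f t)))\<^sup>2 \<le> (sqrt A / T + \<bar>D\<bar> * Ks)\<^sup>2" by (intro power_mono) auto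
        also have "\<dots> \<le> 2 * ((sqrt A / T)\<^sup>2 + (\<bar>D\<bar> * Ks)\<^sup>2)"
          using sum_squares_bound[of "sqrt A / T" "\<bar>D\<bar> * Ks"] by (simp add: power2_sum)
        also have "\<dots> = 2 * (A / T\<^sup>2 + D\<^sup>2 * Ks\<^sup>2)" by (simp add: power_divide power_mult_distrib A_def)
        also have "\<dots> \<le> 2 * (A / T\<^sup>2 + 9/16 * (t powr (-1/2) + (T - t) powr (-1/2)) * Ks\<^sup>2)"
          using D(2) by (intro mult_left_mono add_left_mono mult_right_mono) auto
        also have "\<dots> = 2 * (B t - h)" by (simp add: B_def algebra_simps)
        finally have "1/2 * (norm (mass_scale m (velocity 0 T f t)))\<^sup>2 + h \<le> B t" by simp
        then have "ennreal (1/2 * (norm (mass_scale m (velocity 0 T f t)))\<^sup>2 + h) \<le> ennreal (B t)" by (rule ennreal_leI)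
        then have "free_lagrangian m h (f t) (velocity 0 T f t) \<le> ennreal (B t)"
          using h by (simp add: free_lagrangian_def mass_norm_eq_norm_mass_scale[of m, OF m])
        then show ?thesis using True by simp
      qed simp
    qed
    also have "\<dots> = ennreal (A / T + h * T + 9/4 * Ks\<^sup>2 * sqrt T)"
      using B0 by (intro nn_integral_has_integral_lebesgue' B_int)
    finally have kin: "curve_action (free_lagrangian m h) 0 T f \<le> ennreal (A / T + h * T + 9/4 * Ks\<^sup>2 * sqrt T)" .
    have "action_potential m h x y \<le> lagrangian_action m h 0 T f"
      unfolding action_potential_eq lagrangian_action_eq using T ac ends by (intro curve_cost_le)
    also have "\<dots> = curve_action (free_lagrangian m h) 0 T f + (\<integral>\<^sup>+ t\<in>{0..T}. newton_potential m (f t) \<partial>lborel)"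
      using T by (intro lagrangian_action_split absolutely_continuous_curve_ftc ac) auto
    also have "\<dots> \<le> ennreal (A / T + h * T + 9/4 * Ks\<^sup>2 * sqrt T) + ennreal (8 * K * T powr (1/4) + T)"
      using kin pot unfolding f_def by (intro add_mono) auto
    also have "\<dots> = ennreal (A / T + h * T + 9/4 * Ks\<^sup>2 * sqrt T + (8 * K * T powr (1/4) + T))"
      using T h K(1) by (intro ennreal_plus[symmetric]) (auto simp: A_def intro!: add_nonneg_nonneg)
    also have "\<dots> \<le> ennreal (C * ((norm (y - x))\<^sup>2 / T + T + sqrt T + T powr (1/4)))"
    proof (rule ennreal_leI)
      define P where "P = (norm (y - x))\<^sup>2 / T"
      have P: "0 \<le> P" "A / T \<le> KM\<^sup>2 * P"
      proof -
        have "A \<le> (norm (y - x) * KM)\<^sup>2" unfolding A_def using KM(2)[of "y - x"] by (intro power_mono) auto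
        then show "A / T \<le> KM\<^sup>2 * P" using T by (simp add: P_def power_mult_distrib divide_right_mono mult.commute)
      qed (use T in \<open>simp add: P_def\<close>)
      have q: "0 \<le> sqrt T" "0 \<le> T powr (1/4)" "0 \<le> KM\<^sup>2" "0 \<le> Ks\<^sup>2" using T by auto
      have "KM\<^sup>2 * P \<le> C * P" "(h + 1) * T \<le> C * T" "9/4 * Ks\<^sup>2 * sqrt T \<le> C * sqrt T" "8 * K * T powr (1/4) \<le> C * T powr (1/4)"
        using P q T h K(1) unfolding C_def by (auto intro!: mult_right_mono)
      then show "A / T + h * T + 9/4 * Ks\<^sup>2 * sqrt T + (8 * K * T powr (1/4) + T)
          \<le> C * ((norm (y - x))\<^sup>2 / T + T + sqrt T + T powr (1/4))"
        using P(2) unfolding P_def[symmetric] by (simp add: distrib_left distrib_right)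
    qed
    finally show ?thesis .
  qed
  then show ?thesis using that C by blast
qed

section \<open>Upper and lower bounds for the action potential\<close>

lemma action_potential_small_nearby:
  fixes m :: "'n::{finite,linorder} \<Rightarrow> real" and x :: "('e::euclidean_space, 'n) vec"
  assumes dim: "DIM('e) \<ge> 2" and m: "\<And>i. m i > 0" and h: "h \<ge> 0" and e: "e > 0"
  obtains r where "r > 0" "\<And>y. norm (y - x) < r \<Longrightarrow> action_potential m h x y < ennreal e"
proof -
  obtain C where C: "C > 0" "\<And>(x :: ('e, 'n) vec) y T. T > 0 \<Longrightarrow>
    action_potential m h x y \<le> ennreal (C * ((norm (y - x))\<^sup>2 / T + T + sqrt T + T powr (1/4)))"
    using action_potential_upper_bound[of m, OF dim m h] by blast
  define s where "s = min 1 (e / (8 * C))"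
  have s: "0 < s" "s \<le> 1" "8 * C * s \<le> e" using e C(1) by (auto simp: s_def min_def field_simps)
  \<comment> \<open>With this choice each of the four terms of the upper bound is at most \<open>s\<close>.\<close>
  define T where "T = s ^ 4"
  have T: "T > 0" "sqrt T = s ^ 2" "T powr (1/4) = s"
  proof -
    show "T > 0" using s by (simp add: T_def)
    show "sqrt T = s ^ 2" by (rule real_sqrt_unique) (simp_all add: T_def power_mult[symmetric])
    have "T = s powr 4" using powr_realpow[OF s(1), of 4] by (simp add: T_def)
    then have "T powr (1/4) = s powr (4 * (1/4))" by (simp only: powr_powr)
    then show "T powr (1/4) = s" using s by simp
  qed
  have Ts: "T \<le> s" "s ^ 2 \<le> s"
  proof -
    show "T \<le> s" unfolding T_def using power_decreasing[of 1 4 s] s by simp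
    show "s ^ 2 \<le> s" using power_decreasing[of 1 2 s] s by simp
  qed
  have "action_potential m h x y < ennreal e" if y: "norm (y - x) < sqrt (T * s)" for y
  proof -
    have "(norm (y - x))\<^sup>2 \<le> (sqrt (T * s))\<^sup>2" using y by (intro power_mono) auto
    then have "(norm (y - x))\<^sup>2 / T \<le> s" using T(1) s(1) by (simp add: field_simps)
    then have "C * ((norm (y - x))\<^sup>2 / T + T + sqrt T + T powr (1/4)) \<le> C * (4 * s)"
      using Ts C(1) unfolding T(2,3) by (intro mult_left_mono) auto
    also have "\<dots> < e" using s e by simp
    finally have "ennreal (C * ((norm (y - x))\<^sup>2 / T + T + sqrt T + T powr (1/4))) < ennreal e"
      using e by (intro ennreal_lessI)
    then show ?thesis using C(2)[OF T(1), of x y] by (rule le_less_trans[rotated])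
  qed
  moreover have "0 < sqrt (T * s)" using T(1) s(1) by simp
  ultimately show ?thesis using that by blast
qed

lemma action_potential_finite:
  fixes m :: "'n::{finite,linorder} \<Rightarrow> real" and x y :: "('e::euclidean_space, 'n) vec"
  assumes dim: "DIM('e) \<ge> 2" and m: "\<And>i. m i > 0" and h: "h \<ge> 0"
  shows "action_potential m h x y < \<infinity>"
proof -
  obtain C where "C > 0" and C: "\<And>(x :: ('e, 'n) vec) y T. T > 0 \<Longrightarrow>
    action_potential m h x y \<le> ennreal (C * ((norm (y - x))\<^sup>2 / T + T + sqrt T + T powr (1/4)))"
    using action_potential_upper_bound[of m, OF dim m h] by blast
  show ?thesis by (rule le_less_trans[OF C[of 1]]) simp_all
qed

text \<open>
  Let \<open>M\<close> be the largest distance of the curve from its start. Within the ball of radius \<open>norm x + M\<close> the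
  integrand is at least a constant times the speed divided by the square root of that radius, and
  the curve covers the distance \<open>M\<close>. As \<open>M / sqrt (norm x + M)\<close> increases with \<open>M\<close>, the distance of the two
  ends may replace \<open>M\<close>.
\<close>

lemma action_potential_lower_bound:
  fixes m :: "'n::{finite,linorder} \<Rightarrow> real"
  assumes m: "\<And>i. m i > 0" and n: "CARD('n) \<ge> 2" and h: "h \<ge> 0"
  obtains k where "k > 0" "\<And>x y :: ('e::euclidean_space, 'n) vec.
    ennreal (k * norm (y - x) / sqrt (norm x + norm (y - x))) \<le> action_potential m h x y"
proof -
  obtain c where c: "c > 0"
    "\<And>(x :: ('e, 'n) vec) R. norm x \<le> R \<Longrightarrow> 0 < R \<Longrightarrow> ennreal (c / R) \<le> newton_potential m x"
    using newton_potential_lower_bound[of m, OF m n] by blast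
  obtain B where B: "B > 0" "\<And>x :: ('e, 'n) vec. B * norm x \<le> norm (mass_scale m x)"
    using mass_scale_bounded_below[of m, OF m] by blast
  define k where "k = B * sqrt (2 * c)"
  have k: "k > 0" using B(1) c(1) by (simp add: k_def)
  have "ennreal (k * norm (y - x) / sqrt (norm x + norm (y - x))) \<le> action_potential m h x y"
    for x y :: "('e, 'n) vec"
    unfolding action_potential_eq curve_cost_def
  proof (rule Inf_greatest, clarify)
    fix a b \<gamma> assume ab: "a < b" and ac: "absolutely_continuous_curve a b \<gamma>" and xy: "x = \<gamma> a" "y = \<gamma> b"
    have ftc: "ftc_curve a b \<gamma>" by (rule absolutely_continuous_curve_ftc[OF ac])
    show "ennreal (k * norm (\<gamma> b - \<gamma> a) / sqrt (norm (\<gamma> a) + norm (\<gamma> b - \<gamma> a))) \<le> curve_action (lagrangian m h) a b \<gamma>"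
    proof (cases "\<gamma> b = \<gamma> a")
      case False
      define l where "l = norm (\<gamma> b - \<gamma> a)"
      have l: "l > 0" using False by (simp add: l_def)
      have "continuous_on {a..b} (\<lambda>t. norm (\<gamma> t - \<gamma> a))"
        using ftc unfolding ftc_curve_def by (intro continuous_intros) auto
      then obtain t0 where t0: "t0 \<in> {a..b}" "\<And>t. t \<in> {a..b} \<Longrightarrow> norm (\<gamma> t - \<gamma> a) \<le> norm (\<gamma> t0 - \<gamma> a)"
        using continuous_attains_sup[of "{a..b}" "\<lambda>t. norm (\<gamma> t - \<gamma> a)"] ab by auto
      define M where "M = norm (\<gamma> t0 - \<gamma> a)"
      have M: "l \<le> M" using t0(2)[of b] ab by (simp add: M_def l_def)
      define R where "R = norm (\<gamma> a) + M"
      have R: "R > 0" using M l by (simp add: R_def add_nonneg_pos)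
      define s where "s = sqrt (2 * c / R)"
      have s: "s > 0" "s\<^sup>2 = 2 * c / R" using c(1) R by (auto simp: s_def)
      have speed: "ennreal s * ennreal (norm (mass_scale m (velocity a b \<gamma> t))) \<le> lagrangian m h (\<gamma> t) (velocity a b \<gamma> t)"
        if t: "t \<in> {a..b}" for t
      proof -
        have "norm (\<gamma> t) \<le> R"
          using norm_triangle_sub[of "\<gamma> t" "\<gamma> a"] t0(2)[OF t] by (simp add: R_def M_def)
        then have pot: "ennreal (c / R) \<le> newton_potential m (\<gamma> t)" using R by (rule c(2))
        let ?W = "norm (mass_scale m (velocity a b \<gamma> t))"
        have "s * ?W \<le> 1/2 * ?W\<^sup>2 + c / R"
          using sum_squares_bound[of s ?W] by (simp add: s(2))
        then have "ennreal (s * ?W) \<le> ennreal (1/2 * ?W\<^sup>2 + c / R)" by (rule ennreal_leI)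
        also have "\<dots> = ennreal (1/2 * ?W\<^sup>2) + ennreal (c / R)"
          using c(1) R by (intro ennreal_plus) auto
        also have "\<dots> \<le> ennreal (1/2 * ?W\<^sup>2) + newton_potential m (\<gamma> t) + ennreal h"
        proof -
          have "ennreal (c / R) \<le> newton_potential m (\<gamma> t) + ennreal h" using pot by (rule order_trans) simp
          then show ?thesis by (simp add: add.assoc add_left_mono)
        qed
        also have "\<dots> = lagrangian m h (\<gamma> t) (velocity a b \<gamma> t)"
          by (simp add: lagrangian_def mass_norm_eq_norm_mass_scale[of m, OF m])
        finally show ?thesis using s(1) by (simp add: ennreal_mult)
      qed
      have W_meas: "(\<lambda>t. ennreal (norm (mass_scale m (velocity a b \<gamma> t))) * indicator {a..t0} t) \<in> borel_measurable lebesgue"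
      proof -
        have "(\<lambda>(x :: ('e, 'n) vec, v). ennreal (norm (mass_scale m v))) \<in> borel_measurable borel"
          unfolding split_beta
          by (intro measurable_compose[OF borel_measurable_continuous_onI measurable_ennreal] continuous_intros
              bounded_linear.continuous_on[OF bounded_linear_mass_scale])
        from curve_action_integrand_measurable[OF ftc less_imp_le[OF ab] this]
        have "(\<lambda>t. ennreal (norm (mass_scale m (velocity a b \<gamma> t))) * indicator {a..b} t * indicator {a..t0} t) \<in> borel_measurable lebesgue"
          by (rule borel_measurable_times_ennreal) (rule borel_measurable_indicator, simp)
        also have "(\<lambda>t. ennreal (norm (mass_scale m (velocity a b \<gamma> t))) * indicator {a..b} t * indicator {a..t0} t)
          = (\<lambda>t. ennreal (norm (mass_scale m (velocity a b \<gamma> t))) * indicator {a..t0} t)"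
          using t0(1) by (auto simp: indicator_def)
        finally show ?thesis .
      qed
      have "ennreal (k * l / sqrt (norm (\<gamma> a) + l)) \<le> ennreal (s * (B * M))"
      proof (rule ennreal_leI)
        have "l * sqrt R \<le> M * sqrt (norm (\<gamma> a) + l)"
        proof (rule power2_le_imp_le)
          have "l\<^sup>2 * norm (\<gamma> a) \<le> M\<^sup>2 * norm (\<gamma> a)" using M l by (intro mult_right_mono power_mono) auto
          moreover have "l * M * l \<le> l * M * M" using M l by (intro mult_left_mono) auto
          ultimately have "l\<^sup>2 * R \<le> M\<^sup>2 * (norm (\<gamma> a) + l)" by (simp add: R_def power2_eq_square algebra_simps)
          then show "(l * sqrt R)\<^sup>2 \<le> (M * sqrt (norm (\<gamma> a) + l))\<^sup>2"
            using R l by (simp add: power_mult_distrib)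
        qed (use M l in auto)
        moreover have "0 < sqrt R" "0 < sqrt (norm (\<gamma> a) + l)" using R l by (auto intro: add_nonneg_pos)
        ultimately have "l / sqrt (norm (\<gamma> a) + l) \<le> M / sqrt R" by (simp add: field_simps)
        then have "k * (l / sqrt (norm (\<gamma> a) + l)) \<le> k * (M / sqrt R)" using k by (intro mult_left_mono) auto
        also have "\<dots> = s * (B * M)" by (simp add: k_def s_def real_sqrt_divide)
        finally show "k * l / sqrt (norm (\<gamma> a) + l) \<le> s * (B * M)" by simp
      qed
      also have "\<dots> \<le> ennreal (s * norm (mass_scale m (\<gamma> t0 - \<gamma> a)))"
        using s(1) B(2)[of "\<gamma> t0 - \<gamma> a"] by (intro ennreal_leI mult_left_mono) (auto simp: M_def)
      also have "\<dots> = ennreal s * ennreal (norm (mass_scale m (\<gamma> t0 - \<gamma> a)))"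
        using s(1) by (intro ennreal_mult) auto
      also have "\<dots> \<le> ennreal s * (\<integral>\<^sup>+ t\<in>{a..t0}. ennreal (norm (mass_scale m (velocity a b \<gamma> t))) \<partial>lebesgue)"
        using t0(1) by (intro mult_left_mono ftc_curve_norm_increment_le[OF ftc] bounded_linear_mass_scale) auto
      also have "\<dots> = (\<integral>\<^sup>+ t. ennreal s * (ennreal (norm (mass_scale m (velocity a b \<gamma> t))) * indicator {a..t0} t) \<partial>lebesgue)"
        by (rule nn_integral_cmult[symmetric, OF W_meas])
      also have "\<dots> \<le> curve_action (lagrangian m h) a b \<gamma>"
        unfolding curve_action_def
      proof (rule nn_integral_mono)
        fix t :: real
        show "ennreal s * (ennreal (norm (mass_scale m (velocity a b \<gamma> t))) * indicator {a..t0} t)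
          \<le> lagrangian m h (\<gamma> t) (velocity a b \<gamma> t) * indicator {a..b} t"
        proof (cases "t \<in> {a..t0}")
          case True
          then have "t \<in> {a..b}" using t0(1) by auto
          then show ?thesis using speed[of t] True by simp
        qed simp
      qed
      finally show ?thesis by (simp add: l_def)
    qed simp
  qed
  then show ?thesis using that k by blast
qed

text \<open>
  Moving along the spread of a single vector, each pair of bodies meets for at most one value of the parameter.
\<close>

lemma collision_free_dense:
  fixes m :: "'n::{finite,linorder} \<Rightarrow> real" and x :: "('e::euclidean_space, 'n) vec"
  assumes m: "\<And>i. m i > 0" and r: "r > 0"
  obtains y where "y \<in> collision_free m" "norm (y - x) < r"
proof -
  obtain c :: "'n \<Rightarrow> real" where c: "\<And>i j. i \<noteq> j \<Longrightarrow> 1 \<le> \<bar>c i - c j\<bar>" using exists_separated_weights by blast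
  obtain v :: 'e where v: "v \<in> Basis" using nonempty_Basis by blast
  define w where "w = (spread c v :: ('e, 'n) vec)"
  define bad where "bad = (\<lambda>(i, j). - ((x $ i - x $ j) \<bullet> v) / (c i - c j)) ` {(i, j). i < j}"
  have "finite bad" unfolding bad_def by (intro finite_imageI) (simp add: finite_subset[OF subset_UNIV])
  moreover have "infinite {0<..<r / (norm w + 1)}" using r by (intro infinite_Ioo) (auto intro!: divide_pos_pos add_nonneg_pos)
  ultimately obtain \<kappa> where \<kappa>: "\<kappa> \<in> {0<..<r / (norm w + 1)}" "\<kappa> \<notin> bad" by (meson finite_subset subsetI)
  show ?thesis
  proof (rule that[of "x + \<kappa> *\<^sub>R w"])
    show "x + \<kappa> *\<^sub>R w \<in> collision_free m"
    proof (clarsimp simp: collision_free_iff[of m, OF m])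
      fix i j :: 'n assume ij: "i < j" and eq: "x $ i + \<kappa> *\<^sub>R w $ i = x $ j + \<kappa> *\<^sub>R w $ j"
      have nz: "c i - c j \<noteq> 0" using c[OF less_imp_neq[OF ij]] by auto
      have "(x $ i - x $ j) + (\<kappa> * (c i - c j)) *\<^sub>R v = 0" using eq by (simp add: w_def spread_def algebra_simps)
      then have "((x $ i - x $ j) + (\<kappa> * (c i - c j)) *\<^sub>R v) \<bullet> v = 0" by simp
      then have "(x $ i - x $ j) \<bullet> v + \<kappa> * (c i - c j) = 0" using v by (simp add: inner_add_left)
      then have "\<kappa> * (c i - c j) = - ((x $ i - x $ j) \<bullet> v)" by linarith
      moreover have "\<kappa> = \<kappa> * (c i - c j) / (c i - c j)" using nz by simp
      ultimately have "\<kappa> = - ((x $ i - x $ j) \<bullet> v) / (c i - c j)" by (simp only:)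
      then have "\<kappa> \<in> bad" unfolding bad_def using ij by (intro image_eqI[of _ _ "(i, j)"]) auto
      then show False using \<kappa>(2) by simp
    qed
    have "norm (x + \<kappa> *\<^sub>R w - x) \<le> \<kappa> * (norm w + 1)" using \<kappa>(1) by (simp add: mult_left_mono)
    also have "\<dots> < r" using \<kappa>(1) by (simp add: pos_less_divide_eq add_nonneg_pos)
    finally show "norm (x + \<kappa> *\<^sub>R w - x) < r" .
  qed
qed

lemma jm_dist_eq_action_potential:
  fixes m :: "'n::{finite,linorder} \<Rightarrow> real" and x y :: "('e::euclidean_space, 'n) vec"
  assumes "DIM('e) \<ge> 2" "CARD('n) \<ge> 2" "\<And>i. m i > 0" "h \<ge> 0"
    and "x \<in> collision_free m" "y \<in> collision_free m"
  shows "jm_dist m h x y = action_potential m h x y"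
  using assms by (intro antisym jm_dist_le_action_potential action_potential_le_jm_dist)

section \<open>The completion\<close>

text \<open>
  No admissible curve ends at a collision, so the infimum is over the empty set.
\<close>

lemma jm_dist_outside:
  assumes "x \<notin> collision_free m \<or> y \<notin> collision_free m"
  shows "jm_dist m h x y = \<infinity>"
proof -
  have "\<not> (a < b \<and> jm_curve m a b \<gamma> \<and> \<gamma> a = x \<and> \<gamma> b = y)" for a b \<gamma>
    using assms by (auto simp: jm_curve_def image_subset_iff)
  then have "{curve_action (jm_speed m h) a b \<gamma> | a b \<gamma>. a < b \<and> jm_curve m a b \<gamma> \<and> \<gamma> a = x \<and> \<gamma> b = y} = {}" by blast
  then show ?thesis unfolding jm_dist_eq curve_cost_def by (simp only: Inf_empty infinity_ennreal_def top_ennreal_def)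
qed

lemma Metric_space_action_potential:
  fixes m :: "'n::{finite,linorder} \<Rightarrow> real" and h :: real
  assumes dim: "DIM('e::euclidean_space) \<ge> 2" and n: "CARD('n) \<ge> 2" and m: "\<And>i. m i > 0" and h: "h \<ge> 0"
  shows "Metric_space (UNIV :: ('e, 'n) vec set) (\<lambda>x y. enn2real (action_potential m h x y))"
proof
  fix x y z :: "('e, 'n) vec"
  note fin = action_potential_finite[of m, OF dim m h]
  show "0 \<le> enn2real (action_potential m h x y)" by simp
  show "enn2real (action_potential m h x y) = enn2real (action_potential m h y x)"
    by (simp add: action_potential_commute)
  have "action_potential m h x z \<le> action_potential m h x y + action_potential m h y z"
    by (rule action_potential_triangle)
  then show "enn2real (action_potential m h x z) \<le> enn2real (action_potential m h x y) + enn2real (action_potential m h y z)"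
    using fin[of x y] fin[of y z] by (subst enn2real_plus[symmetric]) (auto intro!: enn2real_mono simp: less_top)
  show "enn2real (action_potential m h x y) = 0 \<longleftrightarrow> x = y"
  proof
    assume "enn2real (action_potential m h x y) = 0"
    then have 0: "action_potential m h x y = 0" using fin[of x y] by (auto simp: enn2real_eq_0_iff)
    obtain k where k: "k > 0" "\<And>x y :: ('e, 'n) vec.
        ennreal (k * norm (y - x) / sqrt (norm x + norm (y - x))) \<le> action_potential m h x y"
      using action_potential_lower_bound[of m, OF m n h] by blast
    have "k * norm (y - x) / sqrt (norm x + norm (y - x)) \<le> 0"
      using k(2)[of y x] 0 by (simp add: ennreal_eq_0_iff)
    show "x = y"
    proof (rule ccontr)
      assume "x \<noteq> y"
      then have "0 < norm (y - x)" by simp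
      then have "0 < k * norm (y - x) / sqrt (norm x + norm (y - x))"
        using k(1) by (intro divide_pos_pos mult_pos_pos) (auto intro: add_nonneg_pos)
      then show False using \<open>_ \<le> 0\<close> by simp
    qed
  next
    assume "x = y"
    have "action_potential m h x x \<le> 0"
    proof (rule ennreal_le_epsilon)
      fix e :: real assume "0 < e"
      from action_potential_small_nearby[of m, OF dim m h this, of x]
      obtain r where "r > 0" "\<And>y. norm (y - x) < r \<Longrightarrow> action_potential m h x y < ennreal e" by blast
      from this(2)[of x] this(1) show "action_potential m h x x \<le> 0 + ennreal e" by simp
    qed
    then show "enn2real (action_potential m h x y) = 0" using \<open>x = y\<close> by simp
  qed
qed

text \<open>
  The lower bound is weak far from the origin, so a Cauchy sequence is first shown to be bounded in norm;
  on a bounded set the bound is proportional to the distance.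
\<close>

lemma action_potential_mcomplete:
  fixes m :: "'n::{finite,linorder} \<Rightarrow> real" and h :: real
  assumes dim: "DIM('e::euclidean_space) \<ge> 2" and n: "CARD('n) \<ge> 2" and m: "\<And>i. m i > 0" and h: "h \<ge> 0"
  shows "Metric_space.mcomplete (UNIV :: ('e, 'n) vec set) (\<lambda>x y. enn2real (action_potential m h x y))"
proof -
  let ?d = "\<lambda>x y :: ('e, 'n) vec. enn2real (action_potential m h x y)"
  interpret Metric_space UNIV ?d by (rule Metric_space_action_potential[of m, OF dim n m h])
  have fin: "action_potential m h x y = ennreal (?d x y)" for x y
    using action_potential_finite[of m, OF dim m h, of x y] by (simp add: less_top)
  obtain k where k: "k > 0" "\<And>x y :: ('e, 'n) vec.
      ennreal (k * norm (y - x) / sqrt (norm x + norm (y - x))) \<le> action_potential m h x y"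
    using action_potential_lower_bound[of m, OF m n h] by blast
  have kd: "k * norm (y - x) \<le> ?d x y * sqrt (norm x + norm (y - x))" for x y
  proof (cases "x = y")
    case False
    then have "0 < sqrt (norm x + norm (y - x))" by (auto intro: add_nonneg_pos)
    moreover have "k * norm (y - x) / sqrt (norm x + norm (y - x)) \<le> ?d x y"
      using ord_le_eq_trans[OF k(2)[of y x] fin[of x y]] ennreal_le_iff[OF enn2real_nonneg] by blast
    ultimately show ?thesis by (simp add: pos_divide_le_eq)
  qed simp
  show ?thesis
    unfolding mcomplete_def
  proof (intro allI impI)
    fix \<sigma> assume \<sigma>: "MCauchy \<sigma>"
    have cau: "\<exists>N. \<forall>i j. N \<le> i \<longrightarrow> N \<le> j \<longrightarrow> ?d (\<sigma> i) (\<sigma> j) < e" if "e > 0" for e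
      using \<sigma> that unfolding MCauchy_def by blast
    obtain N1 where N1: "\<And>i j. N1 \<le> i \<Longrightarrow> N1 \<le> j \<Longrightarrow> ?d (\<sigma> i) (\<sigma> j) < 1" using cau[of 1] by auto
    define x0 where "x0 = \<sigma> N1"
    \<comment> \<open>If \<open>l \<ge> 1\<close> then \<open>(k * l)\<^sup>2 \<le> norm x0 + l \<le> (norm x0 + 1) * l\<close>.\<close>
    define Q where "Q = max 1 ((norm x0 + 1) / k\<^sup>2)"
    have bd: "norm (\<sigma> i - x0) \<le> Q" if i: "N1 \<le> i" for i
    proof (cases "norm (\<sigma> i - x0) \<le> 1")
      case False
      define l where "l = norm (\<sigma> i - x0)"
      have l: "1 < l" using False by (simp add: l_def)
      have "k * l \<le> ?d x0 (\<sigma> i) * sqrt (norm x0 + l)" using kd[of "\<sigma> i" x0] by (simp add: l_def)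
      also have "\<dots> \<le> 1 * sqrt (norm x0 + l)"
        using N1[of N1 i] i l by (intro mult_right_mono) (auto simp: x0_def intro: less_imp_le)
      finally have "(k * l)\<^sup>2 \<le> (sqrt (norm x0 + l))\<^sup>2" using k(1) l by (intro power_mono) auto
      then have "k\<^sup>2 * (l * l) \<le> norm x0 + l" using l by (simp add: power2_eq_square mult_ac)
      also have "\<dots> \<le> (norm x0 + 1) * l" using l mult_left_mono[of 1 l "norm x0"] by (simp add: algebra_simps)
      finally have "(k\<^sup>2 * l) * l \<le> (norm x0 + 1) * l" by (simp add: ac_simps)
      then have "k\<^sup>2 * l \<le> norm x0 + 1" using l by (simp only: mult_le_cancel_right)
      then show ?thesis using k(1) by (simp add: Q_def l_def[symmetric] pos_le_divide_eq mult.commute le_max_iff_disj)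
    qed (simp add: Q_def)
    define S where "S = sqrt (norm x0 + 3 * Q + 1)"
    have Q1: "Q \<ge> 1" by (simp add: Q_def)
    have S: "S > 0" unfolding S_def using Q1 by (auto intro!: add_nonneg_pos add_nonneg_nonneg)
    have lip: "k * norm (\<sigma> j - \<sigma> i) \<le> ?d (\<sigma> i) (\<sigma> j) * S" if "N1 \<le> i" "N1 \<le> j" for i j
    proof -
      have "norm (\<sigma> i) \<le> norm x0 + Q" using norm_triangle_sub[of "\<sigma> i" x0] bd[OF that(1)] by simp
      moreover have "norm (\<sigma> j - \<sigma> i) \<le> Q + Q"
        using norm_triangle_ineq4[of "\<sigma> j - x0" "\<sigma> i - x0"] bd[OF that(1)] bd[OF that(2)] by simp
      ultimately have "sqrt (norm (\<sigma> i) + norm (\<sigma> j - \<sigma> i)) \<le> S" unfolding S_def by (intro real_sqrt_le_mono) linarith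
      then have "?d (\<sigma> i) (\<sigma> j) * sqrt (norm (\<sigma> i) + norm (\<sigma> j - \<sigma> i)) \<le> ?d (\<sigma> i) (\<sigma> j) * S"
        by (intro mult_left_mono) auto
      then show ?thesis using kd[of "\<sigma> j" "\<sigma> i"] by linarith
    qed
    have "Cauchy \<sigma>"
      unfolding Cauchy_def
    proof (intro allI impI)
      fix e :: real assume e: "e > 0"
      obtain N2 where N2: "\<And>i j. N2 \<le> i \<Longrightarrow> N2 \<le> j \<Longrightarrow> ?d (\<sigma> i) (\<sigma> j) < k * e / S" using cau[of "k * e / S"] e k(1) S by auto
      have "dist (\<sigma> i) (\<sigma> j) < e" if ij: "max N1 N2 \<le> i" "max N1 N2 \<le> j" for i j
      proof -
        have "k * norm (\<sigma> i - \<sigma> j) \<le> ?d (\<sigma> j) (\<sigma> i) * S" using ij by (intro lip) auto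
        also have "\<dots> < k * e" using N2[of j i] ij S by (simp add: pos_less_divide_eq)
        finally show ?thesis using k(1) by (simp add: dist_norm)
      qed
      then show "\<exists>M. \<forall>i\<ge>M. \<forall>j\<ge>M. dist (\<sigma> i) (\<sigma> j) < e" by blast
    qed
    then obtain z where z: "\<sigma> \<longlonglongrightarrow> z" using Cauchy_convergent convergent_def by blast
    have "limitin mtopology \<sigma> z sequentially"
      unfolding limit_metric_sequentially
    proof (intro conjI allI impI)
      fix e :: real assume e: "e > 0"
      obtain r where r: "r > 0" "\<And>y. norm (y - z) < r \<Longrightarrow> action_potential m h z y < ennreal e"
        using action_potential_small_nearby[of m, OF dim m h e, of z] by blast
      obtain N where N: "\<And>i. N \<le> i \<Longrightarrow> norm (\<sigma> i - z) < r" using z r(1) unfolding LIMSEQ_iff by blast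
      have "\<sigma> i \<in> UNIV \<and> ?d (\<sigma> i) z < e" if "N \<le> i" for i
      proof -
        have "ennreal (?d z (\<sigma> i)) < ennreal e"
          by (rule ord_eq_less_trans[OF fin[symmetric] r(2)[OF N[OF that]]])
        then have "?d z (\<sigma> i) < e" by (simp only: ennreal_less_iff[OF enn2real_nonneg])
        then show ?thesis by (simp only: commute[of "\<sigma> i" z] UNIV_I simp_thms)
      qed
      then show "\<exists>N. \<forall>i\<ge>N. \<sigma> i \<in> UNIV \<and> ?d (\<sigma> i) z < e" by blast
    qed simp
    then show "\<exists>x. limitin mtopology \<sigma> x sequentially" ..
  qed
qed

theorem proposition5p1:
  fixes m :: "'n::{finite,linorder} \<Rightarrow> real" and h :: real
  assumes "DIM('e::euclidean_space) \<ge> 2"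
    and "CARD('n) \<ge> 2"
    and "\<And>i. m i > 0"
    and "h \<ge> 0"
  shows "(\<forall>x y :: ('e, 'n) vec. action_potential m h x y < \<infinity>) \<and>
    (\<forall>x \<in> collision_free m. \<forall>y \<in> collision_free m. jm_dist m h x (y :: ('e, 'n) vec) < \<infinity>) \<and>
    is_metric_completion
      (collision_free m :: (('e, 'n) vec) set) (\<lambda>x y. enn2real (jm_dist m h x y))
      (UNIV :: (('e, 'n) vec) set) (\<lambda>x y. enn2real (action_potential m h x y))
      (\<lambda>x. x)"
proof (intro conjI)
  let ?\<Omega> = "collision_free m :: ('e, 'n) vec set"
  let ?d = "\<lambda>x y :: ('e, 'n) vec. enn2real (action_potential m h x y)"
  let ?d\<Omega> = "\<lambda>x y :: ('e, 'n) vec. enn2real (jm_dist m h x y)"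
  note fin = action_potential_finite[of m, OF assms(1,3,4)]
  have eq: "jm_dist m h x y = action_potential m h x y" if "x \<in> ?\<Omega>" "y \<in> ?\<Omega>" for x y
    by (rule jm_dist_eq_action_potential[of m, OF assms that])
  show "\<forall>x y :: ('e, 'n) vec. action_potential m h x y < \<infinity>" using fin by blast
  then show "\<forall>x\<in>?\<Omega>. \<forall>y\<in>?\<Omega>. jm_dist m h x y < \<infinity>" using eq by simp
  interpret Metric_space UNIV ?d by (rule Metric_space_action_potential[of m, OF assms])
  \<comment> \<open>Symmetry is required for all arguments, so the value \<open>0\<close> that represents infinity at collisions enters.\<close>
  have "Metric_space ?\<Omega> ?d\<Omega>"
  proof
    fix x y z :: "('e, 'n) vec"
    show "0 \<le> ?d\<Omega> x y" by simp
    show "?d\<Omega> x y = ?d\<Omega> y x"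
    proof (cases "x \<in> ?\<Omega> \<and> y \<in> ?\<Omega>")
      case True
      then show ?thesis by (simp add: eq commute)
    next
      case False
      then show ?thesis by (auto simp: jm_dist_outside)
    qed
    show "?d\<Omega> x y = 0 \<longleftrightarrow> x = y" if "x \<in> ?\<Omega>" "y \<in> ?\<Omega>" using that by (simp add: eq)
    show "?d\<Omega> x z \<le> ?d\<Omega> x y + ?d\<Omega> y z" if "x \<in> ?\<Omega>" "y \<in> ?\<Omega>" "z \<in> ?\<Omega>"
      using that triangle[of x y z] by (simp add: eq)
  qed
  moreover have "mtopology closure_of ((\<lambda>x. x) ` ?\<Omega>) = UNIV"
  proof -
    have "\<exists>y\<in>?\<Omega>. y \<in> mball x e" if e: "e > 0" for x e
    proof -
      obtain r where r: "r > 0" "\<And>y. norm (y - x) < r \<Longrightarrow> action_potential m h x y < ennreal e"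
        using action_potential_small_nearby[of m, OF assms(1,3,4) e, of x] by blast
      obtain y where y: "y \<in> ?\<Omega>" "norm (y - x) < r" using collision_free_dense[of m, OF assms(3) r(1)] by blast
      have "?d x y < e" using r(2)[OF y(2)] fin[of x y] e
        by (cases "action_potential m h x y") (auto simp: ennreal_less_iff)
      then show ?thesis using y(1) by (auto simp: in_mball)
    qed
    then show ?thesis by (auto simp: metric_closure_of)
  qed
  ultimately show "is_metric_completion ?\<Omega> ?d\<Omega> UNIV ?d (\<lambda>x. x)"
    unfolding is_metric_completion_def
    using Metric_space_action_potential[of m, OF assms] action_potential_mcomplete[of m, OF assms] eq by auto
qed

end
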